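(* For every given $\boldsymbol\mu\in\mathcal P$ and observation $y_d\in L^2(0,T;Y_{\mathrm{obs}})$, there exists a unique pair $(y,p)\in\mathcal Y_0\times\mathcal Y_T$ such that $$\mathcal B((y,p),(z,q);\boldsymbol\mu)=\langle\mathcal F(\boldsymbol\mu),(z,q)\rangle\qquad\text{for all }(z,q)\in\mathcal Q\times\mathcal Q .$$
   Context: Let $\mathcal P\subset\mathbb R^{d}$ be a parameter set, $\Omega\subset\mathbb R^n$ ($n=1,2,3$) an open bounded regular domain, $T>0$, $\Omega_{\mathrm{obs}}\subseteq\Omega$ the observation domain, $\Omega_u\subset\overline\Omega$ the control domain, and $0<\alpha\le1$ fixed. $Y$ and $H$ are separable Hilbert spaces over $\Omega$ with continuous embeddings $Y\hookrightarrow H\hookrightarrow Y^*$ ($H$ the pivot space), $U$ is a Hilbert space over $\Omega_u$, and $Y_{\mathrm{obs}}$ is a Hilbert space of observations; $Y,H,U$ are contained in $L^2$. Moreover $Y\subseteq Y_{\mathrm{obs}}$ and $Y\subseteq U$, with constants $c_{\mathrm{obs}},c_u>0$ (possibly depending on $\boldsymbol\mu$) such that $\|y\|_{Y_{\mathrm{obs}}}\le c_{\mathrm{obs}}\|y\|_Y$ and $\|y\|_U\le c_u\|y\|_Y$ for all $y\in Y$. Spaces: $\mathcal Q=L^2(0,T;Y)$; $\mathcal Y_0=\{y\in L^2(0,T;Y):\partial_t y\in L^2(0,T;Y^* ),\ y(0)=0\}$; $\mathcal Y_T=\{p\in L^2(0,T;Y):\partial_t p\in L^2(0,T;Y^* ),\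 p(T)=0\}$. Norms: $\|z\|_{\mathcal Q}^2=\int_0^T\|z\|_Y^2\,dt$ and $\|y\|_{\mathcal Y_0}^2=\int_0^T\|y\|_Y^2\,dt+\int_0^T\|\partial_t y\|_{Y^*}^2\,dt$, with the same expression for $\|\cdot\|_{\mathcal Y_T}$. Forms, for each $\boldsymbol\mu\in\mathcal P$: - $a(\cdot,\cdot;\boldsymbol\mu):Y\times Y\to\mathbb R$ is bilinear, continuous with constant $c_a(\boldsymbol\mu)$ and coercive with constant $\gamma_a(\boldsymbol\mu)>0$. - $s(y,q;\boldsymbol\mu)=\langle S(\boldsymbol\mu)\,\partial_t y,q\rangle_{Y^*,Y}$, where $S(\boldsymbol\mu):Y^*\to Y^*$ is self-adjoint and acts as multiplication by $\sum_{i=1}^{Q_S}c_S^i(\boldsymbol\mu)\chi_{\Omega_S^i}$ with $c_S^i(\boldsymbol\mu)>0$ and $\bigcup_i\Omega_S^i=\Omega$ (it is the identity when there is no geometrical parametrization). - $c(\cdot,\cdot;\boldsymbol\mu):U\times Y\to\mathbb R$ is bilinear, continuous with constant $c_c(\boldsymbol\mu)$, and is the $L^2$ scalar product over $\Omega_u$ weighted by $\sum_{i=1}^{Q_C}c_C^i(\boldsymbol\mu)\chi_{\Omega_C^i}$ with $c_C^i(\boldsymbol\mu)>0$ and $\bigcup_i\Omega_C^i=\Omega_u$; since $Y\subseteq U$, $c(p,z;\boldsymbol\mu)$ is defined for $p,z\in Y$. - $m(\cdot,\cdot;\boldsymbol\mu):Y\times Y\to\mathbb R$ is bilinear, symmetric,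 positive semidefinite, continuous with constant $c_m(\boldsymbol\mu)$, and is the (possibly positively weighted, because of pull-back to $\Omega$) $L^2$ scalar product over $\Omega_{\mathrm{obs}}$; it is also defined and continuous with first argument in $Y_{\mathrm{obs}}$. If $\Omega_u=\Omega_{\mathrm{obs}}$, then $c$ and $m$ coincide. The space-time optimality bilinear form is $$\mathcal B((y,p),(z,q);\boldsymbol\mu)=\int_0^T\Big[s(y,z;\boldsymbol\mu)+a(y,z;\boldsymbol\mu)-\tfrac1\alpha c(p,z;\boldsymbol\mu)+m(y,q;\boldsymbol\mu)-s(p,q;\boldsymbol\mu)+a(q,p;\boldsymbol\mu)\Big]dt ,$$ and the right-hand side is the continuous linear functional on $\mathcal Q\times\mathcal Q$ $$\langle\mathcal F(\boldsymbol\mu),(z,q)\rangle=\int_0^T m(y_d,q;\boldsymbol\mu)\,dt+\int_0^T\langle G(\boldsymbol\mu),z\rangle_{Y^*,Y}\,dt ,$$ where $G(\boldsymbol\mu)$ is a given $Y^*$-valued datum (forcing and boundary terms) such that $z\mapsto\int_0^T\langle G(\boldsymbol\mu),z\rangle_{Y^*,Y}\,dt$ is continuous on $\mathcal Q$. This problem is the optimality system, after elimination of the control, of a parametrized parabolic linear-quadratic optimal control problem with state $y$ and adjoint $p$. *)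

theory Defs
  imports "HOL-Analysis.Analysis"
begin

section \<open>Spaces of functions of the space variable\<close>

definition square_integrable :: "'a measure \<Rightarrow> ('a \<Rightarrow> real) \<Rightarrow> bool" where
  "square_integrable M f \<longleftrightarrow> f \<in> borel_measurable M \<and> integrable M (\<lambda>x. (f x)\<^sup>2)"

text \<open>
  A Hilbert space contained in \<open>L\<^sup>2(M)\<close> is an abstract Hilbert space \<open>'v\<close> together with a map \<open>r\<close>
  that sends each vector to a function representing it; \<open>r\<close> is linear and injective
  modulo equality almost everywhere.
\<close>

definition contained_in_L2 :: "'a measure \<Rightarrow> ('v::real_vector \<Rightarrow> 'a \<Rightarrow> real) \<Rightarrow> bool" where
  "contained_in_L2 M r \<longleftrightarrow>
     (\<forall>v. square_integrable M (r v)) \<and>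
     (\<forall>u v. AE x in M. r (u + v) x = r u x + r v x) \<and>
     (\<forall>k v. AE x in M. r (k *\<^sub>R v) x = k * r v x) \<and>
     (\<forall>v. (AE x in M. r v x = 0) \<longrightarrow> v = 0)"

text \<open>
  The measure that defines \<open>L\<^sup>2(\<Omega>\<^sub>u)\<close>. Inside \<open>\<Omega>\<close> it is Lebesgue measure. The control domain is
  only required to lie in the closure of \<open>\<Omega>\<close>; on a part of the boundary any measure is allowed, in
  particular surface measure, so that boundary control is covered.
\<close>

definition control_measure ::
  "'a::euclidean_space set \<Rightarrow> 'a set \<Rightarrow> 'a measure \<Rightarrow> bool" where
  "control_measure \<Omega> \<Omega>u \<nu> \<longleftrightarrow>
     \<Omega>u \<in> sets borel \<and> space \<nu> = \<Omega>u \<and>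
     (\<forall>B \<in> sets borel. B \<inter> \<Omega>u \<in> sets \<nu>) \<and>
     (\<forall>B \<in> sets borel. B \<subseteq> \<Omega> \<inter> \<Omega>u \<longrightarrow> emeasure \<nu> B = emeasure lborel B)"

definition piecewise_weight ::
  "nat \<Rightarrow> (nat \<Rightarrow> 'p \<Rightarrow> real) \<Rightarrow> (nat \<Rightarrow> 'a set) \<Rightarrow> 'p \<Rightarrow> 'a \<Rightarrow> real" where
  "piecewise_weight N k D \<mu> x = (\<Sum>i<N. k i \<mu> * indicator (D i) x)"

text \<open>
  The embedding \<open>H \<hookrightarrow> Y\<^sup>*\<close> obtained by identifying \<open>H\<close> with its own dual, where
  \<open>j\<close> is the embedding of \<open>Y\<close> into \<open>H\<close>.
\<close>

definition pivot ::
  "('y::real_normed_vector \<Rightarrow> 'h::real_inner) \<Rightarrow> 'h \<Rightarrow> 'y \<Rightarrow>\<^sub>L real" where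
  "pivot j h = Blinfun (\<lambda>v. h \<bullet> j v)"


section \<open>Bochner spaces on the time interval\<close>

definition strongly_measurable ::
  "'a measure \<Rightarrow> ('a \<Rightarrow> 'v::topological_space) \<Rightarrow> bool" where
  "strongly_measurable M f \<longleftrightarrow>
     (\<exists>s. (\<forall>i. simple_function M (s i)) \<and> (AE t in M. (\<lambda>i::nat. s i t) \<longlonglongrightarrow> f t))"

text \<open>Elements are functions; equality in the Bochner space is equality almost everywhere.\<close>

definition L2_time :: "real \<Rightarrow> (real \<Rightarrow> 'v::real_normed_vector) set" where
  "L2_time T = {f. strongly_measurable (lebesgue_on {0<..<T}) f \<and>
                   integrable (lebesgue_on {0<..<T}) (\<lambda>t. (norm (f t))\<^sup>2)}"

definition L2_time_norm :: "real \<Rightarrow> (real \<Rightarrow> 'v::real_normed_vector) \<Rightarrow> real" where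
  "L2_time_norm T f = sqrt (LINT t|lebesgue_on {0<..<T}. (norm (f t))\<^sup>2)"

definition test_function :: "real \<Rightarrow> (real \<Rightarrow> real) \<Rightarrow> bool" where
  "test_function T \<phi> \<longleftrightarrow>
     (\<forall>k x. ((deriv ^^ k) \<phi>) differentiable (at x)) \<and>
     (\<exists>a b. 0 < a \<and> b < T \<and> (\<forall>x. x \<notin> {a..b} \<longrightarrow> \<phi> x = 0))"

text \<open>
  \<open>g = \<partial>\<^sub>t y\<close> as \<open>Y\<^sup>*\<close>-valued distributions on \<open>(0,T)\<close>: the identity
  \<open>\<integral> \<phi>' y dt = - \<integral> \<phi> g dt\<close> in \<open>Y\<^sup>*\<close>, where \<open>y(t)\<close> acts on \<open>v\<close> through the inner product of
  the pivot space, tested with every \<open>v\<close> in \<open>Y\<close>. (The library's Bochner integral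
  requires a second countable type, of which the type of bounded functionals is not an instance.)
\<close>

definition has_time_derivative ::
  "real \<Rightarrow> ('y::real_normed_vector \<Rightarrow> 'h::real_inner) \<Rightarrow>
   (real \<Rightarrow> 'y) \<Rightarrow> (real \<Rightarrow> 'y \<Rightarrow>\<^sub>L real) \<Rightarrow> bool" where
  "has_time_derivative T j y g \<longleftrightarrow>
     (\<forall>\<phi> v. test_function T \<phi> \<longrightarrow>
        (LINT t|lebesgue_on {0<..<T}. deriv \<phi> t * blinfun_apply (pivot j (j (y t))) v) =
        - (LINT t|lebesgue_on {0<..<T}. \<phi> t * blinfun_apply (g t) v))"

text \<open>Determined up to equality almost everywhere.\<close>

definition time_derivative ::
  "real \<Rightarrow> ('y::real_normed_vector \<Rightarrow> 'h::real_inner) \<Rightarrow>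
   (real \<Rightarrow> 'y) \<Rightarrow> (real \<Rightarrow> 'y \<Rightarrow>\<^sub>L real)" where
  "time_derivative T j y = (SOME g. g \<in> L2_time T \<and> has_time_derivative T j y g)"

text \<open>The value at time \<open>\<tau>\<close> is that of the representative in \<open>C([0,T];H)\<close>.\<close>

definition vanishes_at ::
  "real \<Rightarrow> ('y \<Rightarrow> 'h::real_normed_vector) \<Rightarrow> real \<Rightarrow> (real \<Rightarrow> 'y) \<Rightarrow> bool" where
  "vanishes_at T j \<tau> y \<longleftrightarrow>
     (\<exists>w. continuous_on {0..T} w \<and>
          (AE t in lebesgue_on {0<..<T}. w t = j (y t)) \<and> w \<tau> = 0)"

definition W_space ::
  "real \<Rightarrow> ('y::real_normed_vector \<Rightarrow> 'h::real_inner) \<Rightarrow> (real \<Rightarrow> 'y) set" where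
  "W_space T j = {y \<in> L2_time T. \<exists>g \<in> L2_time T. has_time_derivative T j y g}"

definition state_space ::
  "real \<Rightarrow> ('y::real_normed_vector \<Rightarrow> 'h::real_inner) \<Rightarrow> (real \<Rightarrow> 'y) set" where
  "state_space T j = {y \<in> W_space T j. vanishes_at T j 0 y}"

definition adjoint_space ::
  "real \<Rightarrow> ('y::real_normed_vector \<Rightarrow> 'h::real_inner) \<Rightarrow> (real \<Rightarrow> 'y) set" where
  "adjoint_space T j = {p \<in> W_space T j. vanishes_at T j T p}"


section \<open>The parametrized problem\<close>

text \<open>
  \<open>Y\<close>, \<open>H\<close>, \<open>U\<close>, \<open>Y\<^sub>o\<^sub>b\<^sub>s\<close> are the types \<open>'y\<close>, \<open>'h\<close>, \<open>'u\<close>, \<open>'o\<close>. The inclusions of \<open>Y\<close> are the maps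
  \<open>j\<close> (into \<open>H\<close>), \<open>tr\<close> (into \<open>U\<close>) and \<open>ob\<close> (into \<open>Y\<^sub>o\<^sub>b\<^sub>s\<close>); the last two restrict a function to
  a subdomain and need not be injective. The functions represented by elements of \<open>H\<close> and \<open>U\<close> are
  given by \<open>rH\<close> and \<open>rU\<close>, those of \<open>Y\<close> by \<open>rH \<circ> j\<close>.
\<close>

locale ocp_spaces =
  fixes \<Omega> \<Omega>obs \<Omega>u :: "(real^'n) set"
    and \<nu> :: "(real^'n) measure"
    and j :: "'y::{real_inner,complete_space,second_countable_topology}
              \<Rightarrow> 'h::{real_inner,complete_space,second_countable_topology}"
    and tr :: "'y \<Rightarrow> 'u::{real_inner,complete_space}"
    and ob :: "'y \<Rightarrow> 'o::{real_inner,complete_space}"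
    and rH :: "'h \<Rightarrow> real^'n \<Rightarrow> real"
    and rU :: "'u \<Rightarrow> real^'n \<Rightarrow> real"
  assumes dimension: "CARD('n) \<in> {1, 2, 3}"
    and domain: "open \<Omega>" "bounded \<Omega>" "connected \<Omega>" "\<Omega> \<noteq> {}"
    and observation_domain: "\<Omega>obs \<subseteq> \<Omega>" "\<Omega>obs \<in> sets lebesgue"
    and control_domain: "\<Omega>u \<subseteq> closure \<Omega>" "control_measure \<Omega> \<Omega>u \<nu>"
    and H_in_L2: "contained_in_L2 (lebesgue_on \<Omega>) rH"
    and U_in_L2: "contained_in_L2 \<nu> rU"
    and Y_in_H: "bounded_linear j" "inj j"
    and H_in_dual: "inj (pivot j)"
    and Y_in_U: "bounded_linear tr" "\<And>y. AE x in \<nu>. x \<in> \<Omega> \<longrightarrow> rU (tr y) x = rH (j y) x"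
    and Y_in_Yobs: "bounded_linear ob"

locale parabolic_ocp = ocp_spaces \<Omega> \<Omega>obs \<Omega>u \<nu> j tr ob rH rU
  for \<Omega> \<Omega>obs \<Omega>u :: "(real^'n) set"
    and \<nu> :: "(real^'n) measure"
    and j :: "'y::{real_inner,complete_space,second_countable_topology}
              \<Rightarrow> 'h::{real_inner,complete_space,second_countable_topology}"
    and tr :: "'y \<Rightarrow> 'u::{real_inner,complete_space}"
    and ob :: "'y \<Rightarrow> 'o::{real_inner,complete_space}"
    and rH :: "'h \<Rightarrow> real^'n \<Rightarrow> real"
    and rU :: "'u \<Rightarrow> real^'n \<Rightarrow> real" +
  fixes P :: "(real^'d) set"
    and T :: real
    and a :: "real^'d \<Rightarrow> 'y \<Rightarrow> 'y \<Rightarrow> real"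
    and S :: "real^'d \<Rightarrow> ('y \<Rightarrow>\<^sub>L real) \<Rightarrow> ('y \<Rightarrow>\<^sub>L real)"
    and QS :: nat and cS :: "nat \<Rightarrow> real^'d \<Rightarrow> real" and \<Omega>S :: "nat \<Rightarrow> (real^'n) set"
    and c :: "real^'d \<Rightarrow> 'u \<Rightarrow> 'y \<Rightarrow> real"
    and QC :: nat and cC :: "nat \<Rightarrow> real^'d \<Rightarrow> real" and \<Omega>C :: "nat \<Rightarrow> (real^'n) set"
    and m :: "real^'d \<Rightarrow> 'o \<Rightarrow> 'y \<Rightarrow> real"
    and wm :: "real^'d \<Rightarrow> real^'n \<Rightarrow> real"
    and G :: "real^'d \<Rightarrow> real \<Rightarrow> 'y \<Rightarrow>\<^sub>L real"
  assumes a_continuous: "\<mu> \<in> P \<Longrightarrow> bounded_bilinear (a \<mu>)"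
    and a_coercive: "\<mu> \<in> P \<Longrightarrow> \<exists>\<gamma>>0. \<forall>y. \<gamma> * (norm y)\<^sup>2 \<le> a \<mu> y y"
    and S_subdomains: "\<And>i. i < QS \<Longrightarrow> \<Omega>S i \<in> sets lebesgue" "(\<Union>i<QS. \<Omega>S i) = \<Omega>"
    and S_positive: "\<And>i. \<mu> \<in> P \<Longrightarrow> i < QS \<Longrightarrow> cS i \<mu> > 0"
    and S_continuous: "\<mu> \<in> P \<Longrightarrow> bounded_linear (S \<mu>)"
    and S_selfadjoint: "\<And>y z. \<mu> \<in> P \<Longrightarrow>
          blinfun_apply (S \<mu> (pivot j (j y))) z = blinfun_apply (S \<mu> (pivot j (j z))) y"
    and S_multiplication: "\<And>h. \<mu> \<in> P \<Longrightarrow>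
          \<exists>h'. (AE x in lebesgue_on \<Omega>. rH h' x = piecewise_weight QS cS \<Omega>S \<mu> x * rH h x) \<and>
               S \<mu> (pivot j h) = pivot j h'"
    and c_continuous: "\<mu> \<in> P \<Longrightarrow> bounded_bilinear (c \<mu>)"
    and c_subdomains: "\<And>i. i < QC \<Longrightarrow> \<Omega>C i \<in> sets \<nu>" "(\<Union>i<QC. \<Omega>C i) = \<Omega>u"
    and c_positive: "\<And>i. \<mu> \<in> P \<Longrightarrow> i < QC \<Longrightarrow> cC i \<mu> > 0"
    and c_weighted: "\<And>u z. \<mu> \<in> P \<Longrightarrow>
          has_bochner_integral \<nu>
            (\<lambda>x. piecewise_weight QC cC \<Omega>C \<mu> x * rU u x * rU (tr z) x) (c \<mu> u z)"
    and m_continuous: "\<mu> \<in> P \<Longrightarrow> bounded_bilinear (m \<mu>)"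
    and m_symmetric: "\<And>y z. \<mu> \<in> P \<Longrightarrow> m \<mu> (ob y) z = m \<mu> (ob z) y"
    and m_semidefinite: "\<And>y. \<mu> \<in> P \<Longrightarrow> 0 \<le> m \<mu> (ob y) y"
    and m_weight: "\<mu> \<in> P \<Longrightarrow> wm \<mu> \<in> borel_measurable (lebesgue_on \<Omega>obs)"
                  "\<And>x. \<mu> \<in> P \<Longrightarrow> x \<in> \<Omega>obs \<Longrightarrow> wm \<mu> x > 0"
    and m_weighted: "\<And>y z. \<mu> \<in> P \<Longrightarrow>
          has_bochner_integral (lebesgue_on \<Omega>obs)
            (\<lambda>x. wm \<mu> x * rH (j y) x * rH (j z) x) (m \<mu> (ob y) z)"
    and c_eq_m: "\<And>y z. \<mu> \<in> P \<Longrightarrow> \<Omega>u = \<Omega>obs \<Longrightarrow> c \<mu> (tr y) z = m \<mu> (ob y) z"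
    and G_continuous: "\<mu> \<in> P \<Longrightarrow>
          \<exists>K. \<forall>z \<in> L2_time T.
            integrable (lebesgue_on {0<..<T}) (\<lambda>t. blinfun_apply (G \<mu> t) (z t)) \<and>
            \<bar>LINT t|lebesgue_on {0<..<T}. blinfun_apply (G \<mu> t) (z t)\<bar> \<le> K * L2_time_norm T z"

text \<open>
  In the following definitions \<open>S\<close>, \<open>a\<close>, \<open>c\<close>, \<open>m\<close>, \<open>G\<close> are the data at one fixed parameter.
\<close>

definition optimality_form ::
  "real \<Rightarrow> real \<Rightarrow> ('y::real_normed_vector \<Rightarrow> 'h::real_inner) \<Rightarrow> ('y \<Rightarrow> 'u) \<Rightarrow> ('y \<Rightarrow> 'o) \<Rightarrow>
   (('y \<Rightarrow>\<^sub>L real) \<Rightarrow> ('y \<Rightarrow>\<^sub>L real)) \<Rightarrow> ('y \<Rightarrow> 'y \<Rightarrow> real) \<Rightarrow>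
   ('u \<Rightarrow> 'y \<Rightarrow> real) \<Rightarrow> ('o \<Rightarrow> 'y \<Rightarrow> real) \<Rightarrow>
   (real \<Rightarrow> 'y) \<times> (real \<Rightarrow> 'y) \<Rightarrow> (real \<Rightarrow> 'y) \<times> (real \<Rightarrow> 'y) \<Rightarrow> real" where
  "optimality_form T \<alpha> j tr ob S a c m = (\<lambda>(y, p) (z, q).
     LINT t|lebesgue_on {0<..<T}.
         blinfun_apply (S (time_derivative T j y t)) (z t)
       + a (y t) (z t)
       - (1 / \<alpha>) * c (tr (p t)) (z t)
       + m (ob (y t)) (q t)
       - blinfun_apply (S (time_derivative T j p t)) (q t)
       + a (q t) (p t))"

definition optimality_rhs ::
  "real \<Rightarrow> ('o \<Rightarrow> 'y::real_normed_vector \<Rightarrow> real) \<Rightarrow> (real \<Rightarrow> 'y \<Rightarrow>\<^sub>L real) \<Rightarrow>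
   (real \<Rightarrow> 'o) \<Rightarrow> (real \<Rightarrow> 'y) \<times> (real \<Rightarrow> 'y) \<Rightarrow> real" where
  "optimality_rhs T m G yd = (\<lambda>(z, q).
     (LINT t|lebesgue_on {0<..<T}. m (yd t) (q t)) +
     (LINT t|lebesgue_on {0<..<T}. blinfun_apply (G t) (z t)))"

definition solves_optimality ::
  "real \<Rightarrow> real \<Rightarrow> ('y::real_normed_vector \<Rightarrow> 'h::real_inner) \<Rightarrow>
   ('y \<Rightarrow> 'u) \<Rightarrow> ('y \<Rightarrow> 'o::real_normed_vector) \<Rightarrow>
   (('y \<Rightarrow>\<^sub>L real) \<Rightarrow> ('y \<Rightarrow>\<^sub>L real)) \<Rightarrow> ('y \<Rightarrow> 'y \<Rightarrow> real) \<Rightarrow>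
   ('u \<Rightarrow> 'y \<Rightarrow> real) \<Rightarrow> ('o \<Rightarrow> 'y \<Rightarrow> real) \<Rightarrow> (real \<Rightarrow> 'y \<Rightarrow>\<^sub>L real) \<Rightarrow>
   (real \<Rightarrow> 'o) \<Rightarrow> (real \<Rightarrow> 'y) \<times> (real \<Rightarrow> 'y) \<Rightarrow> bool" where
  "solves_optimality T \<alpha> j tr ob S a c m G yd yp \<longleftrightarrow>
     (\<forall>z \<in> L2_time T. \<forall>q \<in> L2_time T.
        optimality_form T \<alpha> j tr ob S a c m yp (z, q) = optimality_rhs T m G yd (z, q))"

end

theory Submission
  imports Defs
begin

text \<open>
  Write \<open>J\<close> for the Riesz representative on \<open>Y\<close> of the inner product of \<open>H\<close>, and \<open>V\<close>, \<open>W\<close> for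
  integration over \<open>(0,t)\<close> and over \<open>(t,T)\<close> in \<open>L\<^sup>2(0,T;Y)\<close>; \<open>W\<close> is the adjoint of \<open>V\<close>. After Riesz
  representation, \<open>y\<close> is a state with time derivative \<open>g\<close> iff \<open>J y = V g\<close>, and \<open>p\<close> is an adjoint
  with time derivative \<open>-k\<close> iff \<open>J p = W k\<close>. The whole problem thus becomes one for commuting
  bounded operators on a Hilbert space.

  Integration by parts and the energy inequality follow from \<open>\<langle>V g, g\<rangle> \<ge> 0\<close> by approximating
  \<open>(g, y)\<close> with \<open>(J d, V d)\<close>, where \<open>\<epsilon> d + V d = y\<close>. They give uniqueness: testing with
  \<open>(p, y)\<close> yields \<open>c(p,p) / \<alpha> + m(y,y) = 0\<close>, which decouples the two equations. For existence,
  testing with \<open>(a + s b, b - s a)\<close> for large \<open>s\<close> makes the adjoint of the weak formulation coercive,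
  and a minimization argument of Lions type produces the solution.

  The operator \<open>S\<close> multiplies by a function with finitely many values, all positive, so it is annihilated
  by a polynomial with positive roots; hence it is invertible and \<open>S J\<close> is positive semidefinite.
\<close>

section \<open>Hilbert spaces and the abstract optimality system\<close>

text \<open>The trial spaces carry end conditions and a derivative in the dual, whereas the test
  space is plain L2, so coercivity cannot be applied directly. An equation of the form
  \<open>B y = V (...)\<close> removes this asymmetry: the unknown is a mere element of L2, and
  derivative, regularity and initial value are contained in one operator equation. The obstacle is
  that \<open>y\<close> itself has no time derivative with values in Y, only \<open>J y\<close> has
  one, so an energy identity for the solution is not directly available. The resolvent of
  \<open>V\<close> supplies regular approximations, and it commutes with \<open>B\<close>.
  \<open>S\<close> is absorbed by taking for \<open>B\<close> the product of \<open>S\<close> and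
  \<open>J\<close>: the system then looks as it does without \<open>S\<close>, and the inverse of
  \<open>S\<close> serves to recover the time derivative. L2 is taken over the whole line because a
  type cannot depend on \<open>T\<close>; the integration operators are extended by the identity
  outside the interval, and the solution is restricted afterwards.\<close>

lemma affine_nonneg_imp_zero:
  fixes b c :: real
  assumes "\<And>t. 0 \<le> 2 * t * b + t\<^sup>2 * c"
  shows "b = 0"
proof (rule ccontr)
  assume b: "b \<noteq> 0"
  \<comment> \<open>Positive and above \<open>c\<close> whatever the sign of \<open>c\<close>, so
    that at \<open>t = - b / k\<close> the linear term outweighs the quadratic one.\<close>
  define k where "k = \<bar>c\<bar> + 1"
  have k: "k > 0" "c < k" unfolding k_def by auto
  have "0 \<le> 2 * (- b / k) * b + (- b / k)\<^sup>2 * c" by (rule assms)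
  also have "\<dots> = (b\<^sup>2 / k) * (c / k - 2)"
    using k by (simp add: field_simps power2_eq_square)
  also have "\<dots> < 0"
    using k b by (intro mult_pos_neg) (auto simp: field_simps)
  finally show False by simp
qed

text \<open>The vector \<open>u\<close> is the limit of \<open>K\<close> along a minimizing sequence of \<open>\<parallel>K \<phi>\<parallel>\<^sup>2 - 2 F \<phi>\<close>.\<close>

lemma lions_projection:
  fixes K :: "'f::real_vector \<Rightarrow> 'x::{real_inner,complete_space}" and F :: "'f \<Rightarrow> real"
  assumes K: "linear K" and F: "linear F" and bound: "\<And>\<phi>. \<bar>F \<phi>\<bar> \<le> C * norm (K \<phi>)"
  obtains u \<phi> where "(\<lambda>n. K (\<phi> n)) \<longlonglongrightarrow> u" and "\<And>\<psi>. u \<bullet> K \<psi> = F \<psi>"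
proof -
  define J where "J \<phi> = (norm (K \<phi>))\<^sup>2 - 2 * F \<phi>" for \<phi>
  have J_lower: "- C\<^sup>2 \<le> J \<phi>" for \<phi>
  proof -
    have "0 \<le> (norm (K \<phi>) - C)\<^sup>2" by simp
    then show ?thesis using bound[of \<phi>] unfolding J_def by (simp add: power2_eq_square algebra_simps)
  qed
  define m where "m = Inf (range J)"
  have bdd: "bdd_below (range J)" using J_lower by (auto intro!: bdd_belowI)
  have m_le: "m \<le> J \<phi>" for \<phi> unfolding m_def by (rule cInf_lower[OF _ bdd]) simp
  have "\<exists>\<phi>. J \<phi> < m + 1 / real (Suc n)" for n
    using cInf_less_iff[OF _ bdd, of "m + 1 / real (Suc n)"] by (auto simp: m_def)
  then obtain \<phi> where \<phi>: "\<And>n. J (\<phi> n) < m + 1 / real (Suc n)" by metis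
  have J_add: "J (x + t *\<^sub>R y) = J x + 2 * t * (K x \<bullet> K y - F y) + t\<^sup>2 * (norm (K y))\<^sup>2" for x y t
    unfolding J_def power2_norm_eq_inner using K F
    by (simp add: linear_add linear_scale inner_add_left inner_add_right
        inner_commute power2_eq_square algebra_simps)
  \<comment> \<open>Parallelogram identity; the linear part of \<open>J\<close> cancels at the
    midpoint. Near-minimizers thus have close images under \<open>K\<close>, while \<open>'f\<close>
    carries no topology in which \<open>\<phi> n\<close> could converge.\<close>
  have par: "(norm (K x - K y))\<^sup>2 = 2 * J x + 2 * J y - 4 * J ((1/2) *\<^sub>R (x + y))" for x y
    unfolding J_def power2_norm_eq_inner using K F
    by (simp add: linear_add linear_scale linear_diff inner_add_left inner_add_right
        inner_diff_left inner_diff_right inner_commute algebra_simps)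
  have dist: "(norm (K (\<phi> n) - K (\<phi> k)))\<^sup>2 \<le> 2 / real (Suc n) + 2 / real (Suc k)" for n k
    using par[of "\<phi> n" "\<phi> k"] \<phi>[of n] \<phi>[of k] m_le[of "(1/2) *\<^sub>R (\<phi> n + \<phi> k)"]
    by (simp add: algebra_simps)
  have "Cauchy (\<lambda>n. K (\<phi> n))"
  proof (rule CauchyI)
    fix e :: real assume e: "0 < e"
    obtain N where N: "4 / real (Suc N) < e\<^sup>2"
      using reals_Archimedean[of "e\<^sup>2 / 4"] e by (auto simp: field_simps)
    show "\<exists>M. \<forall>m\<ge>M. \<forall>n\<ge>M. norm (K (\<phi> m) - K (\<phi> n)) < e"
    proof (intro exI allI impI)
      fix m n assume mn: "N \<le> m" "N \<le> n"
      have "2 / real (Suc m) \<le> 2 / real (Suc N)" "2 / real (Suc n) \<le> 2 / real (Suc N)"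
        using mn by (auto intro!: divide_left_mono)
      then have "(norm (K (\<phi> m) - K (\<phi> n)))\<^sup>2 < e\<^sup>2"
        using dist[of m n] N by simp
      then show "norm (K (\<phi> m) - K (\<phi> n)) < e"
        using e by (simp add: power_less_imp_less_base)
    qed
  qed
  then obtain u where u: "(\<lambda>n. K (\<phi> n)) \<longlonglongrightarrow> u"
    by (auto simp: Cauchy_convergent_iff convergent_def)
  have "u \<bullet> K \<psi> = F \<psi>" for \<psi>
  proof -
    \<comment> \<open>First variation at the limit: \<open>\<phi> n\<close> misses the infimum by
      less than \<open>1 / real (Suc n)\<close>, and this slack vanishes.\<close>
    have "0 \<le> 2 * t * (u \<bullet> K \<psi> - F \<psi>) + t\<^sup>2 * (norm (K \<psi>))\<^sup>2" for t
    proof (rule LIMSEQ_le)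
      show "(\<lambda>n. - (1 / real (Suc n))) \<longlonglongrightarrow> 0"
        using tendsto_minus[OF LIMSEQ_inverse_real_of_nat] by (simp add: inverse_eq_divide)
      show "(\<lambda>n. 2 * t * (K (\<phi> n) \<bullet> K \<psi> - F \<psi>) + t\<^sup>2 * (norm (K \<psi>))\<^sup>2)
          \<longlonglongrightarrow> 2 * t * (u \<bullet> K \<psi> - F \<psi>) + t\<^sup>2 * (norm (K \<psi>))\<^sup>2"
        by (intro tendsto_intros u)
      show "\<exists>N. \<forall>n\<ge>N. - (1 / real (Suc n)) \<le> 2 * t * (K (\<phi> n) \<bullet> K \<psi> - F \<psi>) + t\<^sup>2 * (norm (K \<psi>))\<^sup>2"
      proof (intro exI allI impI)
        fix n :: nat
        show "- (1 / real (Suc n)) \<le> 2 * t * (K (\<phi> n) \<bullet> K \<psi> - F \<psi>) + t\<^sup>2 * (norm (K \<psi>))\<^sup>2"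
          using J_add[of "\<phi> n" t \<psi>] m_le[of "\<phi> n + t *\<^sub>R \<psi>"] \<phi>[of n] by linarith
      qed
    qed
    from affine_nonneg_imp_zero[OF this] show ?thesis by simp
  qed
  with u that show ?thesis by blast
qed

section \<open>Riesz representation, adjoints and Lax-Milgram\<close>

lemma riesz_representation:
  fixes F :: "'x::{real_inner,complete_space} \<Rightarrow> real"
  assumes "bounded_linear F"
  obtains u where "\<And>x. F x = u \<bullet> x"
proof -
  interpret bounded_linear F by fact
  obtain C where "\<And>x. norm (F x) \<le> norm x * C" using bounded by blast
  then have "\<bar>F x\<bar> \<le> C * norm (id x)" for x by (simp add: mult.commute)
  from lions_projection[OF linear_id linear this] that show ?thesis by (metis id_apply)
qed

lemma bounded_linear_adjoint_exists:
  fixes A :: "'x::{real_inner,complete_space} \<Rightarrow> 'z::real_inner"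
  assumes "bounded_linear A"
  obtains A' where "bounded_linear A'" and "\<And>x y. A x \<bullet> y = x \<bullet> A' y"
proof -
  interpret A: bounded_linear A by fact
  have "\<exists>u. \<forall>x. A x \<bullet> y = x \<bullet> u" for y
  proof -
    have "bounded_linear (\<lambda>x. A x \<bullet> y)"
      by (rule bounded_linear_compose[OF bounded_linear_inner_left assms])
    from riesz_representation[OF this] show ?thesis by (metis inner_commute)
  qed
  then obtain A' where A': "\<And>x y. A x \<bullet> y = x \<bullet> A' y" by metis
  have eqI: "u = v" if "\<And>x. x \<bullet> u = x \<bullet> v" for u v :: 'x
  proof -
    have "(u - v) \<bullet> (u - v) = 0" using that[of "u - v"] by (simp only: inner_diff_right)
    then show ?thesis by simp
  qed
  obtain C where C: "\<And>x. norm (A x) \<le> norm x * C" "C > 0" using A.pos_bounded by blast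
  have "bounded_linear A'"
  proof (rule bounded_linear_intro)
    show "A' (x + y) = A' x + A' y" for x y
      by (rule eqI) (simp add: inner_add_right flip: A')
    show "A' (r *\<^sub>R x) = r *\<^sub>R A' x" for r x
      by (rule eqI) (simp flip: A')
    show "norm (A' x) \<le> norm x * C" for x
    proof (cases "A' x = 0")
      case False
      have "(norm (A' x))\<^sup>2 = A (A' x) \<bullet> x" by (simp add: A' power2_norm_eq_inner)
      also have "\<dots> \<le> norm (A (A' x)) * norm x" by (rule norm_cauchy_schwarz)
      also have "\<dots> \<le> (norm (A' x) * C) * norm x" by (intro mult_right_mono C) simp
      finally have "norm (A' x) * norm (A' x) \<le> norm (A' x) * (norm x * C)"
        by (simp add: power2_eq_square ac_simps)
      then show ?thesis using False by (simp add: mult_le_cancel_left)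
    qed (use C in \<open>simp add: less_imp_le\<close>)
  qed
  with A' that show ?thesis by blast
qed

text \<open>Surjectivity by duality: \<open>V u = f\<close> says that
  \<open>u \<bullet> W x = f \<bullet> x\<close> for the adjoint \<open>W\<close>. Coercivity passes
  to \<open>W\<close> and bounds the right side by a multiple of \<open>norm (W x)\<close>, as
  \<open>lions_projection\<close> requires.\<close>

lemma lax_milgram:
  fixes V :: "'x::{real_inner,complete_space} \<Rightarrow> 'x"
  assumes V: "bounded_linear V" and c: "c > 0" and coercive: "\<And>x. c * (norm x)\<^sup>2 \<le> V x \<bullet> x"
  obtains u where "V u = f"
proof -
  obtain W where W: "bounded_linear W" "\<And>x y. V x \<bullet> y = x \<bullet> W y"
    using bounded_linear_adjoint_exists[OF V] by blast
  have low: "c * norm x \<le> norm (W x)" for x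
  proof (cases "x = 0")
    case False
    have "c * (norm x)\<^sup>2 \<le> norm x * norm (W x)"
      using coercive[of x] norm_cauchy_schwarz[of x "W x"] W(2)[of x x] by linarith
    then show ?thesis using False by (simp add: power2_eq_square field_simps)
  qed simp
  have "\<bar>f \<bullet> x\<bar> \<le> (norm f / c) * norm (W x)" for x
  proof -
    have "\<bar>f \<bullet> x\<bar> \<le> norm f * norm x" by (rule Cauchy_Schwarz_ineq2)
    also have "\<dots> \<le> norm f * (norm (W x) / c)" using low[of x] c
      by (intro mult_left_mono) (auto simp: field_simps)
    finally show ?thesis by simp
  qed
  from lions_projection[OF bounded_linear.linear[OF W(1)]
      bounded_linear.linear[OF bounded_linear_inner_right] this]
  obtain u where u: "\<And>x. u \<bullet> W x = f \<bullet> x" by metis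
  have "(V u - f) \<bullet> x = 0" for x using u[of x] by (simp add: inner_diff_left W(2))
  from this[of "V u - f"] have "V u = f" by simp
  then show ?thesis by (rule that)
qed

text \<open>The perturbation direction is \<open>M x\<close> itself: along
  \<open>x + t *\<^sub>R M x\<close> the linear coefficient of the nonnegative form is a multiple of
  \<open>M x \<bullet> M x\<close>, which must vanish.\<close>

lemma psd_zero_imp_zero:
  fixes M :: "'x::real_inner \<Rightarrow> 'x"
  assumes "linear M" and sym: "\<And>x y. M x \<bullet> y = x \<bullet> M y" and psd: "\<And>x. 0 \<le> M x \<bullet> x"
    and "M x \<bullet> x = 0"
  shows "M x = 0"
proof -
  have "0 \<le> 2 * t * (M x \<bullet> M x) + t\<^sup>2 * (M (M x) \<bullet> M x)" for t
  proof -
    have "0 \<le> M (x + t *\<^sub>R M x) \<bullet> (x + t *\<^sub>R M x)" by (rule psd)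
    also have "\<dots> = 2 * t * (M x \<bullet> M x) + t\<^sup>2 * (M (M x) \<bullet> M x)"
      using assms(1,4) sym[of "M x" x]
      by (simp add: linear_add linear_scale inner_add_left inner_add_right power2_eq_square algebra_simps)
    finally show ?thesis .
  qed
  from affine_nonneg_imp_zero[OF this] show ?thesis by simp
qed

text \<open>
  The abstract form of integration from the initial time and integration up to the final time.
\<close>

locale volterra_pair =
  fixes V W :: "'x::{real_inner,complete_space} \<Rightarrow> 'x"
  assumes V: "bounded_linear V" and W: "bounded_linear W"
    and adj: "\<And>x y. V x \<bullet> y = x \<bullet> W y"
    and mono: "\<And>x. 0 \<le> V x \<bullet> x"
    and V_inj: "\<And>x. V x = 0 \<Longrightarrow> x = 0" and W_inj: "\<And>x. W x = 0 \<Longrightarrow> x = 0"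
begin

lemma swap: "volterra_pair W V"
proof (rule volterra_pair.intro)
  show "W x \<bullet> y = x \<bullet> V y" for x y using adj[of y x] by (simp only: inner_commute)
  show "0 \<le> W x \<bullet> x" for x using mono[of x] adj[of x x] by (simp only: inner_commute)
qed (fact V W V_inj W_inj)+

lemma resolvent_exists:
  assumes "e > 0" obtains d where "e *\<^sub>R d + V d = y"
proof -
  have "bounded_linear (\<lambda>d. e *\<^sub>R d + V d)"
    by (intro bounded_linear_add V bounded_linear_scaleR_right)
  moreover have "e * (norm d)\<^sup>2 \<le> (e *\<^sub>R d + V d) \<bullet> d" for d
    using mono[of d] by (simp add: inner_add_left power2_norm_eq_inner)
  ultimately show ?thesis using lax_milgram[of "\<lambda>d. e *\<^sub>R d + V d" e] assms that by blast
qed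

text \<open>The map from \<open>g\<close> to \<open>x\<close> is the resolvent of \<open>V\<close>
  followed by \<open>V\<close>. Monotonicity is tested at \<open>g - x\<close>, where
  \<open>V (g - x) = e *\<^sub>R x\<close>.\<close>

lemma resolvent_contraction:
  assumes "e > 0" "e *\<^sub>R x + V x = V g"
  shows "norm x \<le> norm g"
proof -
  interpret V: bounded_linear V by (rule V)
  have "0 \<le> V (g - x) \<bullet> (g - x)" by (rule mono)
  also have "V (g - x) = e *\<^sub>R x" using assms(2) by (simp add: V.diff algebra_simps)
  finally have "0 \<le> x \<bullet> (g - x)" using assms(1) by (simp add: zero_le_mult_iff)
  then have "(norm x)\<^sup>2 \<le> x \<bullet> g" by (simp add: inner_diff_right power2_norm_eq_inner)
  also have "\<dots> \<le> norm x * norm g" by (rule norm_cauchy_schwarz)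
  finally have "norm x * norm x \<le> norm x * norm g" by (simp add: power2_eq_square)
  then show ?thesis by (cases "x = 0") (auto simp: mult_le_cancel_left)
qed

text \<open>\<open>lions_projection\<close> yields the projection \<open>u\<close> of
  \<open>g\<close> onto the closed range of \<open>V\<close>; the defect \<open>u - g\<close> lies
  in the kernel of the adjoint \<open>W\<close>, hence is zero.\<close>

lemma range_dense:
  assumes "r > 0" obtains k where "norm (g - V k) < r"
proof -
  have "\<bar>g \<bullet> V x\<bar> \<le> norm g * norm (V x)" for x by (rule Cauchy_Schwarz_ineq2)
  moreover have "linear (\<lambda>x. g \<bullet> V x)"
    by (rule bounded_linear.linear[OF bounded_linear_compose[OF bounded_linear_inner_right V]])
  ultimately obtain u \<phi> where u: "(\<lambda>n. V (\<phi> n)) \<longlonglongrightarrow> u" "\<And>x. u \<bullet> V x = g \<bullet> V x"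
    using lions_projection[of V "\<lambda>x. g \<bullet> V x"] V by (metis bounded_linear.linear)
  have "W (u - g) \<bullet> x = 0" for x using u(2)[of x] adj[of x "u - g"]
    by (simp add: inner_diff_left inner_diff_right inner_commute)
  from this[of "W (u - g)"] have "W (u - g) = 0" by simp
  then have "u = g" using W_inj[of "u - g"] by simp
  with u(1) assms have "\<exists>n. dist (V (\<phi> n)) g < r"
    by (auto simp: lim_sequentially)
  then show ?thesis using that by (metis dist_norm norm_minus_commute)
qed

text \<open>If \<open>g\<close> is in the range, \<open>g = V k\<close>, the error is
  \<open>e n *\<^sub>R x'\<close> with \<open>norm x' \<le> norm k\<close> and tends to zero.
  Density of the range and the contraction property extend this to every \<open>g\<close>.\<close>

lemma resolvent_tendsto:
  fixes x :: "nat \<Rightarrow> 'x"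
  assumes e: "\<And>n. e n > 0" "e \<longlonglongrightarrow> 0" and x: "\<And>n. e n *\<^sub>R x n + V (x n) = V g"
  shows "x \<longlonglongrightarrow> g"
proof (rule LIMSEQ_I)
  interpret V: bounded_linear V by (rule V)
  fix r :: real assume "0 < r"
  then have r4: "r / 4 > 0" by simp
  obtain k where k: "norm (g - V k) < r / 4" using range_dense[OF r4] .
  obtain N where N: "\<And>n. n \<ge> N \<Longrightarrow> e n * (norm k + 1) < r / 2"
  proof -
    have "(\<lambda>n. e n * (norm k + 1)) \<longlonglongrightarrow> 0 * (norm k + 1)" by (intro tendsto_intros e)
    then have "\<forall>\<^sub>F n in sequentially. e n * (norm k + 1) < r / 2"
      using \<open>0 < r\<close> by (intro order_tendstoD) auto
    then show ?thesis using that by (auto simp: eventually_sequentially)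
  qed
  show "\<exists>N. \<forall>n\<ge>N. norm (x n - g) < r"
  proof (intro exI allI impI)
    fix n assume n: "N \<le> n"
    obtain x' where x': "e n *\<^sub>R x' + V x' = V k" using resolvent_exists[OF e(1)] .
    have "norm (x n - V x') \<le> norm (g - V k)"
    proof (rule resolvent_contraction[OF e(1)])
      show "e n *\<^sub>R (x n - V x') + V (x n - V x') = V (g - V k)"
        using x[of n] arg_cong[OF x', of V] by (simp add: V.diff V.add V.scaleR algebra_simps)
    qed
    moreover have "norm (V x' - V k) \<le> e n * norm k"
    proof -
      have "V x' - V k = - (e n *\<^sub>R x')" using x' by (simp add: algebra_simps eq_neg_iff_add_eq_0 flip: x')
      then have "norm (V x' - V k) = e n * norm x'" using e(1)[of n] by simp
      also have "\<dots> \<le> e n * norm k" using resolvent_contraction[OF e(1) x'] e(1)[of n]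
        by (intro mult_left_mono) auto
      finally show ?thesis .
    qed
    moreover have "e n * norm k < r / 2" using N[OF n] e(1)[of n] by (simp add: algebra_simps)
    moreover have "norm (x n - g) \<le> norm (x n - V x') + norm (V x' - V k) + norm (V k - g)"
      using norm_triangle_ineq[of "x n - V x'" "V x' - V k"]
        norm_triangle_ineq[of "(x n - V x') + (V x' - V k)" "V k - g"] by simp
    ultimately show "norm (x n - g) < r" using k by (simp add: norm_minus_commute)
  qed
qed

text \<open>With \<open>d\<close> from the resolvent equation
  \<open>e *\<^sub>R d + V d = y\<close>, both \<open>V d\<close> and \<open>B d\<close> solve
  resolvent equations, with right sides \<open>V y\<close> and, because \<open>B\<close> commutes
  with \<open>V\<close>, \<open>B y = V g\<close>. So one sequence approximates the function and its
  derivative simultaneously.\<close>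

lemma approximation:
  assumes B: "bounded_linear B" "\<And>x. B (V x) = V (B x)" and y: "B y = V g"
  obtains d :: "nat \<Rightarrow> 'x" where "(\<lambda>n. B (d n)) \<longlonglongrightarrow> g" "(\<lambda>n. V (d n)) \<longlonglongrightarrow> y"
proof -
  interpret V: bounded_linear V by (rule V)
  interpret B: bounded_linear B by (rule B)
  define e where "e n = 1 / real (Suc n)" for n
  have e: "e n > 0" "e \<longlonglongrightarrow> 0" for n
    using LIMSEQ_inverse_real_of_nat by (auto simp: e_def[abs_def] inverse_eq_divide)
  have "\<exists>d. e n *\<^sub>R d + V d = y" for n using resolvent_exists[OF e(1)] by metis
  then obtain d where d: "\<And>n. e n *\<^sub>R d n + V (d n) = y" by metis
  show ?thesis
  proof
    show "(\<lambda>n. B (d n)) \<longlonglongrightarrow> g"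
    proof (rule resolvent_tendsto[OF e])
      show "e n *\<^sub>R B (d n) + V (B (d n)) = V g" for n
        using arg_cong[OF d[of n], of B] y by (simp add: B.add B.scaleR B(2))
    qed
    show "(\<lambda>n. V (d n)) \<longlonglongrightarrow> y"
    proof (rule resolvent_tendsto[OF e])
      show "e n *\<^sub>R V (d n) + V (V (d n)) = V y" for n
        using arg_cong[OF d[of n], of V] by (simp add: V.add V.scaleR)
    qed
  qed
qed

lemma energy_nonneg:
  assumes B: "bounded_linear B" "\<And>x. B (V x) = V (B x)" and pos: "\<And>x. 0 \<le> B x \<bullet> V x"
    and y: "B y = V g"
  shows "0 \<le> g \<bullet> y"
proof -
  obtain d where d: "(\<lambda>n. B (d n)) \<longlonglongrightarrow> g" "(\<lambda>n. V (d n)) \<longlonglongrightarrow> y"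
    using approximation[OF B y] by blast
  show ?thesis
    by (rule LIMSEQ_le_const[OF tendsto_inner[OF d]]) (use pos in auto)
qed

text \<open>For an approximating pair the identity is pure algebra: \<open>B d \<bullet> p = d
  \<bullet> B p = d \<bullet> W k = V d \<bullet> k\<close>. It suffices to approximate one of the
  two factors.\<close>

lemma integration_by_parts:
  assumes B: "bounded_linear B" "\<And>x. B (V x) = V (B x)" and sym: "\<And>x y. B x \<bullet> y = x \<bullet> B y"
    and y: "B y = V g" and p: "B p = W k"
  shows "g \<bullet> p = y \<bullet> k"
proof -
  obtain d where d: "(\<lambda>n. B (d n)) \<longlonglongrightarrow> g" "(\<lambda>n. V (d n)) \<longlonglongrightarrow> y"
    using approximation[OF B y] by blast
  have "B (d n) \<bullet> p = V (d n) \<bullet> k" for n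
    by (simp add: sym p adj)
  then have "(\<lambda>n. B (d n) \<bullet> p) \<longlonglongrightarrow> y \<bullet> k"
    using tendsto_inner[OF d(2) tendsto_const] by simp
  with tendsto_inner[OF d(1) tendsto_const] show ?thesis
    by (rule LIMSEQ_unique)
qed

end

text \<open>
  \<open>B\<close> is the pivot operator, \<open>A'\<close> the adjoint of \<open>A\<close>, and \<open>D\<close> is the control operator divided
  by \<open>\<alpha>\<close>.
\<close>

locale optimality_system = volterra_pair V W
  for V W :: "'x::{real_inner,complete_space} \<Rightarrow> 'x" +
  fixes B A A' D M :: "'x \<Rightarrow> 'x" and \<gamma> :: real
  assumes B: "bounded_linear B" and B_V: "\<And>x. B (V x) = V (B x)"
    and B_sym: "\<And>x y. B x \<bullet> y = x \<bullet> B y" and B_V_pos: "\<And>x. 0 \<le> B x \<bullet> V x"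
    and A: "bounded_linear A" and A': "bounded_linear A'" and A_adj: "\<And>x y. A x \<bullet> y = x \<bullet> A' y"
    and \<gamma>: "\<gamma> > 0" and A_coercive: "\<And>x. \<gamma> * (norm x)\<^sup>2 \<le> A x \<bullet> x"
    and D: "bounded_linear D" and D_sym: "\<And>x y. D x \<bullet> y = x \<bullet> D y" and D_psd: "\<And>x. 0 \<le> D x \<bullet> x"
    and M: "bounded_linear M" and M_sym: "\<And>x y. M x \<bullet> y = x \<bullet> M y" and M_psd: "\<And>x. 0 \<le> M x \<bullet> x"
begin

lemma B_W: "B (W x) = W (B x)"
proof -
  have "(B (W x) - W (B x)) \<bullet> z = 0" for z
    using adj[of z "B x"] adj[of "B z" x] B_V[of z] B_sym
    by (simp add: inner_diff_left) (metis inner_commute)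
  from this[of "B (W x) - W (B x)"] show ?thesis by simp
qed

lemma B_W_pos: "0 \<le> B x \<bullet> W x"
proof -
  have "B x \<bullet> W x = B (V x) \<bullet> x" by (simp add: B_V adj)
  also have "\<dots> = B x \<bullet> V x" by (simp add: B_sym inner_commute)
  finally show ?thesis using B_V_pos[of x] by simp
qed

lemma unique:
  assumes y: "B y = V g" and p: "B p = W k"
    and g: "g + A y - D p = 0" and k: "k + A' p + M y = 0"
  shows "y = 0" "p = 0"
proof -
  have g': "g = D p - A y" and k': "k = - A' p - M y"
    using g k by (auto simp: algebra_simps eq_neg_iff_add_eq_0)
  have "g \<bullet> p = y \<bullet> k"
    by (rule integration_by_parts[OF B B_V B_sym y p])
  \<comment> \<open>The contributions of \<open>A\<close> and \<open>A'\<close> cancel by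
    adjointness, leaving two nonnegative terms.\<close>
  then have "D p \<bullet> p + M y \<bullet> y = 0"
    unfolding g' k' by (simp add: inner_diff_left inner_diff_right A_adj inner_commute[of y "M y"])
  then have "D p \<bullet> p = 0" "M y \<bullet> y = 0" using D_psd[of p] M_psd[of y] by auto
  then have D0: "D p = 0" and M0: "M y = 0"
    using psd_zero_imp_zero[OF bounded_linear.linear[OF D] D_sym D_psd]
      psd_zero_imp_zero[OF bounded_linear.linear[OF M] M_sym M_psd] by auto
  have "0 \<le> g \<bullet> y" by (rule energy_nonneg[OF B B_V B_V_pos y])
  then have "\<gamma> * (norm y)\<^sup>2 \<le> 0" using A_coercive[of y] D0 g' by simp
  then show "y = 0" using \<gamma> by (simp add: mult_le_0_iff)
  have "0 \<le> k \<bullet> p" by (rule volterra_pair.energy_nonneg[OF swap B B_W B_W_pos p])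
  then have "\<gamma> * (norm p)\<^sup>2 \<le> 0" using A_coercive[of p] M0 k' A_adj[of p p]
    by (simp add: inner_commute)
  then show "p = 0" using \<gamma> by (simp add: mult_le_0_iff)
qed

text \<open>
  Testing with \<open>(a + s b, b - s a)\<close> makes the skew coupling of the two equations cancel and
  turns the coupling by \<open>M\<close> and \<open>D\<close> into \<open>s\<close> times semidefinite terms, which absorb the rest.
\<close>

lemma inf_sup:
  obtains C where "\<And>\<eta> \<zeta>. norm (W \<eta>) + norm (V \<zeta>) \<le>
     C * norm (B \<eta> + A' (W \<eta>) + M (V \<zeta>), B \<zeta> + A (V \<zeta>) - D (W \<eta>))"
proof -
  obtain cM where cM: "\<And>x. norm (M x) \<le> norm x * cM" "cM > 0"
    using bounded_linear.pos_bounded[OF M] by blast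
  obtain cD where cD: "\<And>x. norm (D x) \<le> norm x * cD" "cD > 0"
    using bounded_linear.pos_bounded[OF D] by blast
  \<comment> \<open>\<open>2 * s * \<gamma>\<close> dominates the bounds of both \<open>M\<close>
    and \<open>D\<close>, so that \<open>absorb\<close> applies to each with the same
    \<open>s\<close>.\<close>
  define s where "s = (cM + cD) / (2 * \<gamma>)"
  have s: "s > 0" "cM \<le> 2 * s * \<gamma>" "cD \<le> 2 * s * \<gamma>" using cM cD \<gamma> by (auto simp: s_def)
  have upper: "N x \<bullet> x \<le> 2 * s * \<gamma> * (norm x)\<^sup>2"
    if N: "\<And>x. norm (N x) \<le> norm x * k" "k \<le> 2 * s * \<gamma>" for N :: "'x \<Rightarrow> 'x" and k x
  proof -
    have "N x \<bullet> x \<le> norm (N x) * norm x" by (rule norm_cauchy_schwarz)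
    also have "\<dots> \<le> (norm x * k) * norm x" by (intro mult_right_mono N) simp
    also have "\<dots> = k * (norm x)\<^sup>2" by (simp add: power2_eq_square)
    also have "\<dots> \<le> 2 * s * \<gamma> * (norm x)\<^sup>2" by (intro mult_right_mono N) simp
    finally show ?thesis .
  qed
  \<comment> \<open>Completing the square: semidefiniteness at \<open>2 * s\<close> times
    \<open>x\<close> plus \<open>z\<close>. The price is half of the coercivity, and the other half
    survives in the final estimate.\<close>
  have absorb: "0 \<le> s * (N x \<bullet> x) + N x \<bullet> z + \<gamma> / 2 * (norm z)\<^sup>2"
    if N: "linear N" "\<And>x y. N x \<bullet> y = x \<bullet> N y" "\<And>x. 0 \<le> N x \<bullet> x"
      "\<And>x. N x \<bullet> x \<le> 2 * s * \<gamma> * (norm x)\<^sup>2" for N :: "'x \<Rightarrow> 'x" and x z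
  proof -
    have "0 \<le> N ((2 * s) *\<^sub>R x + z) \<bullet> ((2 * s) *\<^sub>R x + z)" by (rule N)
    also have "\<dots> = 4 * s * (s * (N x \<bullet> x) + N x \<bullet> z) + N z \<bullet> z"
      using N(1) N(2)[of z x]
      by (simp add: linear_add linear_scale inner_add_left inner_add_right inner_commute algebra_simps)
    also have "\<dots> \<le> 4 * s * (s * (N x \<bullet> x) + N x \<bullet> z) + 2 * s * \<gamma> * (norm z)\<^sup>2"
      using N(4) by simp
    also have "\<dots> = 4 * s * (s * (N x \<bullet> x) + N x \<bullet> z + \<gamma> / 2 * (norm z)\<^sup>2)"
      by (simp add: algebra_simps)
    finally show ?thesis using s by (simp add: zero_le_mult_iff)
  qed
  \<comment> \<open>The two test vectors have norms adding up to at most \<open>(1 + s) * n\<close>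
    for \<open>n = norm a + norm b\<close>; passing to the square of \<open>n\<close> costs a factor
    2 and the halved coercivity another one, whence the 4. Only \<open>W \<eta>\<close> and
    \<open>V \<zeta>\<close> are controlled, not \<open>\<eta>\<close> and \<open>\<zeta>\<close>;
    the functional in \<open>solvable\<close> depends on nothing else.\<close>
  have main: "norm (W \<eta>) + norm (V \<zeta>) \<le> (4 * (1 + s) / \<gamma>) *
     norm (B \<eta> + A' (W \<eta>) + M (V \<zeta>), B \<zeta> + A (V \<zeta>) - D (W \<eta>))" for \<eta> \<zeta>
  proof -
    define a b where "a = W \<eta>" and "b = V \<zeta>"
    define K1 K2 where "K1 = B \<eta> + A' a + M b" and "K2 = B \<zeta> + A b - D a"
    define n where "n = norm a + norm b"
    have skew: "B \<eta> \<bullet> b = B \<zeta> \<bullet> a"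
    proof -
      have "B \<eta> \<bullet> b = V \<zeta> \<bullet> B \<eta>" by (simp add: b_def inner_commute)
      also have "\<dots> = \<zeta> \<bullet> W (B \<eta>)" by (rule adj)
      also have "\<dots> = B \<zeta> \<bullet> a" by (simp add: a_def B_sym flip: B_W)
      finally show ?thesis .
    qed
    have eq: "K1 \<bullet> (a + s *\<^sub>R b) + K2 \<bullet> (b - s *\<^sub>R a) =
        B \<eta> \<bullet> a + B \<zeta> \<bullet> b + A a \<bullet> a + A b \<bullet> b
        + (s * (M b \<bullet> b) + M b \<bullet> a) + (s * (D a \<bullet> a) - D a \<bullet> b)"
      unfolding K1_def K2_def using skew A_adj[of a a] A_adj[of b a]
      by (simp add: inner_add_left inner_add_right inner_diff_left inner_diff_right inner_commute
          algebra_simps)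
    have "\<gamma> / 2 * ((norm a)\<^sup>2 + (norm b)\<^sup>2) \<le> K1 \<bullet> (a + s *\<^sub>R b) + K2 \<bullet> (b - s *\<^sub>R a)"
      unfolding eq
      using absorb[OF bounded_linear.linear[OF M] M_sym M_psd upper[OF cM(1) s(2)], of b a]
        absorb[OF bounded_linear.linear[OF D] D_sym D_psd upper[OF cD(1) s(3)], of a "- b"]
        B_W_pos[of \<eta>] B_V_pos[of \<zeta>] A_coercive[of a] A_coercive[of b]
      by (simp add: a_def b_def algebra_simps)
    also have "\<dots> \<le> norm K1 * norm (a + s *\<^sub>R b) + norm K2 * norm (b - s *\<^sub>R a)"
      by (intro add_mono norm_cauchy_schwarz)
    also have "\<dots> \<le> norm (K1, K2) * ((1 + s) * n)"
    proof -
      have "norm (a + s *\<^sub>R b) \<le> norm a + s * norm b" "norm (b - s *\<^sub>R a) \<le> norm b + s * norm a"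
        using norm_triangle_ineq[of a "s *\<^sub>R b"] norm_triangle_ineq4[of b "s *\<^sub>R a"] s by auto
      then have "norm K1 * norm (a + s *\<^sub>R b) + norm K2 * norm (b - s *\<^sub>R a) \<le>
          norm (K1, K2) * (norm a + s * norm b) + norm (K1, K2) * (norm b + s * norm a)"
        using norm_fst_le[of K1 K2] norm_snd_le[of K2 K1] s
        by (intro add_mono mult_mono) auto
      then show ?thesis by (simp add: n_def algebra_simps)
    qed
    finally have "\<gamma> / 2 * ((norm a)\<^sup>2 + (norm b)\<^sup>2) \<le> norm (K1, K2) * ((1 + s) * n)" by simp
    moreover have "n\<^sup>2 \<le> 2 * ((norm a)\<^sup>2 + (norm b)\<^sup>2)"
      unfolding n_def using sum_squares_bound[of "norm a" "norm b"] by (simp add: power2_sum)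
    ultimately have "\<gamma> * n\<^sup>2 \<le> 4 * (norm (K1, K2) * ((1 + s) * n))"
      using \<gamma> mult_left_mono[of "n\<^sup>2" "2 * ((norm a)\<^sup>2 + (norm b)\<^sup>2)" \<gamma>] by linarith
    then have le: "n * (\<gamma> * n) \<le> n * (4 * (1 + s) * norm (K1, K2))"
      by (simp add: power2_eq_square algebra_simps)
    have "n \<ge> 0" by (simp add: n_def)
    then have "\<gamma> * n \<le> 4 * (1 + s) * norm (K1, K2)"
      using le s by (cases "n = 0") (auto simp: mult_le_cancel_left)
    then have "n \<le> 4 * (1 + s) / \<gamma> * norm (K1, K2)"
      using \<gamma> by (simp add: field_simps)
    then show ?thesis by (simp add: n_def a_def b_def K1_def K2_def)
  qed
  show ?thesis by (rule that[OF main])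
qed

text \<open>A very weak formulation: the test functions are \<open>W \<eta>\<close> and
  \<open>V \<zeta>\<close>, standing for functions that vanish at the final and the initial time,
  and all operators act on them. Moving the operators back to \<open>(y, p)\<close> produces
  \<open>V\<close> and \<open>W\<close> on the right sides, so the time derivatives and end
  conditions result from the equations instead of being imposed.\<close>

lemma solvable:
  obtains y p where "B y = V (f - A y + D p)" and "B p = W (h - A' p - M y)"
proof -
  interpret V: bounded_linear V by (rule V)
  interpret W: bounded_linear W by (rule W)
  define K where "K = (\<lambda>(\<eta>, \<zeta>). (B \<eta> + A' (W \<eta>) + M (V \<zeta>), B \<zeta> + A (V \<zeta>) - D (W \<eta>)))"
  define F where "F = (\<lambda>(\<eta>, \<zeta>). f \<bullet> W \<eta> + h \<bullet> V \<zeta>)"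
  note lin = bounded_linear.linear[OF B] bounded_linear.linear[OF A] bounded_linear.linear[OF A']
    bounded_linear.linear[OF D] bounded_linear.linear[OF M]
  have K: "linear K"
    by (rule linearI) (auto simp: K_def V.add W.add V.scaleR W.scaleR lin[THEN linear_add]
        lin[THEN linear_scale] algebra_simps)
  have F: "linear F"
    by (rule linearI) (auto simp: F_def V.add W.add V.scaleR W.scaleR inner_add_right algebra_simps)
  obtain C where C: "\<And>\<eta> \<zeta>. norm (W \<eta>) + norm (V \<zeta>) \<le>
     C * norm (B \<eta> + A' (W \<eta>) + M (V \<zeta>), B \<zeta> + A (V \<zeta>) - D (W \<eta>))"
    using inf_sup by blast
  have bound: "\<bar>F \<phi>\<bar> \<le> ((norm f + norm h) * C) * norm (K \<phi>)" for \<phi>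
  proof -
    obtain \<eta> \<zeta> where \<phi>: "\<phi> = (\<eta>, \<zeta>)" by (cases \<phi>)
    have "\<bar>F \<phi>\<bar> \<le> norm f * norm (W \<eta>) + norm h * norm (V \<zeta>)"
      unfolding F_def \<phi> using Cauchy_Schwarz_ineq2[of f "W \<eta>"] Cauchy_Schwarz_ineq2[of h "V \<zeta>"]
      by (simp add: abs_le_iff)
    also have "\<dots> \<le> (norm f + norm h) * (norm (W \<eta>) + norm (V \<zeta>))" by (simp add: algebra_simps)
    also have "\<dots> \<le> (norm f + norm h) * (C * norm (K \<phi>))"
      using C[of \<eta> \<zeta>] by (intro mult_left_mono) (auto simp: K_def \<phi>)
    finally show ?thesis by (simp add: ac_simps)
  qed
  obtain u where u: "\<And>\<phi>. u \<bullet> K \<phi> = F \<phi>" using lions_projection[OF K F bound] by metis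
  obtain y p where yp: "u = (y, p)" by (cases u)
  have eq: "y \<bullet> (B \<eta> + A' (W \<eta>) + M (V \<zeta>)) + p \<bullet> (B \<zeta> + A (V \<zeta>) - D (W \<eta>))
      = f \<bullet> W \<eta> + h \<bullet> V \<zeta>" for \<eta> \<zeta>
    using u[of "(\<eta>, \<zeta>)"] by (simp add: K_def F_def yp)
  have 0: "x = 0" if "\<And>z. x \<bullet> z = 0" for x :: 'x using that[of x] by simp
  show ?thesis
  proof
    have "(B y - V (f - A y + D p)) \<bullet> \<eta> = 0" for \<eta>
      using eq[of \<eta> 0] linear_0[OF lin(1)] linear_0[OF lin(2)] linear_0[OF lin(5)]
      by (simp add: inner_diff_left inner_add_left inner_add_right inner_diff_right
          V.add V.diff adj A_adj B_sym D_sym V.zero)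
    then show "B y = V (f - A y + D p)" using 0 by force
    have "(B p - W (h - A' p - M y)) \<bullet> \<zeta> = 0" for \<zeta>
      using eq[of 0 \<zeta>] linear_0[OF lin(1)] linear_0[OF lin(3)] linear_0[OF lin(4)]
        volterra_pair.adj[OF swap] A_adj[of "V \<zeta>" p] M_sym[of y "V \<zeta>"] B_sym[of p \<zeta>]
      by (simp add: inner_diff_left inner_add_left inner_add_right inner_diff_right
          W.add W.diff W.zero inner_commute)
    then show "B p = W (h - A' p - M y)" using 0 by force
  qed
qed

end

section \<open>Square integrable functions on the line\<close>

definition sq_int :: "(real \<Rightarrow> 'a::{real_inner,second_countable_topology}) \<Rightarrow> bool" where
  "sq_int f \<longleftrightarrow> f \<in> borel_measurable lebesgue \<and> integrable lebesgue (\<lambda>t. (norm (f t))\<^sup>2)"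

lemma sq_int_measurable [measurable_dest]: "sq_int f \<Longrightarrow> f \<in> borel_measurable lebesgue"
  by (simp add: sq_int_def)

lemma sq_int_integrable: "sq_int f \<Longrightarrow> integrable lebesgue (\<lambda>t. (norm (f t))\<^sup>2)"
  by (simp add: sq_int_def)

lemma sq_intI_bounded:
  assumes [measurable]: "f \<in> borel_measurable lebesgue"
    and "integrable lebesgue h" "AE t in lebesgue. (norm (f t))\<^sup>2 \<le> h t"
  shows "sq_int f"
  unfolding sq_int_def
proof (intro conjI assms(1))
  show "integrable lebesgue (\<lambda>t. (norm (f t))\<^sup>2)"
    by (rule Bochner_Integration.integrable_bound[OF assms(2)]) (use assms(3) in auto)
qed

lemma sq_int_zero: "sq_int (\<lambda>_. 0)"
  by (simp add: sq_int_def)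

lemma sq_int_add:
  assumes f: "sq_int f" and g: "sq_int g"
  shows "sq_int (\<lambda>t. f t + g t)"
proof (rule sq_intI_bounded)
  show "(\<lambda>t. f t + g t) \<in> borel_measurable lebesgue"
    using assms by (intro borel_measurable_add) (auto dest: sq_int_measurable)
  show "integrable lebesgue (\<lambda>t. 2 * (norm (f t))\<^sup>2 + 2 * (norm (g t))\<^sup>2)"
    using assms by (intro Bochner_Integration.integrable_add integrable_mult_right sq_int_integrable)
  have "(norm (x + y))\<^sup>2 \<le> 2 * (norm x)\<^sup>2 + 2 * (norm y)\<^sup>2" for x y :: 'a
    using norm_ge_zero[of "x - y"] power2_norm_eq_inner[of "x - y"] zero_le_power2[of "norm (x - y)"]
    unfolding power2_norm_eq_inner
    by (simp add: inner_add_left inner_add_right inner_diff_left inner_diff_right inner_commute)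
  then show "AE t in lebesgue. (norm (f t + g t))\<^sup>2 \<le> 2 * (norm (f t))\<^sup>2 + 2 * (norm (g t))\<^sup>2"
    by simp
qed

lemma sq_int_bounded_linear:
  fixes A :: "'a::{real_inner,second_countable_topology} \<Rightarrow> 'b::{real_inner,second_countable_topology}"
  assumes A: "bounded_linear A" and f: "sq_int f"
  shows "sq_int (\<lambda>t. A (f t))"
proof -
  obtain K where K: "\<And>x. norm (A x) \<le> norm x * K" "K > 0" using bounded_linear.pos_bounded[OF A] by blast
  show ?thesis
  proof (rule sq_intI_bounded)
    show "(\<lambda>t. A (f t)) \<in> borel_measurable lebesgue"
      using borel_measurable_continuous_onI[OF linear_continuous_on[OF A, of UNIV]] sq_int_measurable[OF f]
      by (rule measurable_compose[rotated])
    show "integrable lebesgue (\<lambda>t. (norm (f t))\<^sup>2 * K\<^sup>2)"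
      using f by (intro integrable_mult_left sq_int_integrable)
    show "AE t in lebesgue. (norm (A (f t)))\<^sup>2 \<le> (norm (f t))\<^sup>2 * K\<^sup>2"
      using K by (auto simp flip: power_mult_distrib intro!: power_mono)
  qed
qed

lemma sq_int_scaleR: "sq_int f \<Longrightarrow> sq_int (\<lambda>t. c *\<^sub>R f t)"
  by (rule sq_int_bounded_linear[OF bounded_linear_scaleR_right])

lemma sq_int_minus: "sq_int f \<Longrightarrow> sq_int (\<lambda>t. - f t)"
  using sq_int_scaleR[of f "- 1"] by simp

lemma sq_int_diff: "sq_int f \<Longrightarrow> sq_int g \<Longrightarrow> sq_int (\<lambda>t. f t - g t)"
  using sq_int_add[of f "\<lambda>t. - g t"] sq_int_minus[of g] by simp

lemma integrable_inner_sq_int: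
  assumes f: "sq_int f" and g: "sq_int g"
  shows "integrable lebesgue (\<lambda>t. f t \<bullet> g t)"
proof (rule Bochner_Integration.integrable_bound)
  show "integrable lebesgue (\<lambda>t. (norm (f t))\<^sup>2 + (norm (g t))\<^sup>2)"
    using assms by (intro Bochner_Integration.integrable_add integrable_mult_right sq_int_integrable)
  show "(\<lambda>t. f t \<bullet> g t) \<in> borel_measurable lebesgue"
    using assms by (intro borel_measurable_inner) (auto dest: sq_int_measurable)
  have "\<bar>x \<bullet> y\<bar> \<le> (norm x)\<^sup>2 + (norm y)\<^sup>2" for x y :: 'a
    using Cauchy_Schwarz_ineq2[of x y] sum_squares_bound[of "norm x" "norm y"]
      mult_nonneg_nonneg[OF norm_ge_zero[of x] norm_ge_zero[of y]] by linarith
  then show "AE t in lebesgue. norm (f t \<bullet> g t) \<le> norm ((norm (f t))\<^sup>2 + (norm (g t))\<^sup>2)"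
    by simp
qed

\<comment> \<open>The whole line instead of \<open>(0,T)\<close>, since \<open>T\<close> is a term
  and cannot enter a type. The quotient is partial because only square integrable functions
  represent a class.\<close>
quotient_type (overloaded) 'a L2 = "real \<Rightarrow> ('a::{real_inner,second_countable_topology})" /
  partial: "\<lambda>f g. sq_int f \<and> sq_int g \<and> (AE t in lebesgue. f t = g t)"
proof (rule part_equivpI)
  show "\<exists>f::real \<Rightarrow> 'a. sq_int f \<and> sq_int f \<and> (AE t in lebesgue. f t = f t)"
    using sq_int_zero by auto
  show "symp (\<lambda>f g::real \<Rightarrow> 'a. sq_int f \<and> sq_int g \<and> (AE t in lebesgue. f t = g t))"
    by (auto simp: symp_def eq_commute)
  show "transp (\<lambda>f g::real \<Rightarrow> 'a. sq_int f \<and> sq_int g \<and> (AE t in lebesgue. f t = g t))"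
    by (auto simp: transp_def)
qed

instantiation L2 :: ("{real_inner,second_countable_topology}") real_vector
begin

lift_definition zero_L2 :: "'a L2" is "\<lambda>_. 0" by (simp add: sq_int_zero)
lift_definition plus_L2 :: "'a L2 \<Rightarrow> 'a L2 \<Rightarrow> 'a L2" is "\<lambda>f g t. f t + g t"
  by (auto intro: sq_int_add)
lift_definition uminus_L2 :: "'a L2 \<Rightarrow> 'a L2" is "\<lambda>f t. - f t"
  by (auto intro: sq_int_minus)
lift_definition minus_L2 :: "'a L2 \<Rightarrow> 'a L2 \<Rightarrow> 'a L2" is "\<lambda>f g t. f t - g t"
  by (auto intro: sq_int_diff)
lift_definition scaleR_L2 :: "real \<Rightarrow> 'a L2 \<Rightarrow> 'a L2" is "\<lambda>c f t. c *\<^sub>R f t"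
  by (auto intro: sq_int_scaleR)

instance
proof
  fix x y z :: "'a L2" and a b :: real
  show "x + y + z = x + (y + z)" by transfer (auto intro: sq_int_add simp: add.assoc)
  show "x + y = y + x" by transfer (auto intro: sq_int_add simp: add.commute)
  show "0 + x = x" by transfer (auto intro: sq_int_add)
  show "- x + x = 0" by transfer (auto intro: sq_int_add sq_int_minus sq_int_zero)
  show "x - y = x + - y" by transfer (auto intro: sq_int_add sq_int_diff sq_int_minus)
  show "a *\<^sub>R (x + y) = a *\<^sub>R x + a *\<^sub>R y"
    by transfer (auto intro!: sq_int_add sq_int_scaleR simp: scaleR_add_right)
  show "(a + b) *\<^sub>R x = a *\<^sub>R x + b *\<^sub>R x"
    by transfer (auto intro!: sq_int_add sq_int_scaleR simp: scaleR_add_left)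
  show "a *\<^sub>R b *\<^sub>R x = (a * b) *\<^sub>R x" by transfer (auto intro!: sq_int_scaleR)
  show "1 *\<^sub>R x = x" by transfer (auto intro!: sq_int_scaleR)
qed

end

instantiation L2 :: ("{real_inner,second_countable_topology}") real_inner
begin

lift_definition inner_L2 :: "'a L2 \<Rightarrow> 'a L2 \<Rightarrow> real" is "\<lambda>f g. LINT t|lebesgue. f t \<bullet> g t"
proof -
  fix f f' g g' :: "real \<Rightarrow> 'a"
  assume f: "sq_int f \<and> sq_int f' \<and> (AE t in lebesgue. f t = f' t)"
    and g: "sq_int g \<and> sq_int g' \<and> (AE t in lebesgue. g t = g' t)"
  show "(LINT t|lebesgue. f t \<bullet> g t) = (LINT t|lebesgue. f' t \<bullet> g' t)"
  proof (rule integral_cong_AE)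
    show "AE t in lebesgue. f t \<bullet> g t = f' t \<bullet> g' t" using f g by auto
  qed (use f g in \<open>auto intro!: borel_measurable_inner dest: sq_int_measurable\<close>)
qed

definition norm_L2 :: "'a L2 \<Rightarrow> real" where "norm_L2 x = sqrt (x \<bullet> x)"
definition dist_L2 :: "'a L2 \<Rightarrow> 'a L2 \<Rightarrow> real" where "dist_L2 x y = norm (x - y)"
definition sgn_L2 :: "'a L2 \<Rightarrow> 'a L2" where "sgn_L2 x = x /\<^sub>R norm x"
definition uniformity_L2 :: "('a L2 \<times> 'a L2) filter"
  where "uniformity_L2 = (INF e\<in>{0<..}. principal {(x, y). dist x y < e})"
definition open_L2 :: "'a L2 set \<Rightarrow> bool"
  where "open_L2 U = (\<forall>x\<in>U. eventually (\<lambda>(x', y). x' = x \<longrightarrow> y \<in> U) uniformity)"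

instance
proof
  fix x y z :: "'a L2" and a :: real
  show "dist x y = norm (x - y)" by (rule dist_L2_def)
  show "sgn x = x /\<^sub>R norm x" by (rule sgn_L2_def)
  show "uniformity = (INF e\<in>{0<..}. principal {(x::'a L2, y). dist x y < e})"
    by (rule uniformity_L2_def)
  show "open U = (\<forall>x\<in>U. \<forall>\<^sub>F (x', y) in uniformity. x' = x \<longrightarrow> y \<in> U)" for U :: "'a L2 set"
    by (rule open_L2_def)
  show "x \<bullet> y = y \<bullet> x" by transfer (simp add: inner_commute)
  show "(x + y) \<bullet> z = x \<bullet> z + y \<bullet> z"
    by transfer (simp add: inner_add_left integrable_inner_sq_int)
  show "a *\<^sub>R x \<bullet> y = a * (x \<bullet> y)" by transfer simp
  show "0 \<le> x \<bullet> x" by transfer simp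
  show "x \<bullet> x = 0 \<longleftrightarrow> x = 0"
    by transfer (auto simp: integral_nonneg_eq_0_iff_AE integrable_inner_sq_int sq_int_zero)
  show "norm x = sqrt (x \<bullet> x)" by (rule norm_L2_def)
qed

end

abbreviation fn :: "'a::{real_inner,second_countable_topology} L2 \<Rightarrow> real \<Rightarrow> 'a"
  where "fn \<equiv> rep_L2"
text \<open>Arbitrary if \<open>f\<close> is not square integrable.\<close>

abbreviation cls :: "(real \<Rightarrow> 'a::{real_inner,second_countable_topology}) \<Rightarrow> 'a L2"
  where "cls \<equiv> abs_L2"

lemma sq_int_fn: "sq_int (fn F)"
  using Quotient3_rep_reflp[OF Quotient3_L2] by blast

lemma fn_measurable [measurable]: "fn F \<in> borel_measurable lebesgue"
  by (rule sq_int_measurable[OF sq_int_fn])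

lemma cls_fn: "cls (fn F) = F"
  by (rule Quotient3_abs_rep[OF Quotient3_L2])

lemma cls_eq_iff: "sq_int f \<Longrightarrow> sq_int g \<Longrightarrow> cls f = cls g \<longleftrightarrow> (AE t in lebesgue. f t = g t)"
  using Quotient3_rel[OF Quotient3_L2, of f g] by auto

lemma fn_cls: "sq_int f \<Longrightarrow> AE t in lebesgue. fn (cls f) t = f t"
  using cls_eq_iff[OF sq_int_fn, of f "cls f"] by (simp add: cls_fn)

lemma L2_eq_iff: "F = G \<longleftrightarrow> (AE t in lebesgue. fn F t = fn G t)"
  using cls_eq_iff[OF sq_int_fn sq_int_fn, of F G] by (simp add: cls_fn)

lemma inner_L2_eq: "F \<bullet> G = (LINT t|lebesgue. fn F t \<bullet> fn G t)"
proof -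
  have "cls (fn F) \<bullet> cls (fn G) = (LINT t|lebesgue. fn F t \<bullet> fn G t)"
    by (rule inner_L2.abs_eq) (auto simp: sq_int_fn)
  then show ?thesis by (simp add: cls_fn)
qed

lemma norm_L2_eq: "(norm F)\<^sup>2 = (LINT t|lebesgue. (norm (fn F t))\<^sup>2)"
  by (simp add: power2_norm_eq_inner inner_L2_eq)

lemma fn_add: "AE t in lebesgue. fn (F + G) t = fn F t + fn G t"
proof -
  have "F + G = cls (\<lambda>t. fn F t + fn G t)"
    using plus_L2.abs_eq[of "fn F" "fn G"] by (simp add: sq_int_fn cls_fn)
  then show ?thesis using fn_cls[OF sq_int_add[OF sq_int_fn sq_int_fn]] by simp
qed

lemma fn_diff: "AE t in lebesgue. fn (F - G) t = fn F t - fn G t"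
proof -
  have "F - G = cls (\<lambda>t. fn F t - fn G t)"
    using minus_L2.abs_eq[of "fn F" "fn G"] by (simp add: sq_int_fn cls_fn)
  then show ?thesis using fn_cls[OF sq_int_diff[OF sq_int_fn sq_int_fn]] by simp
qed

lemma fn_scaleR: "AE t in lebesgue. fn (c *\<^sub>R F) t = c *\<^sub>R fn F t"
proof -
  have "c *\<^sub>R F = cls (\<lambda>t. c *\<^sub>R fn F t)"
    using scaleR_L2.abs_eq[of "fn F" c] by (simp add: sq_int_fn cls_fn)
  then show ?thesis using fn_cls[OF sq_int_scaleR[OF sq_int_fn]] by simp
qed

lemma fn_zero: "AE t in lebesgue. fn (0 :: 'a::{real_inner,second_countable_topology} L2) t = 0"
  using fn_scaleR[of 0 "0 :: 'a L2"] by simp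

text \<open>The nonnegative integral is the form needed for Fatou's lemma, where the limit is not
  yet known to be square integrable.\<close>

lemma nn_integral_fn_diff:
  "(\<integral>\<^sup>+t. ennreal ((norm (fn F t - fn G t))\<^sup>2) \<partial>lebesgue) = ennreal ((dist F G)\<^sup>2)"
proof -
  have "(\<integral>\<^sup>+t. ennreal ((norm (fn F t - fn G t))\<^sup>2) \<partial>lebesgue) =
      (\<integral>\<^sup>+t. ennreal ((norm (fn (F - G) t))\<^sup>2) \<partial>lebesgue)"
    by (rule nn_integral_cong_AE) (use fn_diff[of F G] in auto)
  also have "\<dots> = ennreal (LINT t|lebesgue. (norm (fn (F - G) t))\<^sup>2)"
    by (rule nn_integral_eq_integral) (auto intro: sq_int_integrable sq_int_fn)
  finally show ?thesis by (simp add: norm_L2_eq dist_norm)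
qed

section \<open>Completeness of L2\<close>

lemma geometric_steps_Cauchy:
  fixes f :: "nat \<Rightarrow> 'a::metric_space"
  assumes "\<And>n. dist (f (Suc n)) (f n) \<le> C * (1/2)^n"
  shows "Cauchy f"
proof -
  have C: "C \<ge> 0" using order_trans[OF zero_le_dist assms[of 0]] by simp
  \<comment> \<open>The bracket is the exact value of the geometric sum from \<open>n\<close> to
    \<open>n + k - 1\<close>, which makes the induction close.\<close>
  have step: "dist (f (n + k)) (f n) \<le> C * (2 * (1/2)^n - 2 * (1/2)^(n + k))" for n k
  proof (induction k)
    case (Suc k)
    have "dist (f (n + Suc k)) (f n) \<le> dist (f (Suc (n + k))) (f (n + k)) + dist (f (n + k)) (f n)"
      using dist_triangle[of "f (Suc (n + k))" "f n" "f (n + k)"] by simp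
    also have "\<dots> \<le> C * (1/2)^(n + k) + C * (2 * (1/2)^n - 2 * (1/2)^(n + k))"
      by (intro add_mono assms Suc)
    also have "\<dots> = C * (2 * (1/2)^n - 2 * (1/2)^(n + Suc k))" by (simp add: algebra_simps)
    finally show ?case .
  qed simp
  have bound: "dist (f m) (f n) \<le> 2 * C * (1/2)^n" if "n \<le> m" for m n
  proof -
    have "dist (f m) (f n) \<le> C * (2 * (1/2)^n - 2 * (1/2)^m)"
      using step[of n "m - n"] that by simp
    also have "\<dots> \<le> C * (2 * (1/2)^n)" using C by (intro mult_left_mono) auto
    finally show ?thesis by (simp add: ac_simps)
  qed
  have lim: "(\<lambda>n. 2 * C * (1/2)^n) \<longlonglongrightarrow> 2 * C * 0"
    by (intro tendsto_intros LIMSEQ_realpow_zero) auto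
  show ?thesis
  proof (rule metric_CauchyI)
    fix e :: real assume "0 < e"
    then have "\<forall>\<^sub>F n in sequentially. 2 * C * (1/2)^n < e / 2"
      using lim by (intro order_tendstoD) auto
    then obtain N where N: "2 * C * (1/2)^N < e / 2" by (auto simp: eventually_sequentially)
    show "\<exists>M. \<forall>m\<ge>M. \<forall>n\<ge>M. dist (f m) (f n) < e"
    proof (intro exI allI impI)
      fix m n assume "N \<le> m" "N \<le> n"
      then show "dist (f m) (f n) < e"
        using bound[of N m] bound[of N n] N dist_triangle2[of "f m" "f n" "f N"] by linarith
    qed
  qed
qed

text \<open>Squared increments weighted by \<open>4 ^ n\<close> still have summable integrals, so
  their sum is finite almost everywhere. Finiteness at \<open>t\<close> bounds the increment there
  by a constant times \<open>(1/2)^n\<close>.\<close>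

lemma fast_subsequence_AE_Cauchy:
  fixes X :: "nat \<Rightarrow> 'a::{real_inner,complete_space,second_countable_topology} L2"
  assumes X: "\<And>n. dist (X (Suc n)) (X n) < (1/4)^n"
  shows "AE t in lebesgue. Cauchy (\<lambda>n. fn (X n) t)"
proof -
  define u where "u n t = ennreal (4 ^ n) * ennreal ((norm (fn (X (Suc n)) t - fn (X n) t))\<^sup>2)" for n t
  have u_meas [measurable]: "u n \<in> borel_measurable lebesgue" for n
    unfolding u_def by measurable
  have "(\<integral>\<^sup>+t. u n t \<partial>lebesgue) \<le> ennreal ((1/4)^n)" for n
  proof -
    have "(\<integral>\<^sup>+t. u n t \<partial>lebesgue) = ennreal (4 ^ n) * ennreal ((dist (X (Suc n)) (X n))\<^sup>2)"
      unfolding u_def by (subst nn_integral_cmult) (auto simp: nn_integral_fn_diff)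
    also have "\<dots> = ennreal (4 ^ n * (dist (X (Suc n)) (X n))\<^sup>2)" by (simp add: ennreal_mult)
    also have "\<dots> \<le> ennreal (4 ^ n * ((1/4)^n)\<^sup>2)"
      using X[of n] by (intro ennreal_leI mult_left_mono power_mono) auto
    also have "4 ^ n * ((1/4)^n)\<^sup>2 = ((1/4)^n :: real)"
      by (simp add: power2_eq_square field_simps power_one_over)
    finally show ?thesis .
  qed
  then have "(\<Sum>n. \<integral>\<^sup>+t. u n t \<partial>lebesgue) \<le> (\<Sum>n. ennreal ((1/4)^n))"
    by (intro suminf_le) auto
  also have "\<dots> = ennreal (\<Sum>n. (1/4)^n)"
    by (rule suminf_ennreal2) (auto intro!: summable_geometric)
  also have "\<dots> < \<infinity>" by simp
  finally have "(\<integral>\<^sup>+t. (\<Sum>n. u n t) \<partial>lebesgue) \<noteq> \<infinity>"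
    by (subst nn_integral_suminf) auto
  then have "AE t in lebesgue. (\<Sum>n. u n t) \<noteq> \<infinity>"
    by (intro nn_integral_PInf_AE) auto
  then show ?thesis
  proof eventually_elim
    case (elim t)
    then obtain C where C: "(\<Sum>n. u n t) = ennreal C" "C \<ge> 0" by (cases "\<Sum>n. u n t") auto
    show ?case
    proof (rule geometric_steps_Cauchy)
      fix n
      define w where "w = norm (fn (X (Suc n)) t - fn (X n) t)"
      have "u n t \<le> (\<Sum>n. u n t)" using sum_le_suminf[of "\<lambda>n. u n t" "{n}"] by simp
      then have "ennreal (4 ^ n * w\<^sup>2) \<le> ennreal C"
        unfolding C(1) by (simp add: u_def w_def ennreal_mult)
      then have "4 ^ n * w\<^sup>2 \<le> C" using C by (simp add: ennreal_le_iff)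
      moreover have "(2 ^ n)\<^sup>2 = (4::real) ^ n"
        by (simp add: power2_eq_square flip: power_mult_distrib)
      ultimately have "(2 ^ n * w)\<^sup>2 \<le> C" by (simp add: power_mult_distrib)
      then have "2 ^ n * w \<le> sqrt C" by (rule real_le_rsqrt)
      then show "dist (fn (X (Suc n)) t) (fn (X n) t) \<le> sqrt C * (1/2)^n"
        by (simp add: dist_norm w_def field_simps power_one_over)
    qed
  qed
qed

lemma Cauchy_fast_subsequence:
  fixes X :: "nat \<Rightarrow> 'a::metric_space"
  assumes "Cauchy X" and e: "\<And>n. e n > 0"
  obtains r where "strict_mono r" "\<And>n. dist (X (r (Suc n))) (X (r n)) < e n"
proof -
  have "\<exists>M. \<forall>m\<ge>M. \<forall>k\<ge>M. dist (X m) (X k) < e n" for n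
    using assms by (meson metric_CauchyD)
  then obtain M where M: "\<And>n m k. m \<ge> M n \<Longrightarrow> k \<ge> M n \<Longrightarrow> dist (X m) (X k) < e n" by metis
  \<comment> \<open>The summand \<open>n\<close> makes \<open>r\<close> strictly increasing, and the
    partial sum dominates each threshold \<open>M n\<close>.\<close>
  define r where "r n = n + (\<Sum>i\<le>n. M i)" for n
  have "strict_mono r" by (rule strict_monoI_Suc) (simp add: r_def)
  moreover have "r n \<ge> M n" "r (Suc n) \<ge> M n" for n
    by (simp_all add: r_def trans_le_add2 member_le_sum)
      (cases n, auto simp: trans_le_add2 trans_le_add1)
  ultimately show ?thesis using M that by blast
qed

text \<open>Riesz-Fischer: a fast subsequence converges pointwise almost everywhere, and Fatou's
  lemma shows that the pointwise limit is also the limit in norm.\<close>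

instance L2 :: ("{real_inner,complete_space,second_countable_topology}") complete_space
proof
  fix X :: "nat \<Rightarrow> 'a L2"
  assume X: "Cauchy X"
  obtain r where r: "strict_mono r" "\<And>n. dist (X (r (Suc n))) (X (r n)) < (1/4)^n"
    using Cauchy_fast_subsequence[OF X, of "\<lambda>n. (1/4)^n"] by auto
  define f where "f n = fn (X (r n))" for n
  have [measurable]: "f n \<in> borel_measurable lebesgue" for n by (simp add: f_def)
  have "AE t in lebesgue. Cauchy (\<lambda>n. f n t)"
    unfolding f_def by (rule fast_subsequence_AE_Cauchy[of "\<lambda>n. X (r n)", OF r(2)])
  then obtain N where N: "{t. \<not> Cauchy (\<lambda>n. f n t)} \<subseteq> N" "N \<in> null_sets lebesgue"
    by (auto elim!: AE_E simp: null_sets_def)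
  have N_meas [measurable]: "N \<in> sets lebesgue" using N by auto
  define g where "g t = (if t \<in> N then 0 else lim (\<lambda>n. f n t))" for t
  have lim: "(\<lambda>n. if t \<in> N then 0 else f n t) \<longlonglongrightarrow> g t" for t
    using N(1) by (auto simp: g_def Cauchy_convergent_iff convergent_LIMSEQ_iff)
  have g_meas [measurable]: "g \<in> borel_measurable lebesgue"
    by (rule borel_measurable_LIMSEQ_metric[OF _ lim]) simp
  have AE_lim: "AE t in lebesgue. (\<lambda>n. f n t) \<longlonglongrightarrow> g t"
  proof (rule AE_I'[OF N(2)])
    show "{t \<in> space lebesgue. \<not> (\<lambda>n. f n t) \<longlonglongrightarrow> g t} \<subseteq> N"
    proof safe
      fix t assume "\<not> (\<lambda>n. f n t) \<longlonglongrightarrow> g t"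
      then show "t \<in> N" using lim[of t] by (cases "t \<in> N") auto
    qed
  qed
  have close: "(\<integral>\<^sup>+t. ennreal ((norm (g t - f n t))\<^sup>2) \<partial>lebesgue) \<le> ennreal (e\<^sup>2)"
    if e: "\<And>m. m \<ge> n \<Longrightarrow> dist (X (r m)) (X (r n)) \<le> e" for n e
  proof -
    have "(\<integral>\<^sup>+t. ennreal ((norm (g t - f n t))\<^sup>2) \<partial>lebesgue) =
        (\<integral>\<^sup>+t. liminf (\<lambda>m. ennreal ((norm (f m t - f n t))\<^sup>2)) \<partial>lebesgue)"
    proof (rule nn_integral_cong_AE, use AE_lim in eventually_elim)
      fix t assume "(\<lambda>n. f n t) \<longlonglongrightarrow> g t"
      then have "(\<lambda>m. ennreal ((norm (f m t - f n t))\<^sup>2)) \<longlonglongrightarrow> ennreal ((norm (g t - f n t))\<^sup>2)"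
        by (intro tendsto_intros)
      then show "ennreal ((norm (g t - f n t))\<^sup>2) = liminf (\<lambda>m. ennreal ((norm (f m t - f n t))\<^sup>2))"
        by (rule lim_imp_Liminf[OF trivial_limit_sequentially, symmetric])
    qed
    also have "\<dots> \<le> liminf (\<lambda>m. \<integral>\<^sup>+t. ennreal ((norm (f m t - f n t))\<^sup>2) \<partial>lebesgue)"
      by (rule nn_integral_liminf) simp
    also have "\<dots> = liminf (\<lambda>m. ennreal ((dist (X (r m)) (X (r n)))\<^sup>2))"
      unfolding f_def nn_integral_fn_diff ..
    also have "\<dots> \<le> liminf (\<lambda>m. ennreal (e\<^sup>2))"
    proof (rule Liminf_mono)
      show "\<forall>\<^sub>F m in sequentially. ennreal ((dist (X (r m)) (X (r n)))\<^sup>2) \<le> ennreal (e\<^sup>2)"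
        unfolding eventually_sequentially
        by (intro exI[of _ n]) (auto intro!: ennreal_leI power_mono e)
    qed
    finally show ?thesis by (simp add: Liminf_const)
  qed
  have sub_Cauchy: "Cauchy (X \<circ> r)" by (rule Cauchy_subseq_Cauchy[OF X r(1)])
  have sq_diff: "sq_int (\<lambda>t. g t - f n t)"
    if "\<And>m. m \<ge> n \<Longrightarrow> dist (X (r m)) (X (r n)) \<le> e" for n e
    unfolding sq_int_def
  proof (intro conjI integrableI_bounded)
    have "(\<integral>\<^sup>+t. ennreal (norm ((norm (g t - f n t))\<^sup>2)) \<partial>lebesgue) \<le> ennreal (e\<^sup>2)"
      using close[OF that] by simp
    then show "(\<integral>\<^sup>+t. ennreal (norm ((norm (g t - f n t))\<^sup>2)) \<partial>lebesgue) < \<infinity>"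
      by (rule le_less_trans) simp
  qed simp_all
  obtain N1 where N1: "\<And>m. m \<ge> N1 \<Longrightarrow> dist (X (r m)) (X (r N1)) \<le> 1"
    using metric_CauchyD[OF sub_Cauchy, of 1] by (force intro: less_imp_le)
  \<comment> \<open>Fatou only bounds the difference from a member of the sequence; adding that
    member back gives square integrability of \<open>g\<close>.\<close>
  have g: "sq_int g"
    using sq_int_add[OF sq_diff[OF N1] sq_int_fn[of "X (r N1)"]] by (simp add: f_def)
  have "(X \<circ> r) \<longlonglongrightarrow> cls g"
  proof (rule metric_LIMSEQ_I)
    fix e :: real assume "0 < e"
    then obtain M where M: "\<And>m n. m \<ge> M \<Longrightarrow> n \<ge> M \<Longrightarrow> dist (X (r m)) (X (r n)) < e / 2"
      using metric_CauchyD[OF sub_Cauchy, of "e / 2"] by auto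
    show "\<exists>no. \<forall>n\<ge>no. dist ((X \<circ> r) n) (cls g) < e"
    proof (intro exI allI impI)
      fix n assume n: "M \<le> n"
      have "ennreal ((dist (cls g) (X (r n)))\<^sup>2) = (\<integral>\<^sup>+t. ennreal ((norm (fn (cls g) t - f n t))\<^sup>2) \<partial>lebesgue)"
        by (simp add: nn_integral_fn_diff f_def)
      also have "\<dots> = (\<integral>\<^sup>+t. ennreal ((norm (g t - f n t))\<^sup>2) \<partial>lebesgue)"
        by (rule nn_integral_cong_AE) (use fn_cls[OF g] in auto)
      also have "\<dots> \<le> ennreal ((e / 2)\<^sup>2)"
      proof (rule close)
        fix m assume "n \<le> m"
        with n have "dist (X (r m)) (X (r n)) < e / 2" by (intro M) simp_all
        then show "dist (X (r m)) (X (r n)) \<le> e / 2" by simp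
      qed
      finally have "(dist (cls g) (X (r n)))\<^sup>2 \<le> (e / 2)\<^sup>2" by (simp add: ennreal_le_iff)
      then have "dist (cls g) (X (r n)) \<le> e / 2" by (rule power2_le_imp_le) (use \<open>0 < e\<close> in simp)
      then show "dist ((X \<circ> r) n) (cls g) < e" using \<open>0 < e\<close> by (simp add: dist_commute)
    qed
  qed
  then show "convergent X"
    using Cauchy_converges_subseq[OF X r(1)] by (auto simp: convergent_def)
qed

section \<open>Pointwise action of bounded operators\<close>

definition lift_L2 :: "('a \<Rightarrow> 'b) \<Rightarrow> 'a::{real_inner,second_countable_topology} L2 \<Rightarrow>
    'b::{real_inner,second_countable_topology} L2" where
  "lift_L2 A F = cls (\<lambda>t. A (fn F t))"

lemma fn_lift_L2:
  assumes "bounded_linear A"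
  shows "AE t in lebesgue. fn (lift_L2 A F) t = A (fn F t)"
  unfolding lift_L2_def by (rule fn_cls[OF sq_int_bounded_linear[OF assms sq_int_fn]])

lemma lift_L2_inner:
  assumes "bounded_linear A"
  shows "lift_L2 A F \<bullet> G = (LINT t|lebesgue. A (fn F t) \<bullet> fn G t)"
  unfolding inner_L2_eq
proof (rule integral_cong_AE)
  show "AE t in lebesgue. fn (lift_L2 A F) t \<bullet> fn G t = A (fn F t) \<bullet> fn G t"
    using fn_lift_L2[OF assms, of F] by auto
qed (auto intro!: borel_measurable_inner
  sq_int_measurable[OF sq_int_bounded_linear[OF assms sq_int_fn]])

lemma norm_L2_le:
  assumes "AE t in lebesgue. norm (fn F t) \<le> K * norm (fn G t)" "K \<ge> 0"
  shows "norm F \<le> K * norm G"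
proof -
  have "(norm F)\<^sup>2 \<le> (LINT t|lebesgue. K\<^sup>2 * (norm (fn G t))\<^sup>2)"
    unfolding norm_L2_eq
  proof (rule integral_mono_AE)
    show "AE t in lebesgue. (norm (fn F t))\<^sup>2 \<le> K\<^sup>2 * (norm (fn G t))\<^sup>2"
      using assms by (auto simp flip: power_mult_distrib intro: power_mono)
  qed (auto intro: sq_int_integrable sq_int_fn)
  also have "\<dots> = (K * norm G)\<^sup>2" by (simp add: norm_L2_eq power_mult_distrib)
  finally show ?thesis by (rule power2_le_imp_le) (use assms(2) in simp)
qed

lemma bounded_linear_lift_L2:
  assumes A: "bounded_linear A"
  shows "bounded_linear (lift_L2 A)"
proof -
  interpret A: bounded_linear A by (rule A)
  obtain K where K: "\<And>x. norm (A x) \<le> norm x * K" "K > 0" using A.pos_bounded by blast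
  show ?thesis
  proof (rule bounded_linear_intro[where K = K])
    show "lift_L2 A (F + G) = lift_L2 A F + lift_L2 A G" for F G
      unfolding L2_eq_iff
      using fn_lift_L2[OF A, of F] fn_lift_L2[OF A, of G] fn_lift_L2[OF A, of "F + G"] fn_add[of F G]
        fn_add[of "lift_L2 A F" "lift_L2 A G"]
      by eventually_elim (simp add: A.add)
    show "lift_L2 A (c *\<^sub>R F) = c *\<^sub>R lift_L2 A F" for c F
      unfolding L2_eq_iff
      using fn_lift_L2[OF A, of F] fn_lift_L2[OF A, of "c *\<^sub>R F"] fn_scaleR[of c F]
        fn_scaleR[of c "lift_L2 A F"]
      by eventually_elim (simp add: A.scaleR)
    show "norm (lift_L2 A F) \<le> norm F * K" for F
    proof -
      have "AE t in lebesgue. norm (fn (lift_L2 A F) t) \<le> K * norm (fn F t)"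
        using fn_lift_L2[OF A, of F] by eventually_elim (use K in \<open>simp add: mult.commute\<close>)
      from norm_L2_le[OF this] K show ?thesis by (simp add: mult.commute)
    qed
  qed
qed

lemma lift_L2_adjoint:
  assumes "bounded_linear A" "bounded_linear A'" "\<And>x y. A x \<bullet> y = x \<bullet> A' y"
  shows "lift_L2 A F \<bullet> G = F \<bullet> lift_L2 A' G"
proof -
  have "A (fn F t) \<bullet> fn G t = A' (fn G t) \<bullet> fn F t" for t
    using assms(3)[of "fn F t" "fn G t"] by (simp add: inner_commute)
  then have "lift_L2 A F \<bullet> G = lift_L2 A' G \<bullet> F"
    by (simp add: lift_L2_inner assms(1,2))
  then show ?thesis by (simp only: inner_commute)
qed

lemma lift_L2_coercive:
  assumes A: "bounded_linear A" and c: "\<And>x. c * (norm x)\<^sup>2 \<le> A x \<bullet> x"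
  shows "c * (norm F)\<^sup>2 \<le> lift_L2 A F \<bullet> F"
proof -
  have "c * (norm F)\<^sup>2 = (LINT t|lebesgue. c * (norm (fn F t))\<^sup>2)" by (simp add: norm_L2_eq)
  also have "\<dots> \<le> (LINT t|lebesgue. A (fn F t) \<bullet> fn F t)"
    using c by (intro integral_mono integrable_inner_sq_int sq_int_bounded_linear[OF A] sq_int_fn)
      (auto intro: sq_int_integrable sq_int_fn)
  finally show ?thesis by (simp add: lift_L2_inner[OF A])
qed

section \<open>Weak integrals\<close>

lemma borel_measurable_ident_lebesgue_on [measurable]: "(\<lambda>x. x) \<in> borel_measurable (lebesgue_on S)"
  by (intro measurable_restrict_space1 measurable_completion measurable_ident_sets) simp

text \<open>Half-lines form an intersection-stable generator of the Borel sets, and the sets with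
  zero integral are closed under complement (by \<open>total\<close>) and countable disjoint union.
  Lebesgue sets differ from Borel sets by null sets only.\<close>

lemma AE_zero_if_initial_integrals_zero:
  fixes f :: "real \<Rightarrow> real"
  assumes f: "integrable lebesgue f" and zero: "\<And>t. (LINT s:{..<t}|lebesgue. f s) = 0"
    and total: "(LINT s|lebesgue. f s) = 0"
  shows "AE s in lebesgue. f s = 0"
proof -
  have set_f: "set_integrable lebesgue A f" if "A \<in> sets lebesgue" for A :: "real set"
    unfolding set_integrable_def by (rule integrable_mult_indicator[OF that f])
  have borel: "(LINT s:A|lebesgue. f s) = 0" if "A \<in> sets borel" for A :: "real set"
  proof -
    have A: "A \<in> sigma_sets UNIV (range lessThan)"
      using that by (simp add: borel_Iio)
    show ?thesis
    proof (rule sigma_sets_induct_disjoint[OF _ _ A])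
      show "Int_stable (range lessThan :: real set set)"
      proof (rule Int_stableI)
        fix a b :: "real set" assume "a \<in> range lessThan" "b \<in> range lessThan"
        then obtain x y where "a = {..<x}" "b = {..<y}" by auto
        then have "a \<inter> b = {..<min x y}" by auto
        then show "a \<inter> b \<in> range lessThan" by auto
      qed
      show "range lessThan \<subseteq> Pow (UNIV :: real set)" by simp
      show "(LINT s:A|lebesgue. f s) = 0" if "A \<in> range lessThan" for A :: "real set"
        using that zero by auto
      show "(LINT s:({}::real set)|lebesgue. f s) = 0" by (simp add: set_lebesgue_integral_def)
      show "(LINT s:UNIV - A|lebesgue. f s) = 0"
        if "A \<in> sigma_sets UNIV (range lessThan)" "(LINT s:A|lebesgue. f s) = 0" for A :: "real set"
      proof -
        have "A \<in> sets borel" using that(1) by (simp add: borel_Iio)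
        then have "A \<in> sets lebesgue" by simp
        then have "(LINT s:A \<union> (UNIV - A)|lebesgue. f s) = (LINT s:A|lebesgue. f s) + (LINT s:UNIV - A|lebesgue. f s)"
          by (intro set_integral_Un set_f) auto
        moreover have "(LINT s:A \<union> (UNIV - A)|lebesgue. f s) = 0"
          using total by (simp add: set_lebesgue_integral_def)
        ultimately show ?thesis using that by simp
      qed
      show "(LINT s:(\<Union>i::nat. A i)|lebesgue. f s) = 0"
        if "disjoint_family A" "range A \<subseteq> sigma_sets UNIV (range lessThan)"
          "\<And>i. (LINT s:A i|lebesgue. f s) = 0" for A :: "nat \<Rightarrow> real set"
      proof -
        have "A i \<in> sets borel" for i using that(2) by (auto simp: borel_Iio)
        then have A: "A i \<in> sets lebesgue" for i by simp
        have "(LINT s:(\<Union>i. A i)|lebesgue. f s) = (\<Sum>i. (LINT s:A i|lebesgue. f s))"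
          using that(1) A by (intro lebesgue_integral_countable_add set_f sets.countable_UN)
            (auto simp: disjoint_family_on_def)
        then show ?thesis using that(3) by simp
      qed
    qed
  qed
  have "AE s in lebesgue. f s = (\<lambda>_. 0) s"
  proof (rule density_unique_real[OF f])
    fix A :: "real set" assume "A \<in> sets lebesgue"
    then obtain S N N' where S: "A = S \<union> N" "N \<subseteq> N'" "N' \<in> null_sets lborel" "S \<in> sets lborel"
      by (rule sets_completionE)
    have N': "N' \<in> null_sets lebesgue" using S(3) by (rule null_sets_completionI)
    have A: "A \<in> sets lebesgue" by fact
    have "AE s in lebesgue. s \<notin> N'" using N' by (rule AE_not_in)
    then have "AE s in lebesgue. indicator A s *\<^sub>R f s = indicator S s *\<^sub>R f s"
      by eventually_elim (use S in \<open>auto simp: indicator_def\<close>)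
    then have "(LINT s:A|lebesgue. f s) = (LINT s:S|lebesgue. f s)"
      unfolding set_lebesgue_integral_def using A S
      by (intro integral_cong_AE borel_measurable_integrable set_f[unfolded set_integrable_def]) auto
    also have "\<dots> = 0" using borel S by simp
    finally show "(LINT s:A|lebesgue. f s) = (LINT s:A|lebesgue. (\<lambda>_. 0) s)"
      by (simp add: set_lebesgue_integral_def)
  qed simp
  then show ?thesis by simp
qed

text \<open>The exceptional set depends on \<open>v\<close>, so only a countable dense set of
  \<open>v\<close> is used. A dense vector closer to \<open>f t\<close> than
  \<open>norm (f t)\<close> cannot be orthogonal to a nonzero \<open>f t\<close>.\<close>

lemma AE_eq_zero_if_inner:
  fixes f :: "'b \<Rightarrow> 'a::{real_inner,second_countable_topology}"
  assumes "\<And>v. AE t in M. f t \<bullet> v = 0"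
  shows "AE t in M. f t = 0"
proof -
  obtain D :: "'a set" where D: "countable D" "\<And>X. open X \<Longrightarrow> X \<noteq> {} \<Longrightarrow> \<exists>d\<in>D. d \<in> X"
    using countable_dense_exists by blast
  have "AE t in M. \<forall>v\<in>D. f t \<bullet> v = 0"
    using assms D(1) by (simp add: AE_ball_countable)
  then show ?thesis
  proof eventually_elim
    case (elim t)
    show ?case
    proof (rule ccontr)
      assume nz: "f t \<noteq> 0"
      then obtain d where d: "d \<in> D" "d \<in> ball (f t) (norm (f t))"
        using D(2)[of "ball (f t) (norm (f t))"] by auto
      have "(norm (f t))\<^sup>2 = f t \<bullet> (f t - d)"
        using elim d(1) by (simp add: inner_diff_right power2_norm_eq_inner)
      also have "\<dots> \<le> norm (f t) * norm (f t - d)" by (rule norm_cauchy_schwarz)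
      also have "\<dots> < norm (f t) * norm (f t)"
        using d(2) nz by (simp add: dist_norm)
      finally show False by (simp add: power2_eq_square)
    qed
  qed
qed

lemma integrable_indicator_lmeasurable:
  "A \<in> lmeasurable \<Longrightarrow> integrable lebesgue (indicator A :: real \<Rightarrow> real)"
  by (auto simp: fmeasurable_def)

definition ind :: "real set \<Rightarrow> 'a::{real_inner,second_countable_topology} \<Rightarrow> 'a L2" where
  "ind A v = cls (\<lambda>s. indicator A s *\<^sub>R v)"

lemma sq_int_indicator:
  assumes "A \<in> lmeasurable"
  shows "sq_int (\<lambda>s. indicator A s *\<^sub>R v)"
proof (rule sq_intI_bounded)
  show "(\<lambda>s. indicator A s *\<^sub>R v) \<in> borel_measurable lebesgue"
    using assms by (intro borel_measurable_scaleR) auto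
  show "integrable lebesgue (\<lambda>s. indicator A s * (norm v)\<^sup>2)"
    using assms by (auto simp: fmeasurable_def)
qed (auto simp: indicator_def)

lemma fn_ind: "A \<in> lmeasurable \<Longrightarrow> AE s in lebesgue. fn (ind A v) s = indicator A s *\<^sub>R v"
  unfolding ind_def by (rule fn_cls[OF sq_int_indicator])

lemma ind_empty: "ind {} v = 0"
  unfolding ind_def zero_L2_def by simp

text \<open>By duality this becomes the modulus of continuity of primitives in
  \<open>prim_Holder\<close>; with \<open>B = {}\<close> it gives the norm of
  \<open>ind A v\<close>.\<close>

lemma norm_ind_diff:
  assumes "A \<in> lmeasurable" "B \<in> lmeasurable"
  shows "(norm (ind A v - ind B v))\<^sup>2 = measure lebesgue ((A - B) \<union> (B - A)) * (norm v)\<^sup>2"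
proof -
  have AB: "A - B \<union> (B - A) \<in> lmeasurable" using assms by auto
  have "(norm (ind A v - ind B v))\<^sup>2 =
      (LINT s|lebesgue. indicator ((A - B) \<union> (B - A)) s * (norm v)\<^sup>2)"
    unfolding norm_L2_eq
  proof (rule integral_cong_AE)
    show "AE s in lebesgue. (norm (fn (ind A v - ind B v) s))\<^sup>2 =
        indicator ((A - B) \<union> (B - A)) s * (norm v)\<^sup>2"
      using fn_diff[of "ind A v" "ind B v"] fn_ind[OF assms(1), of v] fn_ind[OF assms(2), of v]
      by eventually_elim (auto simp: indicator_def)
  qed (use AB in auto)
  then show ?thesis using AB by (simp add: fmeasurable_def)
qed

lemma bounded_linear_ind:
  assumes A: "A \<in> lmeasurable"
  shows "bounded_linear (ind A)"
proof (rule bounded_linear_intro[where K = "sqrt (measure lebesgue A)"])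
  show "ind A (x + y) = ind A x + ind A y" for x y
    unfolding L2_eq_iff using fn_ind[OF A, of x] fn_ind[OF A, of y] fn_ind[OF A, of "x + y"]
      fn_add[of "ind A x" "ind A y"]
    by eventually_elim (simp add: scaleR_add_right)
  show "ind A (c *\<^sub>R x) = c *\<^sub>R ind A x" for c x
    unfolding L2_eq_iff using fn_ind[OF A, of x] fn_ind[OF A, of "c *\<^sub>R x"] fn_scaleR[of c "ind A x"]
    by eventually_elim simp
  then show "norm (ind A v) \<le> norm v * sqrt (measure lebesgue A)" for v
    using norm_ind_diff[OF A, of "{}" v]
    by (intro power2_le_imp_le[of "norm (ind A v)"]) (auto simp: power_mult_distrib ind_empty)
qed

text \<open>
  The integral of \<open>F\<close> over \<open>A\<close>, defined by duality: the Bochner integral of the library asks for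
  the class \<^class>\<open>banach\<close>, of which a type in \<^class>\<open>real_inner\<close> and
  \<^class>\<open>complete_space\<close> is not an instance.
\<close>

definition wint :: "real set \<Rightarrow> 'a::{real_inner,complete_space,second_countable_topology} L2 \<Rightarrow> 'a" where
  "wint A = (SOME L. bounded_linear L \<and> (\<forall>F v. L F \<bullet> v = F \<bullet> ind A v))"

lemma wint:
  fixes F :: "'a::{real_inner,complete_space,second_countable_topology} L2"
  assumes "A \<in> lmeasurable"
  shows "bounded_linear (wint A :: 'a L2 \<Rightarrow> 'a)" and "wint A F \<bullet> v = F \<bullet> ind A v"
proof -
  obtain L :: "'a L2 \<Rightarrow> 'a" where "bounded_linear L" "\<And>v F. ind A v \<bullet> F = v \<bullet> L F"
    using bounded_linear_adjoint_exists[OF bounded_linear_ind[OF assms]] by blast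
  then have "bounded_linear L \<and> (\<forall>F v. L F \<bullet> v = F \<bullet> ind A v)" by (metis inner_commute)
  then have "bounded_linear (wint A :: 'a L2 \<Rightarrow> 'a) \<and> (\<forall>F v. wint A F \<bullet> v = F \<bullet> ind A (v::'a))"
    unfolding wint_def
    by (rule someI[of "\<lambda>L. bounded_linear L \<and> (\<forall>F v. L F \<bullet> v = F \<bullet> ind A v)"])
  then show "bounded_linear (wint A :: 'a L2 \<Rightarrow> 'a)" "wint A F \<bullet> v = F \<bullet> ind A v" by auto
qed

lemma wint_inner:
  assumes "A \<in> lmeasurable"
  shows "wint A F \<bullet> v = (LINT s|lebesgue. indicator A s * (fn F s \<bullet> v))"
proof -
  have A [measurable]: "A \<in> sets lebesgue" using assms by auto
  have m: "fn F \<in> borel_measurable lebesgue" by simp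
  show ?thesis
    unfolding wint(2)[OF assms] inner_L2_eq
  proof (rule integral_cong_AE)
    show "AE s in lebesgue. fn F s \<bullet> fn (ind A v) s = indicator A s * (fn F s \<bullet> v)"
      using fn_ind[OF assms, of v] by eventually_elim simp
  qed (intro borel_measurable_inner borel_measurable_times borel_measurable_indicator; simp)+
qed

text \<open>Dual to the fact that the adjoint \<open>B'\<close> takes \<open>ind A v\<close> to
  \<open>ind A (B' v)\<close>. This is why integration in time commutes with operators in
  space.\<close>

lemma wint_lift_L2:
  assumes A: "A \<in> lmeasurable" and B: "bounded_linear B"
  shows "wint A (lift_L2 B F) = B (wint A F)"
proof -
  obtain B' where B': "bounded_linear B'" "\<And>x y. B x \<bullet> y = x \<bullet> B' y"
    using bounded_linear_adjoint_exists[OF B] by blast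
  have lift_ind: "lift_L2 B' (ind A v) = ind A (B' v)" for v
    unfolding L2_eq_iff using fn_lift_L2[OF B'(1), of "ind A v"] fn_ind[OF A, of v] fn_ind[OF A, of "B' v"]
    by eventually_elim (simp add: linear_scale[OF bounded_linear.linear[OF B'(1)]])
  have "(wint A (lift_L2 B F) - B (wint A F)) \<bullet> v = 0" for v
    by (simp add: inner_diff_left wint[OF A] B' lift_L2_adjoint[OF B B'] lift_ind)
  from this[of "wint A (lift_L2 B F) - B (wint A F)"] show ?thesis by simp
qed

section \<open>Integration from an end point of the time interval\<close>

text \<open>
  The order \<open>r\<close> is that of time for the state and the reversed one for the adjoint;
  \<open>start r T\<close> and \<open>stop r T\<close> are the first and the last instant with respect to \<open>r\<close>.
\<close>

definition time_order :: "(real \<Rightarrow> real \<Rightarrow> bool) \<Rightarrow> bool" where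
  "time_order r \<longleftrightarrow> r = (<) \<or> r = (>)"

definition start :: "(real \<Rightarrow> real \<Rightarrow> bool) \<Rightarrow> real \<Rightarrow> real" where
  "start r T = (if r 0 1 then 0 else T)"

definition stop :: "(real \<Rightarrow> real \<Rightarrow> bool) \<Rightarrow> real \<Rightarrow> real" where
  "stop r T = (if r 0 1 then T else 0)"

definition slab :: "(real \<Rightarrow> real \<Rightarrow> bool) \<Rightarrow> real \<Rightarrow> real \<Rightarrow> real set" where
  "slab r T t = {s \<in> {0<..<T}. r s t}"

definition prim :: "(real \<Rightarrow> real \<Rightarrow> bool) \<Rightarrow> real \<Rightarrow>
    'a::{real_inner,complete_space,second_countable_topology} L2 \<Rightarrow> real \<Rightarrow> 'a" where
  "prim r T F t = wint (slab r T t) F"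

text \<open>Outside the time interval the operator is the identity, which keeps it injective.\<close>

definition volt :: "(real \<Rightarrow> real \<Rightarrow> bool) \<Rightarrow> real \<Rightarrow>
    'a::{real_inner,complete_space,second_countable_topology} L2 \<Rightarrow> 'a L2" where
  "volt r T F = cls (\<lambda>t. if t \<in> {0<..<T} then prim r T F t else fn F t)"

lemma time_order_less: "time_order (<)" and time_order_greater: "time_order (>)"
  by (auto simp: time_order_def)

lemma time_order_cases:
  assumes "time_order r"
  obtains "r = (<)" | "r = (>)"
  using assms by (auto simp: time_order_def)

lemma slab_lmeasurable: "time_order r \<Longrightarrow> slab r T t \<in> lmeasurable"
proof (erule time_order_cases)
  assume "r = (<)"
  then have "slab r T t = {0<..<min T t}" by (auto simp: slab_def)
  then show ?thesis by simp
next
  assume "r = (>)"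
  then have "slab r T t = {max 0 t<..<T}" by (auto simp: slab_def)
  then show ?thesis by simp
qed

lemma slab_start: "time_order r \<Longrightarrow> slab r T (start r T) = {}"
  by (erule time_order_cases) (auto simp: slab_def start_def)

lemma slab_stop: "time_order r \<Longrightarrow> slab r T (stop r T) = {0<..<T}"
  by (erule time_order_cases) (auto simp: slab_def stop_def)

lemma indicator_slab: "indicator (slab r T t) s = (indicator {0<..<T} s * of_bool (r s t) :: real)"
  by (auto simp: slab_def indicator_def)

text \<open>A kernel on the fixed interval replaces the variable domain, so that Fubini becomes
  applicable.\<close>

lemma prim_inner:
  assumes "time_order r"
  shows "prim r T F t \<bullet> v = (LINT s|lebesgue_on {0<..<T}. of_bool (r s t) * (fn F s \<bullet> v))"
  unfolding prim_def wint_inner[OF slab_lmeasurable[OF assms]]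
  by (simp add: integral_restrict_space indicator_slab mult.assoc)

lemma bounded_linear_prim: "time_order r \<Longrightarrow> bounded_linear (\<lambda>F. prim r T F t)"
  unfolding prim_def by (rule wint(1)[OF slab_lmeasurable])

lemma prim_lift_L2:
  "time_order r \<Longrightarrow> bounded_linear B \<Longrightarrow> prim r T (lift_L2 B F) t = B (prim r T F t)"
  unfolding prim_def by (rule wint_lift_L2[OF slab_lmeasurable])

text \<open>The increment \<open>w\<close> is paired with itself: Cauchy-Schwarz leaves the norm of
  \<open>w\<close> on the symmetric difference of two slabs, whose length is at most
  \<open>\<bar>t - s\<bar>\<close>.\<close>

lemma prim_Holder:
  assumes r: "time_order r"
  shows "norm (prim r T F t - prim r T F s) \<le> sqrt \<bar>t - s\<bar> * norm F"
proof -
  define w where "w = prim r T F t - prim r T F s"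
  have "slab r T t - slab r T s \<union> (slab r T s - slab r T t) \<subseteq> {min s t..max s t}"
    using r by (cases rule: time_order_cases) (auto simp: slab_def)
  then have "measure lebesgue (slab r T t - slab r T s \<union> (slab r T s - slab r T t)) \<le> measure lebesgue {min s t..max s t}"
    using slab_lmeasurable[OF r] by (intro measure_mono_fmeasurable) auto
  also have "\<dots> = \<bar>t - s\<bar>" by (simp add: min_def max_def)
  finally have m: "(norm (ind (slab r T t) w - ind (slab r T s) w))\<^sup>2 \<le> \<bar>t - s\<bar> * (norm w)\<^sup>2"
    unfolding norm_ind_diff[OF slab_lmeasurable[OF r] slab_lmeasurable[OF r]]
    by (intro mult_right_mono) auto
  have m': "norm (ind (slab r T t) w - ind (slab r T s) w) \<le> sqrt \<bar>t - s\<bar> * norm w"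
    using real_sqrt_le_mono[OF m] by (simp add: real_sqrt_mult)
  have "(norm w)\<^sup>2 = F \<bullet> (ind (slab r T t) w - ind (slab r T s) w)"
    unfolding power2_norm_eq_inner
    by (subst (1) w_def) (simp add: prim_def inner_diff_left inner_diff_right wint[OF slab_lmeasurable[OF r]])
  also have "\<dots> \<le> norm F * (sqrt \<bar>t - s\<bar> * norm w)"
    using norm_cauchy_schwarz[of F "ind (slab r T t) w - ind (slab r T s) w"]
      mult_left_mono[OF m' norm_ge_zero[of F]] by linarith
  finally have "norm w * norm w \<le> norm w * (sqrt \<bar>t - s\<bar> * norm F)"
    by (simp add: power2_eq_square ac_simps)
  then show ?thesis by (cases "w = 0") (auto simp: w_def mult_le_cancel_left)
qed

lemma prim_start: "time_order r \<Longrightarrow> prim r T F (start r T) = 0"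
  using bounded_linear_prim[of r T "start r T"] slab_start[of r T]
    wint(2)[of "{}" F "prim r T F (start r T)"]
  by (simp add: prim_def ind_empty)

lemma continuous_prim:
  assumes r: "time_order r"
  shows "continuous_on S (prim r T F)"
proof (rule continuous_on_subset[of UNIV])
  show "continuous_on UNIV (prim r T F)"
    unfolding continuous_on_def
  proof safe
    fix s
    have "((\<lambda>t. sqrt \<bar>t - s\<bar> * norm F) \<longlongrightarrow> sqrt \<bar>s - s\<bar> * norm F) (at s)"
      by (intro tendsto_intros)
    then have lim: "((\<lambda>t. sqrt \<bar>t - s\<bar> * norm F) \<longlongrightarrow> 0) (at s)" by simp
    show "(prim r T F \<longlongrightarrow> prim r T F s) (at s)"
      by (rule LIM_zero_cancel, rule Lim_null_comparison[OF _ lim])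
        (intro always_eventually allI prim_Holder[OF r])
  qed
qed simp

lemma norm_prim_le:
  assumes r: "time_order r" and t: "t \<in> {0<..<T}"
  shows "norm (prim r T F t) \<le> sqrt T * norm F"
proof -
  have "norm (prim r T F t - prim r T F (start r T)) \<le> sqrt \<bar>t - start r T\<bar> * norm F"
    by (rule prim_Holder[OF r])
  also have "\<dots> \<le> sqrt T * norm F"
    using t by (intro mult_right_mono) (auto simp: start_def)
  finally show ?thesis by (simp add: prim_start[OF r])
qed

lemma sq_int_volt:
  assumes r: "time_order r"
  shows "sq_int (\<lambda>t. if t \<in> {0<..<T} then prim r T F t else fn F t)"
proof (rule sq_intI_bounded)
  have [measurable]: "prim r T F \<in> borel_measurable lebesgue"
    by (intro measurable_completion) (use borel_measurable_continuous_onI[OF continuous_prim[OF r]] in simp)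
  have [measurable]: "{0<..<T} \<in> sets lebesgue" by simp
  show "(\<lambda>t. if t \<in> {0<..<T} then prim r T F t else fn F t) \<in> borel_measurable lebesgue"
    by measurable
  show "integrable lebesgue (\<lambda>t. indicator {0<..<T} t * (sqrt T * norm F)\<^sup>2 + (norm (fn F t))\<^sup>2)"
    by (intro Bochner_Integration.integrable_add integrable_mult_left sq_int_integrable sq_int_fn
        integrable_indicator_lmeasurable) simp
  show "AE t in lebesgue. (norm (if t \<in> {0<..<T} then prim r T F t else fn F t))\<^sup>2
      \<le> indicator {0<..<T} t * (sqrt T * norm F)\<^sup>2 + (norm (fn F t))\<^sup>2"
  proof (rule AE_I2)
    fix t
    show "(norm (if t \<in> {0<..<T} then prim r T F t else fn F t))\<^sup>2
      \<le> indicator {0<..<T} t * (sqrt T * norm F)\<^sup>2 + (norm (fn F t))\<^sup>2"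
    proof (cases "t \<in> {0<..<T}")
      case True
      then have "(norm (prim r T F t))\<^sup>2 \<le> (sqrt T * norm F)\<^sup>2"
        by (intro power_mono norm_prim_le[OF r]) auto
      then show ?thesis using True by (simp add: add_increasing2)
    qed (simp del: greaterThanLessThan_iff)
  qed
qed

lemma fn_volt:
  "time_order r \<Longrightarrow> AE t in lebesgue. fn (volt r T F) t = (if t \<in> {0<..<T} then prim r T F t else fn F t)"
  unfolding volt_def by (rule fn_cls[OF sq_int_volt])

lemma bounded_linear_volt:
  assumes r: "time_order r" and T: "T > 0"
  shows "bounded_linear (volt r T)"
\<comment> \<open>On the interval the primitive is at most \<open>sqrt T * norm F\<close>, which
  integrates to \<open>T * T\<close> times the squared norm; the identity outside adds 1, and
  \<open>T\<^sup>2 + 1\<close> is at most the square of \<open>T + 1\<close>.\<close>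
proof (rule bounded_linear_intro[where K = "T + 1"])
  interpret P: bounded_linear "\<lambda>F. prim r T F t" for t by (rule bounded_linear_prim[OF r])
  show "volt r T (F + G) = volt r T F + volt r T G" for F G
    unfolding L2_eq_iff
    using fn_volt[OF r, of T F] fn_volt[OF r, of T G] fn_volt[OF r, of T "F + G"] fn_add[of F G]
      fn_add[of "volt r T F" "volt r T G"]
    by eventually_elim (simp add: P.add)
  show "volt r T (c *\<^sub>R F) = c *\<^sub>R volt r T F" for c F
    unfolding L2_eq_iff
    using fn_volt[OF r, of T F] fn_volt[OF r, of T "c *\<^sub>R F"] fn_scaleR[of c F] fn_scaleR[of c "volt r T F"]
    by eventually_elim (simp add: P.scaleR)
  show "norm (volt r T F) \<le> norm F * (T + 1)" for F
  proof (rule power2_le_imp_le)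
    have "(norm (volt r T F))\<^sup>2 \<le> (LINT t|lebesgue. indicator {0<..<T} t * (T * (norm F)\<^sup>2) + (norm (fn F t))\<^sup>2)"
      unfolding norm_L2_eq[of "volt r T F"]
    proof (rule integral_mono_AE)
      show "integrable lebesgue (\<lambda>t. indicator {0<..<T} t * (T * (norm F)\<^sup>2) + (norm (fn F t))\<^sup>2)"
        by (intro Bochner_Integration.integrable_add integrable_mult_left sq_int_integrable sq_int_fn
        integrable_indicator_lmeasurable) simp
      show "AE t in lebesgue. (norm (fn (volt r T F) t))\<^sup>2 \<le> indicator {0<..<T} t * (T * (norm F)\<^sup>2) + (norm (fn F t))\<^sup>2"
        using fn_volt[OF r, of T F]
      proof eventually_elim
        case (elim t)
        show ?case
        proof (cases "t \<in> {0<..<T}")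
          case True
          then have "(norm (prim r T F t))\<^sup>2 \<le> (sqrt T * norm F)\<^sup>2"
            by (intro power_mono norm_prim_le[OF r]) auto
          then show ?thesis using True T elim by (simp add: add_increasing2 power_mult_distrib)
        qed (use elim in \<open>simp del: greaterThanLessThan_iff\<close>)
      qed
    qed (intro sq_int_integrable sq_int_fn)
    also have "\<dots> = T * (T * (norm F)\<^sup>2) + (norm F)\<^sup>2"
      using T integrable_indicator_lmeasurable[of "{0<..<T}"]
      by (subst Bochner_Integration.integral_add) (auto simp: norm_L2_eq[of F] intro: sq_int_integrable sq_int_fn)
    also have "\<dots> \<le> (norm F * (T + 1))\<^sup>2"
      using T by (simp add: power_mult_distrib power2_eq_square algebra_simps)
    finally show "(norm (volt r T F))\<^sup>2 \<le> (norm F * (T + 1))\<^sup>2" .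
  qed (use T in simp)
qed

lemma volt_lift_L2:
  assumes r: "time_order r" and B: "bounded_linear B"
  shows "lift_L2 B (volt r T F) = volt r T (lift_L2 B F)"
  unfolding L2_eq_iff
  using fn_lift_L2[OF B, of "volt r T F"] fn_volt[OF r, of T F] fn_volt[OF r, of T "lift_L2 B F"]
    fn_lift_L2[OF B, of F]
  by eventually_elim (simp add: prim_lift_L2[OF r B])

lemma prim_zero_imp:
  assumes r: "time_order r" and T: "T > 0" and zero: "\<And>t. prim r T F t = 0"
  shows "AE t in lebesgue. t \<in> {0<..<T} \<longrightarrow> fn F t = 0"
proof -
  have "AE t in lebesgue. indicator {0<..<T} t *\<^sub>R fn F t = 0"
  proof (rule AE_eq_zero_if_inner)
    fix v
    have int: "integrable lebesgue (\<lambda>s. fn F s \<bullet> (indicator {0<..<T} s *\<^sub>R v))"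
      by (intro integrable_inner_sq_int sq_int_fn sq_int_indicator) simp
    have slab_zero: "(LINT s|lebesgue. indicator (slab r T t) s * (fn F s \<bullet> v)) = 0" for t
      using zero[of t] wint_inner[OF slab_lmeasurable[OF r], of T t F v] by (simp add: prim_def)
    have total: "(LINT s|lebesgue. indicator {0<..<T} s * (fn F s \<bullet> v)) = 0"
      using slab_zero[of "stop r T"] by (simp add: slab_stop[OF r])
    have "AE t in lebesgue. fn F t \<bullet> (indicator {0<..<T} t *\<^sub>R v) = 0"
    proof (rule AE_zero_if_initial_integrals_zero[OF int])
      show "(LINT s|lebesgue. fn F s \<bullet> (indicator {0<..<T} s *\<^sub>R v)) = 0"
        using total by simp
      fix t
      show "(LINT s:{..<t}|lebesgue. fn F s \<bullet> (indicator {0<..<T} s *\<^sub>R v)) = 0"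
        using r
      proof (cases rule: time_order_cases)
        case 1
        have "indicator {..<t} s * (indicator {0<..<T} s * x) = indicator (slab r T t) s * x" for s x :: real
          by (auto simp: 1 slab_def indicator_def)
        then show ?thesis
          unfolding set_lebesgue_integral_def real_scaleR_def inner_scaleR_right
          by (simp only: slab_zero)
      next
        case 2
        \<comment> \<open>In reversed time the slabs are final segments, so an initial integral is
          the total minus a slab integral; the two descriptions disagree at most at the point
          \<open>t\<close>.\<close>
        have eq: "AE s in lebesgue. indicator {..<t} s * (indicator {0<..<T} s * (fn F s \<bullet> v)) =
            indicator {0<..<T} s * (fn F s \<bullet> v) - indicator (slab r T t) s * (fn F s \<bullet> v)"
          using AE_lborel_singleton[THEN AE_completion, of t]
          by eventually_elim (auto simp: 2 slab_def indicator_def)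
        have i1: "integrable lebesgue (\<lambda>s. indicator {0<..<T} s * (fn F s \<bullet> v))" using int by simp
        have i2: "integrable lebesgue (\<lambda>s. indicator (slab r T t) s * (fn F s \<bullet> v))"
          using integrable_inner_sq_int[OF sq_int_fn sq_int_indicator[OF slab_lmeasurable[OF r]], of F T t v]
          by simp
        have "(LINT s|lebesgue. indicator {..<t} s * (indicator {0<..<T} s * (fn F s \<bullet> v))) =
            (LINT s|lebesgue. indicator {0<..<T} s * (fn F s \<bullet> v) - indicator (slab r T t) s * (fn F s \<bullet> v))"
        proof (rule integral_cong_AE[OF _ _ eq])
          show "(\<lambda>s. indicator {..<t} s * (indicator {0<..<T} s * (fn F s \<bullet> v))) \<in> borel_measurable lebesgue"
            by (intro borel_measurable_times borel_measurable_indicator borel_measurable_integrable[OF i1]) simp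
        qed (use i1 i2 in auto)
        also have "\<dots> = 0" using i1 i2 total slab_zero[of t] by simp
        finally show ?thesis by (simp add: set_lebesgue_integral_def)
      qed
    qed
    then show "AE t in lebesgue. indicator {0<..<T} t *\<^sub>R fn F t \<bullet> v = 0" by simp
  qed
  then show ?thesis by eventually_elim auto
qed

lemma AE_interval_zero_imp_zero:
  fixes g :: "real \<Rightarrow> 'a::real_normed_vector"
  assumes cont: "continuous_on {0..T} g" and AE: "AE t in lebesgue. t \<in> {0<..<T} \<longrightarrow> g t = 0"
    and t: "t \<in> {0..T}" and T: "T > 0"
  shows "g t = 0"
proof (rule ccontr)
  assume "g t \<noteq> 0"
  then have "norm (g t) > 0" by simp
  then obtain d where d: "d > 0" "\<And>s. s \<in> {0..T} \<Longrightarrow> dist s t < d \<Longrightarrow> dist (g s) (g t) < norm (g t)"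
    using cont t unfolding continuous_on_iff by blast
  \<comment> \<open>Clipping the neighbourhood to the interval keeps positive length even when
    \<open>t\<close> is an end point.\<close>
  define lo hi where "lo = max 0 (t - d)" and "hi = min T (t + d)"
  have lh: "lo < hi" "0 \<le> lo" "hi \<le> T" using d(1) t T by (auto simp: lo_def hi_def)
  have nz: "g s \<noteq> 0" if "s \<in> {lo<..<hi}" for s
    using d(2)[of s] that by (auto simp: lo_def hi_def dist_real_def abs_less_iff)
  have "AE s in lebesgue. s \<notin> {lo<..<hi}"
    using AE by eventually_elim (use nz lh in auto)
  then have "{lo<..<hi} \<in> null_sets lebesgue"
    by (subst (asm) AE_iff_null_sets[symmetric]) auto
  then show False using lh by (simp add: null_sets_def emeasure_lborel_Ioo)
qed

lemma volt_inj:
  fixes F :: "'a::{real_inner,complete_space,second_countable_topology} L2"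
  assumes r: "time_order r" and T: "T > 0" and zero: "volt r T F = 0"
  shows "F = 0"
proof -
  have AE: "AE t in lebesgue. (if t \<in> {0<..<T} then prim r T F t else fn F t) = 0"
    using fn_volt[OF r, of T F] fn_zero[where 'a='a] unfolding zero by eventually_elim metis
  have inside: "prim r T F t = 0" if "t \<in> {0..T}" for t
    by (rule AE_interval_zero_imp_zero[OF continuous_prim[OF r] _ that T])
      (use AE in eventually_elim, auto)
  have "prim r T F t = 0" for t
  proof -
    \<comment> \<open>Beyond the interval the slab no longer changes, so \<open>t\<close> may be
      clamped.\<close>
    have "slab r T t = slab r T (min T (max 0 t))"
      using r by (cases rule: time_order_cases) (auto simp: slab_def)
    then show ?thesis using inside[of "min T (max 0 t)"] T by (simp add: prim_def)
  qed
  from prim_zero_imp[OF r T this] AE have "AE t in lebesgue. fn F t = 0"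
    by eventually_elim (auto split: if_splits)
  then show ?thesis unfolding L2_eq_iff using fn_zero by eventually_elim simp
qed

section \<open>Double integrals: adjointness and energy\<close>

lemma sq_int_measurable_on: "sq_int f \<Longrightarrow> f \<in> borel_measurable (lebesgue_on S)"
  by (intro measurable_restrict_space1 sq_int_measurable)

lemma sq_int_integrable_norm_on:
  assumes "sq_int f"
  shows "integrable (lebesgue_on {0<..<T}) (\<lambda>t. norm (f t))"
proof -
  have sq: "integrable (lebesgue_on {0<..<T}) (\<lambda>t. (norm (f t))\<^sup>2)"
    using integrable_restrict_space[of "{0<..<T}" lebesgue "\<lambda>t. (norm (f t))\<^sup>2"]
      integrable_mult_indicator[OF _ sq_int_integrable[OF assms], of "{0<..<T}"] by simp
  have "finite_measure (lebesgue_on {0<..<T})"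
    by (rule finite_measure_lebesgue_on) simp
  then have c: "integrable (lebesgue_on {0<..<T}) (\<lambda>_. 1 :: real)"
    by (rule finite_measure.integrable_const)
  show ?thesis
  proof (rule Bochner_Integration.integrable_bound[OF Bochner_Integration.integrable_add[OF c sq]])
    have "x \<le> 1 + x\<^sup>2" for x :: real
      using zero_le_power2[of "x - 1/2"] by (simp add: power2_eq_square algebra_simps)
    then show "AE t in lebesgue_on {0<..<T}. norm (norm (f t)) \<le> norm (1 + (norm (f t))\<^sup>2)"
      by simp
  qed (rule measurable_compose[OF sq_int_measurable_on[OF assms] borel_measurable_norm])
qed

lemma pair_sigma_finite_lebesgue_on: "pair_sigma_finite (lebesgue_on {0<..<T::real}) (lebesgue_on {0<..<T'::real})"
proof -
  have "finite_measure (lebesgue_on {0<..<T})" for T :: real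
    by (rule finite_measure_lebesgue_on) simp
  then show ?thesis
    by (intro pair_sigma_finite.intro finite_measure.axioms(1)) blast+
qed

text \<open>The hypothesis for each later use of Fubini, with \<open>Q\<close> built from indicators
  of time orderings. On a bounded interval square integrable functions are integrable, so the
  product of norms is an integrable majorant.\<close>

lemma integrable_product_kernel:
  fixes f g :: "real \<Rightarrow> 'a::{real_inner,second_countable_topology}"
  assumes f: "sq_int f" and g: "sq_int g"
    and Q: "Q \<in> borel_measurable (lebesgue_on {0<..<T} \<Otimes>\<^sub>M lebesgue_on {0<..<T})"
    and Q1: "\<And>p. \<bar>Q p\<bar> \<le> (1::real)"
  shows "integrable (lebesgue_on {0<..<T} \<Otimes>\<^sub>M lebesgue_on {0<..<T}) (\<lambda>(s, u). Q (s, u) * (f s \<bullet> g u))"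
proof -
  let ?M = "lebesgue_on {0<..<T}"
  interpret pair_sigma_finite ?M ?M by (rule pair_sigma_finite_lebesgue_on)
  note [measurable] = sq_int_measurable_on[OF f] sq_int_measurable_on[OF g] Q
  note nf = sq_int_integrable_norm_on[OF f, of T] and ng = sq_int_integrable_norm_on[OF g, of T]
  have bound: "integrable (?M \<Otimes>\<^sub>M ?M) (\<lambda>(s, u). norm (f s) * norm (g u))"
  proof (rule Fubini_integrable)
    show "(\<lambda>(s, u). norm (f s) * norm (g u)) \<in> borel_measurable (?M \<Otimes>\<^sub>M ?M)" by measurable
    show "integrable ?M (\<lambda>s. LINT u|?M. norm (case (s, u) of (s, u) \<Rightarrow> norm (f s) * norm (g u)))"
      using nf by (simp add: abs_mult)
    show "AE s in ?M. integrable ?M (\<lambda>u. case (s, u) of (s, u) \<Rightarrow> norm (f s) * norm (g u))"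
      using ng by simp
  qed
  show ?thesis
  proof (rule Bochner_Integration.integrable_bound[OF bound])
    have [measurable]: "(\<lambda>p. f (fst p)) \<in> borel_measurable (?M \<Otimes>\<^sub>M ?M)"
      "(\<lambda>p. g (snd p)) \<in> borel_measurable (?M \<Otimes>\<^sub>M ?M)" by measurable
    have "(\<lambda>p. Q p * (f (fst p) \<bullet> g (snd p))) \<in> borel_measurable (?M \<Otimes>\<^sub>M ?M)"
      by (intro borel_measurable_times borel_measurable_inner) measurable
    then show "(\<lambda>(s, u). Q (s, u) * (f s \<bullet> g u)) \<in> borel_measurable (?M \<Otimes>\<^sub>M ?M)"
      by (simp add: case_prod_unfold)
    have "\<bar>Q (s, u)\<bar> * \<bar>f s \<bullet> g u\<bar> \<le> 1 * (norm (f s) * norm (g u))" for s u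
      by (intro mult_mono Q1 Cauchy_Schwarz_ineq2) auto
    then show "AE p in ?M \<Otimes>\<^sub>M ?M. norm (case p of (s, u) \<Rightarrow> Q (s, u) * (f s \<bullet> g u))
        \<le> norm (case p of (s, u) \<Rightarrow> norm (f s) * norm (g u))"
      by (auto simp: abs_mult)
  qed
qed

lemma pred_time_order:
  assumes "time_order r" "f \<in> borel_measurable M" "g \<in> borel_measurable M"
  shows "Measurable.pred M (\<lambda>p. r (f p) (g p))"
  using assms by (cases rule: time_order_cases) (simp_all add: borel_measurable_pred_less)

lemma fst_snd_lebesgue_on:
  "fst \<in> borel_measurable (lebesgue_on A \<Otimes>\<^sub>M lebesgue_on B)"
  "snd \<in> borel_measurable (lebesgue_on A \<Otimes>\<^sub>M lebesgue_on B)"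
  by (rule measurable_compose[OF measurable_fst borel_measurable_ident_lebesgue_on]
      measurable_compose[OF measurable_snd borel_measurable_ident_lebesgue_on])+

lemma borel_measurable_of_bool:
  "Measurable.pred M P \<Longrightarrow> (\<lambda>x. of_bool (P x) :: real) \<in> borel_measurable M"
  by (simp add: of_bool_def)

lemma lebesgue_on_sets_Ioo: "{0<..<T::real} \<in> sets lebesgue"
  by simp

lemma inner_L2_split:
  "F \<bullet> G = (LINT t|lebesgue_on {0<..<T}. fn F t \<bullet> fn G t) +
           (LINT t|lebesgue_on (- {0<..<T}). fn F t \<bullet> fn G t)"
proof -
  have int: "integrable lebesgue (\<lambda>t. indicator A t *\<^sub>R (fn F t \<bullet> fn G t))" if "A \<in> sets lebesgue" for A
    by (rule integrable_mult_indicator[OF that integrable_inner_sq_int[OF sq_int_fn sq_int_fn]])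
  have "F \<bullet> G = (LINT t|lebesgue. indicator {0<..<T} t *\<^sub>R (fn F t \<bullet> fn G t)
      + indicator (- {0<..<T}) t *\<^sub>R (fn F t \<bullet> fn G t))"
    unfolding inner_L2_eq by (intro Bochner_Integration.integral_cong) (auto simp: indicator_def)
  also have "\<dots> = (LINT t|lebesgue. indicator {0<..<T} t *\<^sub>R (fn F t \<bullet> fn G t))
      + (LINT t|lebesgue. indicator (- {0<..<T}) t *\<^sub>R (fn F t \<bullet> fn G t))"
    by (intro Bochner_Integration.integral_add int) auto
  finally show ?thesis by (simp add: integral_restrict_space)
qed

lemma AE_lebesgue_onI: "AE t in lebesgue. P t \<Longrightarrow> S \<in> sets lebesgue \<Longrightarrow> AE t in lebesgue_on S. P t"
  by (subst AE_restrict_space_iff) auto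

lemma AE_lebesgue_on_iff:
  "S \<in> sets lebesgue \<Longrightarrow> (AE t in lebesgue_on S. P t) \<longleftrightarrow> (AE t in lebesgue. t \<in> S \<longrightarrow> P t)"
  by (subst AE_restrict_space_iff) auto

lemma borel_measurable_prim_on [measurable]:
  assumes r: "time_order r"
  shows "prim r T F \<in> borel_measurable (lebesgue_on S)"
  by (intro measurable_restrict_space1 measurable_completion)
    (use borel_measurable_continuous_onI[OF continuous_prim[OF r]] in simp)

lemma volt_inner_split:
  assumes r: "time_order r"
  shows "volt r T F \<bullet> G = (LINT t|lebesgue_on {0<..<T}. prim r T F t \<bullet> fn G t) +
           (LINT t|lebesgue_on (- {0<..<T}). fn F t \<bullet> fn G t)"
proof -
  have "(LINT t|lebesgue_on {0<..<T}. fn (volt r T F) t \<bullet> fn G t) =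
      (LINT t|lebesgue_on {0<..<T}. prim r T F t \<bullet> fn G t)"
  proof (rule integral_cong_AE)
    show "AE t in lebesgue_on {0<..<T}. fn (volt r T F) t \<bullet> fn G t = prim r T F t \<bullet> fn G t"
      unfolding AE_lebesgue_on_iff[OF lebesgue_on_sets_Ioo] using fn_volt[OF r, of T F]
      by eventually_elim simp
  qed (intro borel_measurable_inner sq_int_measurable_on sq_int_fn borel_measurable_prim_on r)+
  moreover have "(LINT t|lebesgue_on (- {0<..<T}). fn (volt r T F) t \<bullet> fn G t) =
      (LINT t|lebesgue_on (- {0<..<T}). fn F t \<bullet> fn G t)"
  proof (rule integral_cong_AE)
    have "- {0<..<T} \<in> sets lebesgue" by simp
    then show "AE t in lebesgue_on (- {0<..<T}). fn (volt r T F) t \<bullet> fn G t = fn F t \<bullet> fn G t"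
      by (rule AE_lebesgue_on_iff[THEN iffD2])
        (use fn_volt[OF r, of T F] in eventually_elim, simp)
  qed (intro borel_measurable_inner sq_int_measurable_on sq_int_fn)+
  ultimately show ?thesis by (simp add: inner_L2_split[of _ _ T])
qed

text \<open>Inside the interval both sides integrate \<open>fn F s \<bullet> fn G t\<close> over the
  triangle \<open>s < t\<close>, in different orders; outside both operators are the
  identity.\<close>

lemma volt_adjoint:
  "volt (<) T F \<bullet> G = F \<bullet> volt (>) T G"
proof -
  let ?M = "lebesgue_on {0<..<T}"
  interpret pair_sigma_finite ?M ?M by (rule pair_sigma_finite_lebesgue_on)
  note r = time_order_less and r' = time_order_greater
  have "integrable (?M \<Otimes>\<^sub>M ?M) (\<lambda>(s, t). of_bool (fst (s, t) < snd (s, t)) * (fn F s \<bullet> fn G t))"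
    by (rule integrable_product_kernel[OF sq_int_fn sq_int_fn])
      (intro borel_measurable_of_bool pred_time_order[OF r] fst_snd_lebesgue_on, simp)
  then have int: "integrable (?M \<Otimes>\<^sub>M ?M) (case_prod (\<lambda>s t. of_bool (s < t) * (fn F s \<bullet> fn G t)))"
    by simp
  have "(LINT t|?M. prim (<) T F t \<bullet> fn G t) =
      (LINT t|?M. LINT s|?M. of_bool (s < t) * (fn F s \<bullet> fn G t))"
    by (simp add: prim_inner[OF r])
  also have "\<dots> = (LINT s|?M. LINT t|?M. of_bool (s < t) * (fn F s \<bullet> fn G t))"
    by (rule Fubini_integral[OF int])
  also have "\<dots> = (LINT s|?M. prim (>) T G s \<bullet> fn F s)"
    unfolding prim_inner[OF r'] inner_commute[of "fn F _"] ..
  finally have "volt (<) T F \<bullet> G = volt (>) T G \<bullet> F"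
    unfolding volt_inner_split[OF r] volt_inner_split[OF r'] inner_commute[of "fn F _" "fn G _"]
    by (rule arg_cong)
  then show ?thesis by (simp only: inner_commute)
qed

text \<open>
  By symmetry of the integrand, the integral over the square \<open>{s, u before t}\<close> is twice
  the integral over the triangle \<open>u before s before t\<close>.
\<close>

lemma prim_energy:
  assumes r: "time_order r" and B: "bounded_linear B" and sym: "\<And>x y. B x \<bullet> y = x \<bullet> B y"
  shows "B (prim r T d t) \<bullet> prim r T d t =
    2 * (LINT s|lebesgue_on {0<..<T}. of_bool (r s t) * (B (fn d s) \<bullet> prim r T d s))"
proof -
  let ?M = "lebesgue_on {0<..<T}"
  interpret pair_sigma_finite ?M ?M by (rule pair_sigma_finite_lebesgue_on)
  define K where "K s u = B (fn d s) \<bullet> fn d u" for s u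
  have K_sym: "K s u = K u s" for s u
    unfolding K_def sym[of "fn d s"] by (rule inner_commute)
  define X where "X = (LINT s|?M. of_bool (r s t) * (B (fn d s) \<bullet> prim r T d s))"
  \<comment> \<open>Kernels of the two triangles, \<open>u\<close> before \<open>s\<close> and
    \<open>s\<close> before \<open>u\<close>. Together they cover the square up to its diagonal,
    which is negligible for each fixed \<open>s\<close>.\<close>
  define k1 k2 where "k1 s u = of_bool (r s t) * of_bool (r u s) * K s u"
    and "k2 s u = of_bool (r u t) * of_bool (r s u) * K s u" for s u
  note sq = sq_int_bounded_linear[OF B sq_int_fn[of d]] sq_int_fn[of d]
  have "integrable (?M \<Otimes>\<^sub>M ?M) (\<lambda>(s, u). (of_bool (r (fst (s, u)) t) * of_bool (r (snd (s, u)) (fst (s, u)))) * (B (fn d s) \<bullet> fn d u))"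
    by (rule integrable_product_kernel[OF sq])
      (intro borel_measurable_times borel_measurable_of_bool pred_time_order[OF r]
        fst_snd_lebesgue_on borel_measurable_const, simp)
  then have k1: "integrable (?M \<Otimes>\<^sub>M ?M) (case_prod k1)" by (simp add: k1_def[abs_def] K_def)
  have "integrable (?M \<Otimes>\<^sub>M ?M) (\<lambda>(s, u). (of_bool (r (snd (s, u)) t) * of_bool (r (fst (s, u)) (snd (s, u)))) * (B (fn d s) \<bullet> fn d u))"
    by (rule integrable_product_kernel[OF sq])
      (intro borel_measurable_times borel_measurable_of_bool pred_time_order[OF r]
        fst_snd_lebesgue_on borel_measurable_const, simp)
  then have k2: "integrable (?M \<Otimes>\<^sub>M ?M) (case_prod k2)" by (simp add: k2_def[abs_def] K_def)
  have inner: "(LINT u|?M. of_bool (r u s) * K s u) = B (fn d s) \<bullet> prim r T d s" for s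
    using prim_inner[OF r, of T d s "B (fn d s)"] by (simp add: K_def inner_commute)
  have inner': "(LINT u|?M. of_bool (r u t) * K s u) = prim r T d t \<bullet> B (fn d s)" for s
    unfolding prim_inner[OF r] K_def by (simp add: inner_commute)
  have X1: "(LINT s|?M. LINT u|?M. k1 s u) = X"
    by (simp add: k1_def X_def mult.assoc inner)
  have "(LINT s|?M. LINT u|?M. k2 s u) = (LINT u|?M. LINT s|?M. k2 s u)"
    by (rule Fubini_integral[OF k2, symmetric])
  also have "\<dots> = X"
    unfolding k2_def X_def inner[symmetric] by (subst K_sym) (simp add: mult.assoc)
  finally have X2: "(LINT s|?M. LINT u|?M. k2 s u) = X" .
  have split: "of_bool (r s t) * of_bool (r u t) * K s u = k1 s u + k2 s u" if "u \<noteq> s" for s u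
    using r that by (cases rule: time_order_cases) (auto simp: k1_def k2_def)
  have AE_neq: "AE u in ?M. u \<noteq> s" for s
    unfolding AE_lebesgue_on_iff[OF lebesgue_on_sets_Ioo]
    using AE_lborel_singleton[THEN AE_completion, of s] by eventually_elim simp
  have "B (prim r T d t) \<bullet> prim r T d t = prim r T d t \<bullet> B (prim r T d t)"
    by (rule sym)
  also have "\<dots> = (LINT s|?M. of_bool (r s t) * (prim r T d t \<bullet> B (fn d s)))"
    by (subst prim_inner[OF r]) (simp add: sym inner_commute)
  also have "\<dots> = (LINT s|?M. LINT u|?M. of_bool (r s t) * of_bool (r u t) * K s u)"
    by (simp add: mult.assoc inner')
  also have "\<dots> = (LINT s|?M. LINT u|?M. k1 s u + k2 s u)"
  proof (rule Bochner_Integration.integral_cong[OF refl], rule integral_cong_AE)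
    fix s
    have Km: "K s \<in> borel_measurable ?M"
      unfolding K_def by (intro borel_measurable_inner borel_measurable_const sq_int_measurable_on sq_int_fn)
    show "(\<lambda>u. of_bool (r s t) * of_bool (r u t) * K s u) \<in> borel_measurable ?M"
      "(\<lambda>u. k1 s u + k2 s u) \<in> borel_measurable ?M"
      unfolding k1_def k2_def
      by (intro borel_measurable_add borel_measurable_times borel_measurable_of_bool Km borel_measurable_const
          pred_time_order[OF r] borel_measurable_ident_lebesgue_on)+
    show "AE u in ?M. of_bool (r s t) * of_bool (r u t) * K s u = k1 s u + k2 s u"
      using AE_neq[of s] by eventually_elim (rule split)
  qed
  also have "\<dots> = integral\<^sup>L (?M \<Otimes>\<^sub>M ?M) (\<lambda>p. case_prod k1 p + case_prod k2 p)"
    using integral_fst'[OF Bochner_Integration.integrable_add[OF k1 k2]] by simp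
  also have "\<dots> = (LINT s|?M. LINT u|?M. k1 s u) + (LINT s|?M. LINT u|?M. k2 s u)"
    using integral_fst'[OF k1] integral_fst'[OF k2] k1 k2 by simp
  also have "\<dots> = 2 * X" by (simp add: X1 X2)
  finally show ?thesis by (simp add: X_def)
qed

text \<open>At the last instant \<open>prim_energy\<close> gives the integral over the whole
  interval as half of a value of the form of \<open>B\<close>. Outside the interval the integrand is
  itself such a value.\<close>

lemma lift_volt_nonneg:
  assumes r: "time_order r" and B: "bounded_linear B" and sym: "\<And>x y. B x \<bullet> y = x \<bullet> B y"
    and psd: "\<And>x. 0 \<le> B x \<bullet> x"
  shows "0 \<le> lift_L2 B F \<bullet> volt r T F"
proof -
  note meas = sq_int_measurable_on[OF sq_int_bounded_linear[OF B sq_int_fn]]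
    sq_int_measurable_on[OF sq_int_fn] borel_measurable_prim_on[OF r]
  have fn_B: "AE t in lebesgue. fn (lift_L2 B F) t = B (fn F t)" by (rule fn_lift_L2[OF B])
  have "(LINT s|lebesgue_on {0<..<T}. prim r T F s \<bullet> fn (lift_L2 B F) s) =
      (LINT s|lebesgue_on {0<..<T}. of_bool (r s (stop r T)) * (B (fn F s) \<bullet> prim r T F s))"
  proof (rule integral_cong_AE)
    show "AE s in lebesgue_on {0<..<T}. prim r T F s \<bullet> fn (lift_L2 B F) s =
        of_bool (r s (stop r T)) * (B (fn F s) \<bullet> prim r T F s)"
      unfolding AE_lebesgue_on_iff[OF lebesgue_on_sets_Ioo] using fn_B
    proof eventually_elim
      case (elim s)
      show ?case
      proof
        assume "s \<in> {0<..<T}"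
        then have "r s (stop r T)" using slab_stop[OF r, of T] unfolding slab_def by blast
        then show "prim r T F s \<bullet> fn (lift_L2 B F) s = of_bool (r s (stop r T)) * (B (fn F s) \<bullet> prim r T F s)"
          unfolding elim by (simp add: inner_commute[of "prim r T F s"])
      qed
    qed
    show "(\<lambda>s. of_bool (r s (stop r T)) * (B (fn F s) \<bullet> prim r T F s)) \<in> borel_measurable (lebesgue_on {0<..<T})"
      by (intro borel_measurable_times borel_measurable_of_bool borel_measurable_inner meas
          pred_time_order[OF r] borel_measurable_ident_lebesgue_on borel_measurable_const)
  qed (intro borel_measurable_inner meas)
  also have "\<dots> = B (prim r T F (stop r T)) \<bullet> prim r T F (stop r T) / 2"
    by (simp add: prim_energy[OF r B sym])
  finally have inside: "0 \<le> (LINT s|lebesgue_on {0<..<T}. prim r T F s \<bullet> fn (lift_L2 B F) s)"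
    using psd[of "prim r T F (stop r T)"] by linarith
  have "0 \<le> (LINT s|lebesgue_on (- {0<..<T}). fn F s \<bullet> fn (lift_L2 B F) s)"
  proof (rule integral_nonneg_AE)
    have "AE s in lebesgue. 0 \<le> fn F s \<bullet> fn (lift_L2 B F) s"
      using fn_B by eventually_elim (use psd in \<open>simp add: inner_commute[of "fn F _"]\<close>)
    then show "AE s in lebesgue_on (- {0<..<T}). 0 \<le> fn F s \<bullet> fn (lift_L2 B F) s"
      by (rule AE_lebesgue_onI) simp
  qed
  with inside show ?thesis
    using volt_inner_split[OF r, of T F "lift_L2 B F"] by (simp add: inner_commute)
qed

lemma lift_L2_id: "lift_L2 (\<lambda>x. x) F = F"
  by (simp add: lift_L2_def cls_fn)

lemma volterra_pair_volt:
  assumes T: "T > 0"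
  shows "volterra_pair (volt (<) T) (volt (>) T)"
proof (rule volterra_pair.intro)
  show "bounded_linear (volt (<) T)" "bounded_linear (volt (>) T)"
    using bounded_linear_volt[OF _ T] time_order_less time_order_greater by auto
  show "volt (<) T x = 0 \<Longrightarrow> x = 0" "volt (>) T x = 0 \<Longrightarrow> x = 0" for x
    using volt_inj[OF _ T] time_order_less time_order_greater by auto
  show "volt (<) T x \<bullet> y = x \<bullet> volt (>) T y" for x y
    by (rule volt_adjoint)
  show "0 \<le> volt (<) T x \<bullet> x" for x
    using lift_volt_nonneg[OF time_order_less bounded_linear_ident, of x T]
    by (simp add: lift_L2_id inner_commute)
qed

lemma Ioo_integral:
  fixes f :: "real \<Rightarrow> real"
  shows "(LINT s|lebesgue_on {0<..<T}. f s) = (LINT s|lebesgue. indicator {0<..<T} s *\<^sub>R f s)"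
  by (simp add: integral_restrict_space)

text \<open>The bound does not depend on \<open>t\<close>, which later upgrades L2 convergence to
  uniform convergence in time. The integral of \<open>prim_energy\<close> over the slab is a pairing
  with \<open>volt r T d\<close> cut off to the slab, and cutting off does not increase the
  norm.\<close>

lemma prim_energy_le:
  assumes r: "time_order r" and B: "bounded_linear B" and sym: "\<And>x y. B x \<bullet> y = x \<bullet> B y"
  shows "B (prim r T d t) \<bullet> prim r T d t \<le> 2 * (norm (lift_L2 B d) * norm (volt r T d))"
proof -
  define h where "h = (\<lambda>s. indicator (slab r T t) s *\<^sub>R fn (volt r T d) s)"
  have slab: "slab r T t \<in> sets lebesgue" using slab_lmeasurable[OF r] by auto
  have h: "sq_int h"
  proof (rule sq_intI_bounded)
    show "h \<in> borel_measurable lebesgue"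
      unfolding h_def using slab by (intro borel_measurable_scaleR borel_measurable_indicator) auto
    show "AE t in lebesgue. (norm (h t))\<^sup>2 \<le> (norm (fn (volt r T d) t))\<^sup>2"
      by (auto simp: h_def indicator_def)
  qed (rule sq_int_integrable[OF sq_int_fn])
  have norm_h: "norm (cls h) \<le> 1 * norm (volt r T d)"
  proof (rule norm_L2_le)
    show "AE s in lebesgue. norm (fn (cls h) s) \<le> 1 * norm (fn (volt r T d) s)"
      using fn_cls[OF h] by eventually_elim (auto simp: h_def indicator_def)
  qed simp
  have "(LINT s|lebesgue_on {0<..<T}. of_bool (r s t) * (B (fn d s) \<bullet> prim r T d s)) =
      lift_L2 B d \<bullet> cls h"
    unfolding lift_L2_inner[OF B] Ioo_integral
  proof (rule integral_cong_AE)
    show "AE s in lebesgue. indicator {0<..<T} s *\<^sub>R (of_bool (r s t) * (B (fn d s) \<bullet> prim r T d s)) =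
        B (fn d s) \<bullet> fn (cls h) s"
      using fn_cls[OF h] fn_volt[OF r, of T d]
      by eventually_elim (auto simp: h_def indicator_def slab_def)
    have id: "(\<lambda>x::real. x) \<in> borel_measurable lebesgue"
      using borel_measurable_ident_lebesgue_on[of UNIV] by (simp add: lebesgue_on_UNIV_eq)
    show "(\<lambda>s. indicator {0<..<T} s *\<^sub>R (of_bool (r s t) * (B (fn d s) \<bullet> prim r T d s))) \<in> borel_measurable lebesgue"
      using borel_measurable_prim_on[OF r, of T d UNIV]
      by (intro borel_measurable_scaleR borel_measurable_times borel_measurable_of_bool borel_measurable_inner
        borel_measurable_indicator lebesgue_on_sets_Ioo
        pred_time_order[OF r] id sq_int_measurable[OF sq_int_bounded_linear[OF B sq_int_fn]]) auto
  qed (intro borel_measurable_inner sq_int_measurable[OF sq_int_bounded_linear[OF B sq_int_fn]] fn_measurable)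
  also have "\<dots> \<le> norm (lift_L2 B d) * norm (cls h)" by (rule norm_cauchy_schwarz)
  also have "\<dots> \<le> norm (lift_L2 B d) * norm (volt r T d)"
    using norm_h by (intro mult_left_mono) auto
  finally show ?thesis by (simp add: prim_energy[OF r B sym])
qed

section \<open>Test functions\<close>

text \<open>The classical \<open>exp (- (1 / x))\<close> with a polynomial factor in
  \<open>1 / x\<close>, which closes the family under differentiation and so yields smoothness by
  iteration.\<close>

definition bump :: "real poly \<Rightarrow> real \<Rightarrow> real" where
  "bump p x = (if x > 0 then poly p (1 / x) * exp (- (1 / x)) else 0)"

lemma tendsto_poly_div_exp: "((\<lambda>x. poly p x / exp x) \<longlongrightarrow> (0::real)) at_top"
proof -
  have "((\<lambda>x. \<Sum>i\<le>degree p. coeff p i * (x ^ i / exp x)) \<longlongrightarrow> (0::real)) at_top"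
    by (intro tendsto_null_sum tendsto_mult_right_zero tendsto_power_div_exp_0)
  then show ?thesis by (simp add: poly_altdef sum_divide_distrib)
qed

lemma bump_has_derivative:
  "(bump p has_real_derivative bump ([:0, 0, 1:] * (p - pderiv p)) x) (at x)"
proof -
  consider "x > 0" | "x < 0" | "x = 0" by linarith
  then show ?thesis
  proof cases
    case 1
    have "((\<lambda>x. poly p (1 / x) * exp (- (1 / x))) has_real_derivative
        bump ([:0, 0, 1:] * (p - pderiv p)) x) (at x)"
      using 1 by (auto intro!: derivative_eq_intros DERIV_chain2[OF poly_DERIV]
          simp: bump_def field_simps power2_eq_square)
    then show ?thesis
      by (rule has_field_derivative_transform_within_open[where S = "{0<..}"]) (use 1 in \<open>auto simp: bump_def\<close>)
  next
    case 2
    have "((\<lambda>_. 0) has_real_derivative 0) (at x)" by simp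
    then have "(bump p has_real_derivative 0) (at x)"
      by (rule has_field_derivative_transform_within_open[where S = "{..<0}"]) (use 2 in \<open>auto simp: bump_def\<close>)
    then show ?thesis using 2 by (simp add: bump_def)
  next
    case 3
    have "((\<lambda>h. bump p h / h) \<longlongrightarrow> 0) (at 0)"
    proof (rule filterlim_split_at)
      have "((\<lambda>_. 0) \<longlongrightarrow> (0::real)) (at_left 0)" by simp
      then show "((\<lambda>h. bump p h / h) \<longlongrightarrow> 0) (at_left 0)"
        by (rule Lim_transform_eventually) (auto simp: eventually_at_filter bump_def)
      \<comment> \<open>In the variable \<open>y = inverse h\<close> the quotient is
        \<open>y * poly p y / exp y\<close>; division by \<open>h\<close> contributes the
        \<open>pCons 0\<close>.\<close>
      have "((\<lambda>h. poly (pCons 0 p) (inverse h) / exp (inverse h)) \<longlongrightarrow> 0) (at_right (0::real))"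
        by (rule filterlim_compose[OF tendsto_poly_div_exp filterlim_inverse_at_top_right])
      then show "((\<lambda>h. bump p h / h) \<longlongrightarrow> 0) (at_right 0)"
        by (rule Lim_transform_eventually)
          (auto simp: eventually_at_filter bump_def exp_minus field_simps)
    qed
    then show ?thesis
      by (simp add: 3 DERIV_def bump_def)
  qed
qed

inductive bumps :: "(real \<Rightarrow> real) \<Rightarrow> bool" where
  base: "bumps (\<lambda>x. bump p (x - a) * bump q (b - x))"
| add: "bumps f \<Longrightarrow> bumps g \<Longrightarrow> bumps (\<lambda>x. f x + g x)"

lemma bump_smult: "bump (smult c p) x = c * bump p x"
  by (simp add: bump_def)

lemma bump_minus: "bump (- p) x = - bump p x"
  by (simp add: bump_def)

lemma bumps_scale: "bumps f \<Longrightarrow> bumps (\<lambda>x. c * f x)"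
proof (induction rule: bumps.induct)
  case (base p a q b)
  have "bumps (\<lambda>x. bump (smult c p) (x - a) * bump q (b - x))" by (rule bumps.base)
  then show ?case by (simp add: bump_smult mult.assoc)
next
  case (add f g)
  from bumps.add[OF add.IH] show ?case by (simp add: distrib_left)
qed

lemma bumps_has_derivative:
  "bumps f \<Longrightarrow> \<exists>g. bumps g \<and> (\<forall>x. (f has_real_derivative g x) (at x))"
proof (induction rule: bumps.induct)
  case (base p a q b)
  define p' q' where "p' = [:0, 0, 1:] * (p - pderiv p)" and "q' = [:0, 0, 1:] * (q - pderiv q)"
  let ?g = "\<lambda>x. bump p' (x - a) * bump q (b - x) + bump p (x - a) * bump (- q') (b - x)"
  have "bumps ?g" by (intro bumps.intros)
  moreover have "((\<lambda>x. bump p (x - a) * bump q (b - x)) has_real_derivative ?g x) (at x)" for x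
  proof -
    have "((\<lambda>x. bump p (x - a)) has_real_derivative bump p' (x - a) * 1) (at x)"
      unfolding p'_def by (rule DERIV_chain2[OF bump_has_derivative]) (auto intro!: derivative_eq_intros)
    moreover have "((\<lambda>x. bump q (b - x)) has_real_derivative bump q' (b - x) * (- 1)) (at x)"
      unfolding q'_def by (rule DERIV_chain2[OF bump_has_derivative]) (auto intro!: derivative_eq_intros)
    ultimately show ?thesis
      by (auto intro!: derivative_eq_intros simp: bump_minus)
  qed
  ultimately show ?case by blast
next
  case (add f g)
  then obtain f' g' where "bumps f'" "bumps g'" "\<And>x. (f has_real_derivative f' x) (at x)"
    "\<And>x. (g has_real_derivative g' x) (at x)" by blast
  then show ?case
    by (intro exI[of _ "\<lambda>x. f' x + g' x"]) (auto intro: bumps.add DERIV_add)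
qed

lemma bumps_continuous: "bumps f \<Longrightarrow> continuous_on S f"
  using bumps_has_derivative[of f] by (meson DERIV_isCont continuous_at_imp_continuous_on)

text \<open>Only the derivative is assumed to be in the class, since \<open>f\<close> will be an
  integral of a bump function, for which no formula of that class is at hand.\<close>

lemma smooth_if_derivative_bumps:
  assumes g: "bumps g" and f: "\<And>x. (f has_real_derivative g x) (at x)"
  shows "((deriv ^^ k) f) differentiable (at x)"
proof -
  have "\<exists>h. bumps h \<and> (\<forall>x. ((deriv ^^ k) f has_real_derivative h x) (at x))"
  proof (induction k)
    case 0
    then show ?case using assms by auto
  next
    case (Suc k)
    then obtain h where h: "bumps h" "\<And>x. ((deriv ^^ k) f has_real_derivative h x) (at x)" by blast
    have "(deriv ^^ Suc k) f = h" using h(2) by (auto intro!: ext DERIV_imp_deriv)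
    then show ?case using bumps_has_derivative[OF h(1)] by simp
  qed
  then show ?thesis by (meson real_differentiable_def)
qed

section \<open>Test functions as antiderivatives, and weak constancy\<close>

lemma LINT_Ioo_eq_integral:
  fixes f :: "real \<Rightarrow> real"
  assumes f: "continuous_on {a..b} f"
  shows "integrable (lebesgue_on {a<..<b}) f" and "(LINT t|lebesgue_on {a<..<b}. f t) = integral {a..b} f"
proof -
  have "integrable lebesgue (\<lambda>t. indicator {a..b} t *\<^sub>R f t)"
    using continuous_imp_integrable_real[OF f] by (simp add: integrable_restrict_space)
  then have "integrable lebesgue (\<lambda>t. indicator {a<..<b} t *\<^sub>R (indicator {a..b} t *\<^sub>R f t))"
    by (rule integrable_mult_indicator[rotated]) simp
  also have "(\<lambda>t. indicator {a<..<b} t *\<^sub>R (indicator {a..b} t *\<^sub>R f t)) = (\<lambda>t. indicator {a<..<b} t *\<^sub>R f t)"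
    by (auto simp: indicator_def)
  finally show int: "integrable (lebesgue_on {a<..<b}) f" by (simp add: integrable_restrict_space)
  show "(LINT t|lebesgue_on {a<..<b}. f t) = integral {a..b} f"
    by (simp add: lebesgue_integral_eq_integral[OF int] integral_open_interval_real)
qed

lemma test_functionD:
  assumes "test_function T \<phi>"
  shows "(\<phi> has_real_derivative deriv \<phi> x) (at x)" and "continuous_on S (deriv \<phi>)"
    and "\<phi> 0 = 0" and "\<phi> T = 0"
proof -
  have "\<phi> differentiable (at x)" for x using assms[unfolded test_function_def, THEN conjunct1, rule_format, of 0 x] by simp
  then show "(\<phi> has_real_derivative deriv \<phi> x) (at x)"
    by (simp add: DERIV_deriv_iff_real_differentiable)
  have "deriv \<phi> differentiable (at x)" for x using assms[unfolded test_function_def, THEN conjunct1, rule_format, of 1 x] by simp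
  then show "continuous_on S (deriv \<phi>)"
    by (intro continuous_at_imp_continuous_on ballI) (auto intro: differentiable_imp_continuous_within)
  obtain a b where "0 < a" "b < T" "\<And>x. x \<notin> {a..b} \<Longrightarrow> \<phi> x = 0"
    using assms unfolding test_function_def by auto
  then show "\<phi> 0 = 0" "\<phi> T = 0" by auto
qed

text \<open>The integral from 0 vanishes left of the support of \<open>h\<close>, and zero mean
  makes it vanish again to the right, which is the compact support required of a test
  function.\<close>

lemma test_function_antiderivative:
  assumes h: "bumps h" and ab: "0 < a" "a \<le> b" "b < T" and supp: "\<And>x. x \<notin> {a..b} \<Longrightarrow> h x = 0"
    and zero: "integral {0..T} h = 0"
  obtains \<phi> where "test_function T \<phi>" "deriv \<phi> = h"
proof -
  define \<phi> where "\<phi> x = integral {0..x} h" for x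
  have cont: "continuous_on S h" for S by (rule bumps_continuous[OF h])
  have left: "\<phi> x = 0" if "x < a" for x
  proof -
    have "integral {0..x} h = integral {0..x} (\<lambda>_. 0)"
      by (rule Henstock_Kurzweil_Integration.integral_cong) (use that supp in auto)
    then show ?thesis by (simp add: \<phi>_def)
  qed
  have right: "\<phi> x = 0" if "x > b" for x
  proof -
    \<comment> \<open>\<open>min x T\<close> and \<open>max x T\<close> treat points before and
      after the final time alike.\<close>
    have "integral {b..max x T} h = 0" "integral {min x T..max x T} h = 0"
    proof -
      have "integral {y..z} h = 0" if "b \<le> y" for y z
      proof -
        have "integral {y<..<z} h = integral {y<..<z} (\<lambda>_. 0)"
          by (rule Henstock_Kurzweil_Integration.integral_cong) (use that supp in auto)
        then show ?thesis by (simp add: integral_open_interval_real)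
      qed
      then show "integral {b..max x T} h = 0" "integral {min x T..max x T} h = 0" using that ab by auto
    qed
    moreover have "integral {0..min x T} h + integral {min x T..max x T} h = integral {0..max x T} h"
      using that ab by (intro Henstock_Kurzweil_Integration.integral_combine integrable_continuous_real cont) auto
    ultimately have "integral {0..min x T} h = integral {0..max x T} h" by simp
    then have "integral {0..x} h = integral {0..T} h" by (cases "x \<le> T") (auto simp: min_def max_def)
    then show ?thesis by (simp add: \<phi>_def zero)
  qed
  have deriv: "(\<phi> has_real_derivative h x) (at x)" for x
  proof (cases "x > 0")
    case True
    have "(\<phi> has_real_derivative h x) (at x within {0..x + 1})"
      unfolding \<phi>_def by (rule integral_has_real_derivative[OF cont]) (use True in auto)
    moreover have "at x within {0..x + 1} = at x"
      using True by (intro at_within_interior) auto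
    ultimately show ?thesis by simp
  next
    case False
    have "((\<lambda>_. 0) has_real_derivative 0) (at x)" by simp
    then have "(\<phi> has_real_derivative 0) (at x)"
      by (rule has_field_derivative_transform_within_open[where S = "{..<a}"]) (use False ab left in auto)
    moreover have "h x = 0" using False ab supp[of x] by auto
    ultimately show ?thesis by simp
  qed
  have "test_function T \<phi>"
    unfolding test_function_def
  proof (intro conjI allI exI)
    show "((deriv ^^ k) \<phi>) differentiable (at x)" for k x
      by (rule smooth_if_derivative_bumps[OF h deriv])
    show "x \<notin> {a..b} \<longrightarrow> \<phi> x = 0" for x using left[of x] right[of x] by auto
  qed (use ab in auto)
  moreover have "deriv \<phi> = h" using deriv by (auto intro!: ext DERIV_imp_deriv)
  ultimately show ?thesis by (rule that)
qed

lemma bump_pos_iff: "bump 1 x > 0 \<longleftrightarrow> x > 0" and bump_nonneg: "bump 1 x \<ge> 0"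
  by (auto simp: bump_def)

text \<open>
  With a fixed bump \<open>\<theta>\<close>, every bump \<open>\<psi>\<close> minus a multiple of \<open>\<theta>\<close> is the derivative of a test
  function; hence \<open>\<rho>\<close> minus its \<open>\<theta>\<close>-mean is orthogonal to all bumps.
\<close>

lemma du_Bois_Reymond:
  fixes \<rho> :: "real \<Rightarrow> real"
  assumes T: "T > 0" and \<rho>: "continuous_on {0..T} \<rho>"
    and orth: "\<And>\<phi>. test_function T \<phi> \<Longrightarrow> (LINT t|lebesgue_on {0<..<T}. deriv \<phi> t * \<rho> t) = 0"
  obtains m where "\<And>t. t \<in> {0..T} \<Longrightarrow> \<rho> t = m"
proof -
  define \<psi> where "\<psi> a b x = bump 1 (x - a) * bump 1 (b - x)" for a b x
  have \<psi>: "bumps (\<psi> a b)" for a b unfolding \<psi>_def by (rule bumps.base)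
  have \<psi>_supp: "x \<notin> {a<..<b} \<Longrightarrow> \<psi> a b x = 0" for a b x
    by (auto simp: \<psi>_def bump_def)
  have \<psi>_pos: "x \<in> {a<..<b} \<Longrightarrow> \<psi> a b x > 0" and \<psi>_nonneg: "\<psi> a b x \<ge> 0" for a b x
    by (auto simp: \<psi>_def bump_pos_iff bump_nonneg)
  have zero: "g t = 0" if g: "continuous_on {0..T} g" "\<And>x. x \<in> {0..T} \<Longrightarrow> 0 \<le> g x"
    "integral {0..T} g = 0" and t: "t \<in> {0..T}" for g :: "real \<Rightarrow> real" and t
  proof (rule AE_interval_zero_imp_zero[OF g(1) _ t T])
    have "AE t in lebesgue_on {0<..<T}. g t = 0"
    proof (subst integral_nonneg_eq_0_iff_AE[symmetric])
      show "integrable (lebesgue_on {0<..<T}) g" by (rule LINT_Ioo_eq_integral[OF g(1)])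
      show "AE x in lebesgue_on {0<..<T}. 0 \<le> g x"
        using g(2) by (subst AE_lebesgue_on_iff) auto
      show "(LINT t|lebesgue_on {0<..<T}. g t) = 0" using g(3) by (simp add: LINT_Ioo_eq_integral[OF g(1)])
    qed
    then show "AE t in lebesgue. t \<in> {0<..<T} \<longrightarrow> g t = 0" by (subst (asm) AE_lebesgue_on_iff) auto
  qed
  \<comment> \<open>The reference bump only needs nonzero mass and support away from both ends; the
    middle third provides this.\<close>
  define \<theta> where "\<theta> = \<psi> (T/3) (2*T/3)"
  have c: "continuous_on {0..T} (\<psi> a b)" for a b by (rule bumps_continuous[OF \<psi>])
  have \<theta>_pos: "integral {0..T} \<theta> \<noteq> 0"
    using zero[OF c[of "T/3" "2*T/3"], of "T/2"] \<psi>_nonneg \<psi>_pos[of "T/2" "T/3" "2*T/3"] T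
    by (auto simp: \<theta>_def)
  define m where "m = integral {0..T} (\<lambda>t. \<theta> t * \<rho> t) / integral {0..T} \<theta>"
  have mean: "integral {0..T} (\<lambda>t. \<psi> a b t * (\<rho> t - m)) = 0" if ab: "0 < a" "a \<le> b" "b < T" for a b
  proof -
    define k where "k = integral {0..T} (\<psi> a b) / integral {0..T} \<theta>"
    define h where "h x = \<psi> a b x + (- k) * \<theta> x" for x
    have c\<theta>: "continuous_on {0..T} \<theta>" by (simp add: \<theta>_def c)
    have h: "bumps h" unfolding h_def \<theta>_def by (intro bumps.add bumps_scale \<psi>)
    have "integral {0..T} h = integral {0..T} (\<psi> a b) + (- k) * integral {0..T} \<theta>"
      unfolding h_def
      by (subst Henstock_Kurzweil_Integration.integral_add)
        (auto intro!: integrable_continuous_real continuous_intros c c\<theta>)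
    also have "\<dots> = 0" using \<theta>_pos by (simp add: k_def)
    finally have z: "integral {0..T} h = 0" .
    have supp: "h x = 0" if "x \<notin> {min a (T/3)..max b (2*T/3)}" for x
    proof -
      have "x \<notin> {a<..<b}" "x \<notin> {T/3<..<2*T/3}" using that by auto
      then show ?thesis unfolding h_def \<theta>_def by (metis \<psi>_supp add_0 mult_zero_right)
    qed
    have "0 < min a (T/3)" "min a (T/3) \<le> max b (2*T/3)" "max b (2*T/3) < T" using ab T by auto
    from test_function_antiderivative[OF h this supp z]
    obtain \<phi> where \<phi>: "test_function T \<phi>" "deriv \<phi> = h" by blast
    have "continuous_on {0..T} (\<lambda>t. h t * \<rho> t)"
      unfolding h_def by (intro continuous_intros c c\<theta> \<rho>)
    then have "0 = integral {0..T} (\<lambda>t. h t * \<rho> t)"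
      using orth[OF \<phi>(1)] by (simp add: \<phi>(2) LINT_Ioo_eq_integral)
    also have "\<dots> = integral {0..T} (\<lambda>t. \<psi> a b t * \<rho> t + (- k) * (\<theta> t * \<rho> t))"
      by (simp add: h_def algebra_simps)
    also have "\<dots> = integral {0..T} (\<lambda>t. \<psi> a b t * \<rho> t) + (- k) * integral {0..T} (\<lambda>t. \<theta> t * \<rho> t)"
      by (subst Henstock_Kurzweil_Integration.integral_add)
        (auto intro!: integrable_continuous_real continuous_intros c c\<theta> \<rho>)
    also have "\<dots> = integral {0..T} (\<lambda>t. \<psi> a b t * \<rho> t) - m * integral {0..T} (\<psi> a b)"
      by (simp add: k_def m_def)
    also have "\<dots> = integral {0..T} (\<lambda>t. \<psi> a b t * \<rho> t + (- m) * \<psi> a b t)"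
      by (subst Henstock_Kurzweil_Integration.integral_add)
        (auto intro!: integrable_continuous_real continuous_intros c \<rho>)
    finally show ?thesis by (simp add: algebra_simps)
  qed
  \<comment> \<open>Applied with \<open>\<sigma> = 1\<close> and \<open>\<sigma> = -1\<close>, this
    excludes both signs of \<open>\<rho> t - m\<close>. The bump is placed where the sign stays
    constant.\<close>
  have nonpos: "\<not> \<sigma> * (\<rho> t - m) > 0" if t: "t \<in> {0<..<T}" for t \<sigma>
  proof
    assume pos: "\<sigma> * (\<rho> t - m) > 0"
    have cont: "continuous_on {0<..<T} (\<lambda>t. \<sigma> * (\<rho> t - m))"
      by (intro continuous_intros continuous_on_subset[OF \<rho>]) auto
    have "open ({s \<in> {0<..<T}. \<sigma> * (\<rho> s - m) \<in> {0<..}})"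
      using continuous_open_preimage[OF cont, of "{0<..}"] by (simp add: vimage_def Int_def)
    then obtain e where e: "e > 0" "cball t e \<subseteq> {s \<in> {0<..<T}. \<sigma> * (\<rho> s - m) \<in> {0<..}}"
      using pos t by (auto simp: open_contains_cball)
    have in_e: "s \<in> {0<..<T}" "\<sigma> * (\<rho> s - m) > 0" if "s \<in> {t - e..t + e}" for s
      using e(2) that by (auto simp: cball_def dist_real_def subset_iff abs_le_iff)
    have "\<psi> (t - e) (t + e) t * (\<sigma> * (\<rho> t - m)) = 0"
    proof (rule zero[of "\<lambda>t'. \<psi> (t - e) (t + e) t' * (\<sigma> * (\<rho> t' - m))"])
      show "continuous_on {0..T} (\<lambda>t'. \<psi> (t - e) (t + e) t' * (\<sigma> * (\<rho> t' - m)))"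
        by (intro continuous_intros c \<rho>)
      show "0 \<le> \<psi> (t - e) (t + e) x * (\<sigma> * (\<rho> x - m))" if "x \<in> {0..T}" for x
      proof (cases "x \<in> {t - e<..<t + e}")
        case True
        then have "0 \<le> \<sigma> * (\<rho> x - m)" using in_e(2)[of x] by simp
        then show ?thesis by (rule mult_nonneg_nonneg[OF \<psi>_nonneg])
      qed (simp add: \<psi>_supp)
      have "integral {0..T} (\<lambda>t'. \<sigma> * (\<psi> (t - e) (t + e) t' * (\<rho> t' - m))) = 0"
        using mean[of "t - e" "t + e"] in_e(1)[of "t - e"] in_e(1)[of "t + e"] e(1) by simp
      then show "integral {0..T} (\<lambda>t'. \<psi> (t - e) (t + e) t' * (\<sigma> * (\<rho> t' - m))) = 0"
        by (simp add: ac_simps)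
    qed (use t in auto)
    moreover have "\<psi> (t - e) (t + e) t > 0" using e(1) by (intro \<psi>_pos) auto
    ultimately show False using pos by auto
  qed
  have "\<rho> t - m = 0" if "t \<in> {0..T}" for t
  proof (rule AE_interval_zero_imp_zero[OF _ _ that T])
    show "continuous_on {0..T} (\<lambda>t. \<rho> t - m)" by (intro continuous_intros \<rho>)
    show "AE t in lebesgue. t \<in> {0<..<T} \<longrightarrow> \<rho> t - m = 0"
      using nonpos[of _ 1] nonpos[of _ "-1"] by (intro AE_I2) force
  qed
  then show ?thesis using that[of m] by simp
qed

text \<open>The weak derivative of \<open>prim r T F\<close> is \<open>sg r\<close> times
  \<open>F\<close>: integrating up to the final time reverses the sign.\<close>

definition sg :: "(real \<Rightarrow> real \<Rightarrow> bool) \<Rightarrow> real" where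
  "sg r = (if r 0 1 then 1 else - 1)"

text \<open>After exchanging the integrals, \<open>deriv \<phi>\<close> is integrated over the times
  after \<open>s\<close> with respect to \<open>r\<close>. As \<open>\<phi>\<close> vanishes at both
  ends, this gives \<open>- sg r * \<phi> s\<close> in either direction.\<close>

lemma prim_integration_by_parts:
  assumes r: "time_order r" and T: "T > 0" and \<phi>: "test_function T \<phi>"
  shows "(LINT t|lebesgue_on {0<..<T}. deriv \<phi> t * (prim r T G t \<bullet> v)) =
    - sg r * (LINT t|lebesgue_on {0<..<T}. \<phi> t * (fn G t \<bullet> v))"
proof -
  let ?M = "lebesgue_on {0<..<T}"
  interpret pair_sigma_finite ?M ?M by (rule pair_sigma_finite_lebesgue_on)
  note d\<phi> = test_functionD[OF \<phi>]
  \<comment> \<open>The cut-off makes \<open>g\<close> square integrable on the line, as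
    \<open>integrable_product_kernel\<close> requires.\<close>
  define g where "g u = indicator {0<..<T} u *\<^sub>R (deriv \<phi> u *\<^sub>R v)" for u
  have g: "sq_int g"
  proof -
    have "bounded (deriv \<phi> ` {0..T})"
      by (intro compact_imp_bounded compact_continuous_image d\<phi>) simp
    then obtain C where C: "\<And>u. u \<in> {0..T} \<Longrightarrow> \<bar>deriv \<phi> u\<bar> \<le> C" by (force simp: bounded_iff)
    show ?thesis
    proof (rule sq_intI_bounded)
      have "deriv \<phi> \<in> borel_measurable lebesgue"
        by (intro measurable_completion) (use borel_measurable_continuous_onI[OF d\<phi>(2)] in simp)
      then show "g \<in> borel_measurable lebesgue"
        unfolding g_def by (intro borel_measurable_scaleR borel_measurable_indicator) auto
      show "integrable lebesgue (\<lambda>u. indicator {0<..<T} u * (C * norm v)\<^sup>2)"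
        by (intro integrable_mult_left integrable_indicator_lmeasurable) simp
      show "AE u in lebesgue. (norm (g u))\<^sup>2 \<le> indicator {0<..<T} u * (C * norm v)\<^sup>2"
        by (intro AE_I2) (auto simp: g_def indicator_def intro!: power_mono mult_right_mono C)
    qed
  qed
  have g_eq: "x \<bullet> g u = deriv \<phi> u * (x \<bullet> v)" if "u \<in> {0<..<T}" for u x
    using that by (simp add: g_def)
  have "integrable (?M \<Otimes>\<^sub>M ?M) (\<lambda>(s, u). of_bool (r (fst (s, u)) (snd (s, u))) * (fn G s \<bullet> g u))"
    by (rule integrable_product_kernel[OF sq_int_fn g])
      (intro borel_measurable_of_bool pred_time_order[OF r] fst_snd_lebesgue_on, simp)
  then have int: "integrable (?M \<Otimes>\<^sub>M ?M) (case_prod (\<lambda>s u. of_bool (r s u) * (fn G s \<bullet> g u)))" by simp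
  have inner: "(LINT u|?M. of_bool (r s u) * deriv \<phi> u) = - sg r * \<phi> s" if s: "s \<in> {0<..<T}" for s
  proof -
    have FTC: "integral {a..b} (deriv \<phi>) = \<phi> b - \<phi> a" if "a \<le> b" for a b
      using that d\<phi>(1) by (intro integral_unique fundamental_theorem_of_calculus)
        (auto simp: has_real_derivative_iff_has_vector_derivative[symmetric] intro: has_field_derivative_at_within)
    have ab: "(LINT u|?M. of_bool (a < u \<and> u < b) * deriv \<phi> u) = \<phi> b - \<phi> a" if "0 \<le> a" "a \<le> b" "b \<le> T" for a b
    proof -
      have "(LINT u|?M. of_bool (a < u \<and> u < b) * deriv \<phi> u) = (LINT u|lebesgue_on {a<..<b}. deriv \<phi> u)"
        using that by (simp add: integral_restrict_space)
          (auto intro!: Bochner_Integration.integral_cong simp: indicator_def)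
      also have "\<dots> = \<phi> b - \<phi> a" using that by (simp add: LINT_Ioo_eq_integral[OF d\<phi>(2)] FTC)
      finally show ?thesis .
    qed
    show ?thesis using r
    proof (cases rule: time_order_cases)
      case 1
      have "(LINT u|?M. of_bool (r s u) * deriv \<phi> u) = (LINT u|?M. of_bool (s < u \<and> u < T) * deriv \<phi> u)"
        by (rule Bochner_Integration.integral_cong) (auto simp: 1)
      then show ?thesis using ab[of s T] s d\<phi>(4) by (simp add: 1 sg_def)
    next
      case 2
      have "(LINT u|?M. of_bool (r s u) * deriv \<phi> u) = (LINT u|?M. of_bool (0 < u \<and> u < s) * deriv \<phi> u)"
        by (rule Bochner_Integration.integral_cong) (auto simp: 2)
      then show ?thesis using ab[of 0 s] s d\<phi>(3) by (simp add: 2 sg_def)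
    qed
  qed
  have "(LINT t|?M. deriv \<phi> t * (prim r T G t \<bullet> v)) = (LINT t|?M. prim r T G t \<bullet> g t)"
    by (rule Bochner_Integration.integral_cong) (auto simp: g_eq)
  also have "\<dots> = (LINT t|?M. LINT s|?M. of_bool (r s t) * (fn G s \<bullet> g t))"
    by (simp only: prim_inner[OF r])
  also have "\<dots> = (LINT s|?M. LINT t|?M. of_bool (r s t) * (fn G s \<bullet> g t))"
    by (rule Fubini_integral[OF int])
  also have "\<dots> = (LINT s|?M. - sg r * (\<phi> s * (fn G s \<bullet> v)))"
  proof (rule Bochner_Integration.integral_cong[OF refl])
    fix s assume "s \<in> space ?M"
    then have s: "s \<in> {0<..<T}" by simp
    have "(LINT t|?M. of_bool (r s t) * (fn G s \<bullet> g t)) = (LINT t|?M. (of_bool (r s t) * deriv \<phi> t) * (fn G s \<bullet> v))"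
      by (rule Bochner_Integration.integral_cong) (auto simp: g_eq)
    also have "\<dots> = (LINT t|?M. of_bool (r s t) * deriv \<phi> t) * (fn G s \<bullet> v)"
      by (rule integral_mult_left_zero)
    finally show "(LINT t|?M. of_bool (r s t) * (fn G s \<bullet> g t)) = - sg r * (\<phi> s * (fn G s \<bullet> v))"
      by (simp add: inner[OF s])
  qed
  also have "\<dots> = - sg r * (LINT s|?M. \<phi> s * (fn G s \<bullet> v))" by (rule integral_mult_right_zero)
  finally show ?thesis .
qed

section \<open>Bochner spaces and classes of functions\<close>

lemma null_subset_sets_lebesgue_on:
  assumes "N \<in> null_sets (lebesgue_on S)" "S \<in> sets lebesgue" "A \<subseteq> N"
  shows "A \<in> sets (lebesgue_on S)"
proof -
  have "N \<subseteq> S" "N \<in> null_sets lebesgue" using assms by (auto simp: null_sets_restrict_space)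
  then have "A \<in> null_sets lebesgue" using assms(3) null_sets_completion_subset by blast
  with \<open>N \<subseteq> S\<close> assms show ?thesis by (subst sets_restrict_space_iff) auto
qed

text \<open>Lebesgue measure is complete, so the values of \<open>f\<close> on the exceptional null
  set do not affect measurability; there the approximants are replaced by a constant.\<close>

lemma strongly_measurable_iff:
  fixes f :: "real \<Rightarrow> 'a::{metric_space,second_countable_topology}"
  assumes S: "S \<in> sets lebesgue"
  shows "strongly_measurable (lebesgue_on S) f \<longleftrightarrow> f \<in> borel_measurable (lebesgue_on S)"
proof
  assume "f \<in> borel_measurable (lebesgue_on S)"
  from borel_measurable_implies_sequence_metric[OF this]
  obtain F where "\<And>i. simple_function (lebesgue_on S) (F i)"
    "\<And>x. x \<in> space (lebesgue_on S) \<Longrightarrow> (\<lambda>i. F i x) \<longlonglongrightarrow> f x" by metis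
  then show "strongly_measurable (lebesgue_on S) f"
    unfolding strongly_measurable_def by (intro exI[of _ F]) auto
next
  let ?M = "lebesgue_on S"
  assume "strongly_measurable ?M f"
  then obtain s where s: "\<And>i. simple_function ?M (s i)" "AE t in ?M. (\<lambda>i::nat. s i t) \<longlonglongrightarrow> f t"
    unfolding strongly_measurable_def by blast
  obtain N where N: "{t \<in> space ?M. \<not> (\<lambda>i. s i t) \<longlonglongrightarrow> f t} \<subseteq> N" "N \<in> null_sets ?M"
    using s(2) by (auto elim!: AE_E simp: null_sets_def)
  have N_meas: "N \<in> sets ?M" using N(2) by auto
  define c where "c = f 0"
  define g where "g t = (if t \<in> N then c else f t)" for t
  have "g \<in> borel_measurable ?M"
  proof (rule borel_measurable_LIMSEQ_metric)
    show "(\<lambda>t. if t \<in> N then c else s i t) \<in> borel_measurable ?M" for i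
      using N_meas borel_measurable_simple_function[OF s(1)[of i]] by (intro measurable_If_set) auto
    show "(\<lambda>i. if t \<in> N then c else s i t) \<longlonglongrightarrow> g t" if "t \<in> space ?M" for t
      using N(1) that by (cases "t \<in> N") (auto simp: g_def)
  qed
  show "f \<in> borel_measurable ?M"
  proof (rule measurableI)
    fix B :: "'a set" assume B: "B \<in> sets borel"
    have "f -` B \<inter> space ?M = (g -` B \<inter> space ?M - N) \<union> (f -` B \<inter> space ?M \<inter> N)"
      by (auto simp: g_def)
    moreover have "g -` B \<inter> space ?M - N \<in> sets ?M"
      using measurable_sets[OF \<open>g \<in> borel_measurable ?M\<close> B] N_meas by auto
    moreover have "f -` B \<inter> space ?M \<inter> N \<in> sets ?M"
      by (rule null_subset_sets_lebesgue_on[OF N(2) S]) auto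
    ultimately show "f -` B \<inter> space ?M \<in> sets ?M" by (metis sets.Un)
  qed simp
qed

lemma strongly_measurable_continuous:
  assumes "strongly_measurable M f" "continuous_on UNIV A"
  shows "strongly_measurable M (\<lambda>t. A (f t))"
proof -
  obtain s where s: "\<And>i. simple_function M (s i)" "AE t in M. (\<lambda>i::nat. s i t) \<longlonglongrightarrow> f t"
    using assms(1) unfolding strongly_measurable_def by blast
  have "AE t in M. (\<lambda>i. A (s i t)) \<longlonglongrightarrow> A (f t)"
    using s(2) by eventually_elim
      (use continuous_on_tendsto_compose[OF assms(2)] in auto)
  then show ?thesis
    unfolding strongly_measurable_def
    by (intro exI[of _ "\<lambda>i t. A (s i t)"]) (auto intro: simple_function_compose1 s(1))
qed

text \<open>Argued through strong measurability so that it also covers the dual space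
  \<open>'y \<Rightarrow>\<^sub>L real\<close>, as domain for \<open>riesz\<close> and as codomain
  for \<open>blinfun_inner_right\<close>.\<close>

lemma L2_time_bounded_linear:
  fixes A :: "'a::real_normed_vector \<Rightarrow> 'b::real_normed_vector"
  assumes A: "bounded_linear A" and f: "f \<in> L2_time T"
  shows "(\<lambda>t. A (f t)) \<in> L2_time T"
proof -
  let ?M = "lebesgue_on {0<..<T}"
  have sm: "strongly_measurable ?M f" and int: "integrable ?M (\<lambda>t. (norm (f t))\<^sup>2)"
    using f by (auto simp: L2_time_def)
  have smA: "strongly_measurable ?M (\<lambda>t. A (f t))"
    by (rule strongly_measurable_continuous[OF sm linear_continuous_on[OF A]])
  obtain K where K: "\<And>x. norm (A x) \<le> norm x * K" "K > 0" using bounded_linear.pos_bounded[OF A] by blast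
  have "integrable ?M (\<lambda>t. (norm (A (f t)))\<^sup>2)"
  proof (rule Bochner_Integration.integrable_bound)
    show "integrable ?M (\<lambda>t. (norm (f t))\<^sup>2 * K\<^sup>2)" using int by (rule integrable_mult_left)
    have "strongly_measurable ?M (\<lambda>t. (norm (A (f t)))\<^sup>2)"
      by (rule strongly_measurable_continuous[OF smA]) (intro continuous_intros)
    then show "(\<lambda>t. (norm (A (f t)))\<^sup>2) \<in> borel_measurable ?M"
      by (subst (asm) strongly_measurable_iff) auto
    show "AE t in ?M. norm ((norm (A (f t)))\<^sup>2) \<le> norm ((norm (f t))\<^sup>2 * K\<^sup>2)"
      using K by (auto simp flip: power_mult_distrib intro!: power_mono)
  qed
  with smA show ?thesis by (simp add: L2_time_def)
qed

text \<open>Extension by zero, which carries the Bochner space on the interval isometrically into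
  the Hilbert space on the line.\<close>

definition emb :: "real \<Rightarrow> (real \<Rightarrow> 'a::{real_inner,second_countable_topology}) \<Rightarrow> 'a L2" where
  "emb T f = cls (\<lambda>t. indicator {0<..<T} t *\<^sub>R f t)"

lemma L2_time_iff:
  fixes f :: "real \<Rightarrow> 'a::{real_inner,second_countable_topology}"
  shows "f \<in> L2_time T \<longleftrightarrow> sq_int (\<lambda>t. indicator {0<..<T} t *\<^sub>R f t)"
proof -
  have "(\<lambda>t. (norm (indicator {0<..<T} t *\<^sub>R f t))\<^sup>2) = (\<lambda>t. indicator {0<..<T} t *\<^sub>R (norm (f t))\<^sup>2)"
    by (auto simp: indicator_def)
  then show ?thesis
    by (simp add: L2_time_def sq_int_def strongly_measurable_iff integrable_restrict_space
        borel_measurable_restrict_space_iff)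
qed

lemma fn_L2_time: "fn F \<in> L2_time T"
proof -
  have "sq_int (\<lambda>t. indicator {0<..<T} t *\<^sub>R fn F t)"
  proof (rule sq_intI_bounded)
    show "(\<lambda>t. indicator {0<..<T} t *\<^sub>R fn F t) \<in> borel_measurable lebesgue"
      by (intro borel_measurable_scaleR borel_measurable_indicator) auto
    show "integrable lebesgue (\<lambda>t. (norm (fn F t))\<^sup>2)" by (rule sq_int_integrable[OF sq_int_fn])
  qed (simp add: indicator_def)
  then show ?thesis by (simp add: L2_time_iff)
qed

lemma fn_emb:
  "f \<in> L2_time T \<Longrightarrow> AE t in lebesgue. fn (emb T f) t = indicator {0<..<T} t *\<^sub>R f t"
  unfolding emb_def by (intro fn_cls) (simp add: L2_time_iff)

lemma fn_emb_on:
  assumes "f \<in> L2_time T"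
  shows "AE t in lebesgue_on {0<..<T}. fn (emb T f) t = f t"
  unfolding AE_lebesgue_on_iff[OF lebesgue_on_sets_Ioo]
  using fn_emb[OF assms] by eventually_elim (simp add: indicator_def)

lemma L2_time_measurable:
  "f \<in> L2_time T \<Longrightarrow> f \<in> borel_measurable (lebesgue_on {0<..<T})"
  for f :: "real \<Rightarrow> 'a::{real_inner,second_countable_topology}"
  by (simp add: L2_time_def strongly_measurable_iff)

lemma emb_eq_iff:
  assumes "f \<in> L2_time T" "g \<in> L2_time T"
  shows "emb T f = emb T g \<longleftrightarrow> (AE t in lebesgue_on {0<..<T}. f t = g t)"
proof -
  have "emb T f = emb T g \<longleftrightarrow> (AE t in lebesgue. indicator {0<..<T} t *\<^sub>R f t = indicator {0<..<T} t *\<^sub>R g t)"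
    unfolding emb_def using assms by (intro cls_eq_iff) (auto simp: L2_time_iff)
  also have "\<dots> \<longleftrightarrow> (AE t in lebesgue. t \<in> {0<..<T} \<longrightarrow> f t = g t)"
    by (rule eventually_cong[OF eventually_mono[OF always_eventually[of "\<lambda>_. True"]]]) (auto simp: indicator_def)
  finally show ?thesis by (simp add: AE_lebesgue_on_iff)
qed

lemma LINT_inner_emb:
  assumes f: "f \<in> L2_time T" and g: "g \<in> L2_time T"
  shows "integrable (lebesgue_on {0<..<T}) (\<lambda>t. f t \<bullet> g t)"
    and "(LINT t|lebesgue_on {0<..<T}. f t \<bullet> g t) = emb T f \<bullet> emb T g"
proof -
  let ?I = "{0<..<T}"
  have eq: "(\<lambda>t. indicator ?I t *\<^sub>R (f t \<bullet> g t)) = (\<lambda>t. (indicator ?I t *\<^sub>R f t) \<bullet> (indicator ?I t *\<^sub>R g t))"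
    by (auto simp: indicator_def)
  have sq: "sq_int (\<lambda>t. indicator ?I t *\<^sub>R f t)" "sq_int (\<lambda>t. indicator ?I t *\<^sub>R g t)"
    using f g by (auto simp: L2_time_iff)
  have "integrable lebesgue (\<lambda>t. indicator ?I t *\<^sub>R (f t \<bullet> g t))"
    unfolding eq by (rule integrable_inner_sq_int[OF sq])
  then show "integrable (lebesgue_on ?I) (\<lambda>t. f t \<bullet> g t)"
    by (simp add: integrable_restrict_space)
  show "(LINT t|lebesgue_on ?I. f t \<bullet> g t) = emb T f \<bullet> emb T g"
    unfolding Ioo_integral eq inner_L2_eq
  proof (rule integral_cong_AE)
    show "AE t in lebesgue. (indicator ?I t *\<^sub>R f t) \<bullet> (indicator ?I t *\<^sub>R g t) = fn (emb T f) t \<bullet> fn (emb T g) t"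
      using fn_emb[OF f] fn_emb[OF g] by eventually_elim simp
  qed (intro borel_measurable_inner sq_int_measurable sq fn_measurable)+
qed

lemma L2_time_norm_eq:
  fixes f :: "real \<Rightarrow> 'a::{real_inner,second_countable_topology}"
  shows "f \<in> L2_time T \<Longrightarrow> L2_time_norm T f = norm (emb T f)"
  using LINT_inner_emb(2)[of f T f]
  unfolding L2_time_norm_def power2_norm_eq_inner norm_eq_sqrt_inner[of "emb T f"] by simp

lemma emb_lift:
  fixes A :: "'a::{real_inner,second_countable_topology} \<Rightarrow> 'b::{real_inner,second_countable_topology}"
  assumes A: "bounded_linear A" and f: "f \<in> L2_time T"
  shows "emb T (\<lambda>t. A (f t)) = lift_L2 A (emb T f)"
proof -
  have eq: "indicator {0<..<T} t *\<^sub>R A x = A (indicator {0<..<T} t *\<^sub>R x)" for t x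
    by (simp add: linear_scale[OF bounded_linear.linear[OF A]])
  show ?thesis
    unfolding L2_eq_iff
    using fn_emb[OF f] fn_emb[OF L2_time_bounded_linear[OF A f]] fn_lift_L2[OF A, of "emb T f"]
    by eventually_elim (simp only: eq)
qed

section \<open>The dual space\<close>

definition riesz :: "('y::{real_inner,complete_space} \<Rightarrow>\<^sub>L real) \<Rightarrow> 'y" where
  "riesz f = (SOME u. \<forall>x. blinfun_apply f x = u \<bullet> x)"

lemma riesz: "blinfun_apply f x = riesz f \<bullet> x"
proof -
  have "\<exists>u. \<forall>x. blinfun_apply f x = u \<bullet> x"
    using riesz_representation[OF blinfun.bounded_linear_right[of f]] by metis
  from someI_ex[OF this] show ?thesis unfolding riesz_def by (rule spec)
qed

lemma inner_eqI:
  fixes u v :: "'a::real_inner"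
  assumes "\<And>x. u \<bullet> x = v \<bullet> x"
  shows "u = v"
proof -
  have "(u - v) \<bullet> (u - v) = 0" using assms by (simp add: inner_diff_left)
  then show ?thesis by simp
qed

lemma inner_right_riesz: "blinfun_inner_right (riesz f) = f"
  by (rule blinfun_eqI) (simp only: riesz[of f] blinfun_inner_right.rep_eq)

lemma bounded_linear_riesz: "bounded_linear riesz"
proof (rule bounded_linear_intro[where K = 1])
  show "riesz (f + g) = riesz f + riesz g" for f g :: "'a \<Rightarrow>\<^sub>L real"
    by (rule inner_eqI) (simp add: inner_add_left blinfun.add_left flip: riesz)
  show "riesz (c *\<^sub>R f) = c *\<^sub>R riesz f" for c and f :: "'a \<Rightarrow>\<^sub>L real"
    by (rule inner_eqI) (simp add: blinfun.scaleR_left flip: riesz)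
  show "norm (riesz f) \<le> norm f * 1" for f :: "'a \<Rightarrow>\<^sub>L real"
  proof (cases "riesz f = 0")
    case False
    have "(norm (riesz f))\<^sup>2 = blinfun_apply f (riesz f)" by (simp add: riesz power2_norm_eq_inner)
    also have "\<dots> \<le> norm f * norm (riesz f)" using norm_blinfun[of f "riesz f"] by simp
    finally show ?thesis using False by (simp add: power2_eq_square)
  qed simp
qed

section \<open>State and adjoint spaces\<close>

text \<open>\<open>J\<close> is \<open>j\<close> followed by its adjoint. It replaces the embedding
  of \<open>'y\<close> into its dual by an operator on \<open>'y\<close>, so that all equations stay
  in one Hilbert space.\<close>

locale gelfand_triple =
  fixes j :: "'y::{real_inner,complete_space,second_countable_topology} \<Rightarrow>
      'h::{real_inner,complete_space}"
    and J :: "'y \<Rightarrow> 'y" and T :: real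
  assumes j: "bounded_linear j" and inj_pivot: "inj (pivot j)"
    and J: "bounded_linear J" and J_inner: "\<And>u v. J u \<bullet> v = j u \<bullet> j v"
    and T: "T > 0"
begin

lemma pivot_apply: "blinfun_apply (pivot j h) v = h \<bullet> j v"
  unfolding pivot_def
  by (simp add: bounded_linear_Blinfun_apply bounded_linear_compose[OF bounded_linear_inner_right j])

lemma J_sym: "J u \<bullet> v = u \<bullet> J v"
  using J_inner[of u v] J_inner[of v u] by (simp add: inner_commute)

lemma J_psd: "0 \<le> J u \<bullet> u"
  by (simp add: J_inner)

text \<open>Injectivity of \<open>pivot j\<close> expresses density of the range of
  \<open>j\<close>. It is what identifies a continuous representative in \<open>'h\<close> from its
  products with vectors \<open>j v\<close>.\<close>

lemma range_j_separates:
  assumes "\<And>v. u \<bullet> j v = w \<bullet> j v" shows "u = w"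
proof -
  have "pivot j u = pivot j w" by (rule blinfun_eqI) (simp add: pivot_apply assms)
  then show ?thesis using inj_pivot by (simp add: inj_eq)
qed

lemma sg_sq [simp]: "sg r * sg r = 1" "sg r * (sg r * x) = x"
  by (auto simp: sg_def)

text \<open>Tested with a fixed \<open>v\<close>, the continuous representative and the signed
  primitive of the derivative have the same weak derivative. By du Bois-Reymond they differ by a
  constant, which the condition at the start makes zero.\<close>

lemma volt_if_time_derivative:
  assumes r: "time_order r" and y: "y \<in> L2_time T" and g: "g \<in> L2_time T"
    and deriv: "has_time_derivative T j y g" and start: "vanishes_at T j (start r T) y"
  shows "lift_L2 J (emb T y) = volt r T (sg r *\<^sub>R emb T (\<lambda>t. riesz (g t)))"
proof -
  let ?M = "lebesgue_on {0<..<T}"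
  define h where "h = (\<lambda>t. riesz (g t))"
  have h: "h \<in> L2_time T" unfolding h_def by (rule L2_time_bounded_linear[OF bounded_linear_riesz g])
  obtain w where w: "continuous_on {0..T} w" "AE t in ?M. w t = j (y t)" "w (start r T) = 0"
    using start unfolding vanishes_at_def by blast
  have st: "start r T \<in> {0..T}" using T by (simp add: start_def)
  have key: "w t \<bullet> j v = sg r * (prim r T (emb T h) t \<bullet> v)" if t: "t \<in> {0..T}" for t v
  proof -
    define \<rho> where "\<rho> t = w t \<bullet> j v - sg r * (prim r T (emb T h) t \<bullet> v)" for t
    have c1: "continuous_on {0..T} (\<lambda>t. w t \<bullet> j v)" by (intro continuous_intros w)
    have c2: "continuous_on {0..T} (\<lambda>t. prim r T (emb T h) t \<bullet> v)"
      by (intro continuous_intros continuous_prim[OF r])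
    have "continuous_on {0..T} \<rho>" unfolding \<rho>_def by (intro continuous_intros c1 c2)
    moreover have "(LINT t|?M. deriv \<phi> t * \<rho> t) = 0" if \<phi>: "test_function T \<phi>" for \<phi>
    proof -
      note c3 = test_functionD(2)[OF \<phi>, of "{0..T}"]
      have "(LINT t|?M. deriv \<phi> t * \<rho> t) = (LINT t|?M. deriv \<phi> t * (w t \<bullet> j v) - sg r * (deriv \<phi> t * (prim r T (emb T h) t \<bullet> v)))"
        by (simp add: \<rho>_def algebra_simps)
      also have "\<dots> = (LINT t|?M. deriv \<phi> t * (w t \<bullet> j v)) - (LINT t|?M. sg r * (deriv \<phi> t * (prim r T (emb T h) t \<bullet> v)))"
        by (intro Bochner_Integration.integral_diff LINT_Ioo_eq_integral continuous_intros c1 c2 c3)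
      also have "(LINT t|?M. deriv \<phi> t * (w t \<bullet> j v)) = (LINT t|?M. deriv \<phi> t * blinfun_apply (pivot j (j (y t))) v)"
      proof (rule integral_cong_AE)
        have "continuous_on {0..T} (\<lambda>t. deriv \<phi> t * (w t \<bullet> j v))" by (intro continuous_intros c1 c3)
        from LINT_Ioo_eq_integral(1)[OF this]
        show "(\<lambda>t. deriv \<phi> t * (w t \<bullet> j v)) \<in> borel_measurable ?M" by (rule borel_measurable_integrable)
        have "deriv \<phi> \<in> borel_measurable ?M" using LINT_Ioo_eq_integral(1)[OF c3] by (rule borel_measurable_integrable)
        moreover have "(\<lambda>t. J (y t)) \<in> borel_measurable ?M"
          by (rule L2_time_measurable[OF L2_time_bounded_linear[OF J y]])
        ultimately have "(\<lambda>t. deriv \<phi> t * (J (y t) \<bullet> v)) \<in> borel_measurable ?M"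
          by (intro borel_measurable_times borel_measurable_inner) auto
        then show "(\<lambda>t. deriv \<phi> t * blinfun_apply (pivot j (j (y t))) v) \<in> borel_measurable ?M"
          by (simp add: pivot_apply J_inner)
        show "AE t in ?M. deriv \<phi> t * (w t \<bullet> j v) = deriv \<phi> t * blinfun_apply (pivot j (j (y t))) v"
          using w(2) by eventually_elim (simp add: pivot_apply)
      qed
      also have "\<dots> = - (LINT t|?M. \<phi> t * (h t \<bullet> v))"
        using deriv \<phi> by (simp add: has_time_derivative_def h_def riesz)
      also have "(LINT t|?M. \<phi> t * (h t \<bullet> v)) = (LINT t|?M. \<phi> t * (fn (emb T h) t \<bullet> v))"
      proof (rule integral_cong_AE)
        have "continuous_on {0..T} \<phi>"
          using test_functionD(1)[OF \<phi>] by (meson DERIV_isCont continuous_at_imp_continuous_on)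
        from borel_measurable_integrable[OF LINT_Ioo_eq_integral(1)[OF this]]
        show "(\<lambda>t. \<phi> t * (h t \<bullet> v)) \<in> borel_measurable ?M" "(\<lambda>t. \<phi> t * (fn (emb T h) t \<bullet> v)) \<in> borel_measurable ?M"
          by (intro borel_measurable_times borel_measurable_inner L2_time_measurable[OF h]
              sq_int_measurable_on[OF sq_int_fn] borel_measurable_const; assumption)+
        show "AE t in ?M. \<phi> t * (h t \<bullet> v) = \<phi> t * (fn (emb T h) t \<bullet> v)"
          using fn_emb_on[OF h] by eventually_elim simp
      qed
      also have "(LINT t|?M. sg r * (deriv \<phi> t * (prim r T (emb T h) t \<bullet> v))) =
          - (LINT t|?M. \<phi> t * (fn (emb T h) t \<bullet> v))"
        by (simp add: prim_integration_by_parts[OF r T \<phi>])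
      finally show ?thesis by simp
    qed
    ultimately obtain m where m: "\<And>t. t \<in> {0..T} \<Longrightarrow> \<rho> t = m"
      using du_Bois_Reymond[OF T] by blast
    have "m = 0" using m[OF st] by (simp add: \<rho>_def w prim_start[OF r])
    then show ?thesis using m[OF t] by (simp add: \<rho>_def)
  qed
  interpret P: bounded_linear "\<lambda>F. prim r T F t" for t by (rule bounded_linear_prim[OF r])
  have J_eq: "J (y t) = prim r T (sg r *\<^sub>R emb T h) t" if "w t = j (y t)" "t \<in> {0<..<T}" for t
    by (rule inner_eqI) (use key[of t] that in \<open>simp add: J_inner P.scaleR\<close>)
  have AE_J: "AE t in lebesgue. t \<in> {0<..<T} \<longrightarrow> J (y t) = prim r T (sg r *\<^sub>R emb T h) t"
    using w(2)[unfolded AE_lebesgue_on_iff[OF lebesgue_on_sets_Ioo]]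
    by eventually_elim (use J_eq in blast)
  have "lift_L2 J (emb T y) = volt r T (sg r *\<^sub>R emb T h)"
    unfolding L2_eq_iff
    using fn_lift_L2[OF J, of "emb T y"] fn_emb[OF y] AE_J fn_volt[OF r, of T "sg r *\<^sub>R emb T h"]
      fn_scaleR[of "sg r" "emb T h"] fn_emb[OF h]
    by eventually_elim (auto simp: linear_0[OF bounded_linear.linear[OF J]])
  then show ?thesis by (simp add: h_def)
qed

lemma time_derivative_if_prim:
  assumes r: "time_order r" and y: "AE t in lebesgue_on {0<..<T}. J (y t) = prim r T G t"
    and yL: "y \<in> L2_time T"
  shows "has_time_derivative T j y (\<lambda>t. sg r *\<^sub>R blinfun_inner_right (fn G t))"
  unfolding has_time_derivative_def
proof (intro allI impI)
  fix \<phi> v assume \<phi>: "test_function T \<phi>"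
  let ?M = "lebesgue_on {0<..<T}"
  have d\<phi>: "deriv \<phi> \<in> borel_measurable ?M"
    using LINT_Ioo_eq_integral(1)[OF test_functionD(2)[OF \<phi>]] by (rule borel_measurable_integrable)
  have "(LINT t|?M. deriv \<phi> t * blinfun_apply (pivot j (j (y t))) v) =
      (LINT t|?M. deriv \<phi> t * (J (y t) \<bullet> v))"
    by (simp add: pivot_apply J_inner)
  also have "\<dots> = (LINT t|?M. deriv \<phi> t * (prim r T G t \<bullet> v))"
  proof (rule integral_cong_AE)
    show "(\<lambda>t. deriv \<phi> t * (J (y t) \<bullet> v)) \<in> borel_measurable ?M"
      by (intro borel_measurable_times d\<phi> borel_measurable_inner borel_measurable_const
          L2_time_measurable[OF L2_time_bounded_linear[OF J yL]])
    show "(\<lambda>t. deriv \<phi> t * (prim r T G t \<bullet> v)) \<in> borel_measurable ?M"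
      by (intro borel_measurable_times d\<phi> borel_measurable_inner borel_measurable_const
          borel_measurable_prim_on[OF r])
  qed (use y in eventually_elim, simp)
  also have "\<dots> = - sg r * (LINT t|?M. \<phi> t * (fn G t \<bullet> v))"
    by (rule prim_integration_by_parts[OF r T \<phi>])
  also have "\<dots> = - (LINT t|?M. \<phi> t * blinfun_apply (sg r *\<^sub>R blinfun_inner_right (fn G t)) v)"
    by (simp add: blinfun.scaleR_left mult.left_commute)
  finally show "(LINT t|?M. deriv \<phi> t * blinfun_apply (pivot j (j (y t))) v) =
    - (LINT t|?M. \<phi> t * blinfun_apply (sg r *\<^sub>R blinfun_inner_right (fn G t)) v)" .
qed

text \<open>
  \<open>F\<close> is approximated by primitives \<open>prim r T d\<close>, which are continuous with values in \<open>'y\<close>;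
  the energy identity makes them Cauchy in \<open>'h\<close> uniformly in time.
\<close>

lemma continuous_representative:
  assumes r: "time_order r" and F: "lift_L2 J F = volt r T G"
  obtains w where "continuous_on {0..T} w" "w (start r T) = 0"
    "\<And>t v. t \<in> {0..T} \<Longrightarrow> w t \<bullet> j v = prim r T G t \<bullet> v"
proof -
  \<comment> \<open>Reversing the order exchanges the two operators of the pair, so one argument
    serves state and adjoint.\<close>
  have "volterra_pair (volt r T) (volt (\<lambda>s t. r t s) T :: 'y L2 \<Rightarrow> 'y L2)"
    using r by (cases rule: time_order_cases) (use volterra_pair_volt[OF T] volterra_pair.swap[OF volterra_pair_volt[OF T]] in auto)
  then interpret volterra_pair "volt r T" "volt (\<lambda>s t. r t s) T :: 'y L2 \<Rightarrow> 'y L2" .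
  obtain d where d: "(\<lambda>n. lift_L2 J (d n)) \<longlonglongrightarrow> G" "(\<lambda>n. volt r T (d n)) \<longlonglongrightarrow> F"
    using approximation[OF bounded_linear_lift_L2[OF J] volt_lift_L2[OF r J] F] by blast
  interpret P: bounded_linear "\<lambda>F. prim r T F t" for t by (rule bounded_linear_prim[OF r])
  interpret LJ: bounded_linear "lift_L2 J" by (rule bounded_linear_lift_L2[OF J])
  interpret V: bounded_linear "volt r T :: 'y L2 \<Rightarrow> 'y L2" by (rule V)
  interpret j: bounded_linear j by (rule j)
  define u where "u n t = j (prim r T (d n) t)" for n t
  have diff: "(norm (u m t - u n t))\<^sup>2 \<le>
      2 * (norm (lift_L2 J (d m) - lift_L2 J (d n)) * norm (volt r T (d m) - volt r T (d n)))" for m n t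
  proof -
    have "(norm (u m t - u n t))\<^sup>2 = J (prim r T (d m - d n) t) \<bullet> prim r T (d m - d n) t"
      by (simp add: u_def J_inner power2_norm_eq_inner P.diff j.diff)
    also have "\<dots> \<le> 2 * (norm (lift_L2 J (d m - d n)) * norm (volt r T (d m - d n)))"
      by (rule prim_energy_le[OF r J J_sym])
    finally show ?thesis by (simp add: LJ.diff V.diff)
  qed
  have "uniformly_Cauchy_on {0..T} u"
  proof (rule uniformly_Cauchy_onI)
    fix e :: real assume e: "e > 0"
    \<comment> \<open>Half of \<open>e\<close> here and \<open>e\<close> for the other factor, since
      the product in \<open>diff\<close> carries a factor 2.\<close>
    obtain M1 where M1: "\<And>m n. m \<ge> M1 \<Longrightarrow> n \<ge> M1 \<Longrightarrow> norm (lift_L2 J (d m) - lift_L2 J (d n)) < e / 2"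
      using LIMSEQ_imp_Cauchy[OF d(1)] e unfolding Cauchy_iff by (meson half_gt_zero)
    obtain M2 where M2: "\<And>m n. m \<ge> M2 \<Longrightarrow> n \<ge> M2 \<Longrightarrow> norm (volt r T (d m) - volt r T (d n)) < e"
      using LIMSEQ_imp_Cauchy[OF d(2)] e unfolding Cauchy_iff by meson
    show "\<exists>M. \<forall>t\<in>{0..T}. \<forall>m\<ge>M. \<forall>n\<ge>M. dist (u m t) (u n t) < e"
    proof (intro exI ballI allI impI)
      fix t m n assume mn: "max M1 M2 \<le> m" "max M1 M2 \<le> n"
      have "norm (lift_L2 J (d m) - lift_L2 J (d n)) * norm (volt r T (d m) - volt r T (d n)) < e / 2 * e"
        using mn e by (intro mult_strict_mono' M1 M2) auto
      then have "(norm (u m t - u n t))\<^sup>2 < e\<^sup>2"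
        using diff[where m = m and n = n and t = t] by (simp add: power2_eq_square)
      then show "dist (u m t) (u n t) < e"
        using e by (simp add: dist_norm power_less_imp_less_base)
    qed
  qed
  then obtain w where w: "uniform_limit {0..T} u w sequentially"
    using Cauchy_uniformly_convergent by (auto simp: uniformly_convergent_on_def)
  have "continuous_on {0..T} w"
  proof (rule uniform_limit_theorem[OF _ w])
    show "\<forall>\<^sub>F n in sequentially. continuous_on {0..T} (u n)"
      unfolding u_def by (intro always_eventually allI j.continuous_on continuous_prim[OF r])
  qed simp
  moreover have lim: "(\<lambda>n. u n t) \<longlonglongrightarrow> w t" if "t \<in> {0..T}" for t
    by (rule tendsto_uniform_limitI[OF w that])
  moreover have "w (start r T) = 0"
  proof -
    have "start r T \<in> {0..T}" using T by (simp add: start_def)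
    from lim[OF this] show ?thesis
      by (simp add: u_def prim_start[OF r] j.zero LIMSEQ_const_iff)
  qed
  moreover have "w t \<bullet> j v = prim r T G t \<bullet> v" if t: "t \<in> {0..T}" for t v
  proof -
    have "(\<lambda>n. prim r T (lift_L2 J (d n)) t \<bullet> v) \<longlonglongrightarrow> prim r T G t \<bullet> v"
      by (intro tendsto_intros P.tendsto d)
    moreover have "prim r T (lift_L2 J (d n)) t \<bullet> v = u n t \<bullet> j v" for n
      by (simp add: prim_lift_L2[OF r J] J_inner u_def)
    ultimately have "(\<lambda>n. u n t \<bullet> j v) \<longlonglongrightarrow> prim r T G t \<bullet> v" by simp
    moreover have "(\<lambda>n. u n t \<bullet> j v) \<longlonglongrightarrow> w t \<bullet> j v" by (intro tendsto_intros lim t)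
    ultimately show ?thesis using LIMSEQ_unique by blast
  qed
  ultimately show ?thesis using that by blast
qed

text \<open>Converse of \<open>volt_if_time_derivative\<close>: a solution of the operator equation
  is an actual state or adjoint, including its end condition.\<close>

lemma W_space_if_volt:
  assumes r: "time_order r" and F: "lift_L2 J F = volt r T G"
  shows "fn F \<in> W_space T j" and "vanishes_at T j (start r T) (fn F)"
proof -
  have AE_J: "AE t in lebesgue_on {0<..<T}. J (fn F t) = prim r T G t"
    unfolding AE_lebesgue_on_iff[OF lebesgue_on_sets_Ioo]
    using fn_lift_L2[OF J, of F] fn_volt[OF r, of T G] unfolding F by eventually_elim auto
  have "bounded_linear (\<lambda>x. sg r *\<^sub>R blinfun_inner_right x :: 'y \<Rightarrow>\<^sub>L real)"
    by (intro bounded_linear_compose[OF bounded_linear_scaleR_right bounded_linear_blinfun_inner_right])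
  from L2_time_bounded_linear[OF this fn_L2_time] time_derivative_if_prim[OF r AE_J fn_L2_time]
  show "fn F \<in> W_space T j"
    unfolding W_space_def using fn_L2_time by blast
  obtain w where w: "continuous_on {0..T} w" "w (start r T) = 0"
    "\<And>t v. t \<in> {0..T} \<Longrightarrow> w t \<bullet> j v = prim r T G t \<bullet> v"
    using continuous_representative[OF r F] by blast
  have "AE t in lebesgue_on {0<..<T}. w t = j (fn F t)"
    using AE_J AE_space
  proof eventually_elim
    case (elim t)
    show ?case
      by (rule range_j_separates) (use elim w(3)[of t] in \<open>simp flip: J_inner\<close>)
  qed
  with w show "vanishes_at T j (start r T) (fn F)" unfolding vanishes_at_def by blast
qed

end

section \<open>Operators annihilated by a polynomial with positive roots\<close>

text \<open>The monic polynomial with roots \<open>cs\<close>, evaluated at the operator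
  \<open>L\<close>.\<close>

fun root_op :: "('a::real_vector \<Rightarrow> 'a) \<Rightarrow> real list \<Rightarrow> 'a \<Rightarrow> 'a" where
  "root_op L [] v = v"
| "root_op L (c # cs) v = root_op L cs (L v - c *\<^sub>R v)"

lemma root_op_intertwine:
  assumes "\<And>x. S (E x) = E (L x)" "linear E"
  shows "root_op S cs (E x) = E (root_op L cs x)"
proof (induction cs arbitrary: x)
  case (Cons c cs)
  have "S (E x) - c *\<^sub>R E x = E (L x - c *\<^sub>R x)"
    by (simp add: assms(1) linear_diff[OF assms(2)] linear_scale[OF assms(2)])
  then show ?case by (simp add: Cons)
qed simp

text \<open>Division of a polynomial by its variable: \<open>\<kappa>\<close> is the constant term,
  up to sign the product of the roots. If the polynomial annihilates \<open>L\<close>, then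
  \<open>T\<close> divided by \<open>- \<kappa>\<close> is the inverse.\<close>

lemma root_op_remainder:
  fixes L :: "'a::real_normed_vector \<Rightarrow> 'a"
  assumes L: "bounded_linear L" and nz: "0 \<notin> set cs"
  obtains T \<kappa> where "bounded_linear T" "\<kappa> \<noteq> 0" "\<And>x. T (L x) = L (T x)"
    "\<And>x. root_op L cs x = L (T x) + \<kappa> *\<^sub>R x"
proof -
  interpret L: bounded_linear L by (rule L)
  have "\<exists>T \<kappa>. bounded_linear T \<and> \<kappa> \<noteq> 0 \<and> (\<forall>x. T (L x) = L (T x)) \<and>
      (\<forall>x. root_op L cs x = L (T x) + \<kappa> *\<^sub>R x)" using nz
  proof (induction cs)
    case Nil
    show ?case by (intro exI[of _ "\<lambda>_. 0"] exI[of _ 1]) (simp add: L.zero)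
  next
    case (Cons c cs)
    then obtain T \<kappa> where T: "bounded_linear T" "\<kappa> \<noteq> 0" "\<And>x. T (L x) = L (T x)"
      "\<And>x. root_op L cs x = L (T x) + \<kappa> *\<^sub>R x" by auto
    interpret T: bounded_linear T by (rule T)
    \<comment> \<open>From the induction hypothesis at \<open>L x - c *\<^sub>R x\<close>:
      everything carries a factor \<open>L\<close> except the term with
      \<open>- c * \<kappa>\<close>.\<close>
    let ?T = "\<lambda>x. T (L x) - c *\<^sub>R T x + \<kappa> *\<^sub>R x"
    have "bounded_linear ?T"
      by (intro bounded_linear_add bounded_linear_sub bounded_linear_compose[OF T(1) L]
          bounded_linear_compose[OF bounded_linear_scaleR_right T(1)] bounded_linear_scaleR_right)
    moreover have "- c * \<kappa> \<noteq> 0" using Cons.prems T(2) by auto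
    moreover have "?T (L x) = L (?T x)" for x by (simp add: T(3) L.add L.diff L.scaleR)
    moreover have "root_op L (c # cs) x = L (?T x) + (- c * \<kappa>) *\<^sub>R x" for x
      by (simp add: T(3,4) T.diff T.scaleR L.add L.diff L.scaleR algebra_simps)
    ultimately show ?case by blast
  qed
  with that show ?thesis by blast
qed

lemma root_op_inverse:
  fixes L :: "'a::real_normed_vector \<Rightarrow> 'a"
  assumes L: "bounded_linear L" and nz: "0 \<notin> set cs" and zero: "\<And>x. root_op L cs x = 0"
  obtains N where "bounded_linear N" "\<And>x. N (L x) = x" "\<And>x. L (N x) = x"
proof -
  interpret L: bounded_linear L by (rule L)
  obtain T \<kappa> where T: "bounded_linear T" "\<kappa> \<noteq> 0" "\<And>x. T (L x) = L (T x)"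
    "\<And>x. root_op L cs x = L (T x) + \<kappa> *\<^sub>R x" using root_op_remainder[OF L nz] by blast
  have LT: "L (T x) = - (\<kappa> *\<^sub>R x)" for x using T(4)[of x] zero[of x] by (simp add: eq_neg_iff_add_eq_0)
  show ?thesis
  proof
    show "bounded_linear (\<lambda>x. (- 1 / \<kappa>) *\<^sub>R T x)"
      by (rule bounded_linear_compose[OF bounded_linear_scaleR_right T(1)])
    show "(- 1 / \<kappa>) *\<^sub>R T (L x) = x" "L ((- 1 / \<kappa>) *\<^sub>R T x) = x" for x
      using T(2) by (simp_all only: T(3) L.scaleR LT) simp_all
  qed
qed

text \<open>The vector \<open>L v - c *\<^sub>R v\<close> is handled by the induction hypothesis.
  Dividing its \<open>d\<close>-component by \<open>d - c\<close> undoes \<open>L - c\<close> there,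
  and what remains of \<open>v\<close> is an eigenvector for \<open>c\<close>.\<close>

lemma eigenvector_decomposition:
  assumes L: "linear L" and cs: "distinct cs" and zero: "root_op L cs v = 0"
  obtains e where "\<And>c. c \<in> set cs \<Longrightarrow> L (e c) = c *\<^sub>R e c" "v = (\<Sum>c\<in>set cs. e c)"
proof -
  have "\<exists>e. (\<forall>c\<in>set cs. L (e c) = c *\<^sub>R e c) \<and> v = (\<Sum>c\<in>set cs. e c)"
    using cs zero
  proof (induction cs arbitrary: v)
    case (Cons c cs)
    then obtain e where e: "\<And>d. d \<in> set cs \<Longrightarrow> L (e d) = d *\<^sub>R e d" "L v - c *\<^sub>R v = (\<Sum>d\<in>set cs. e d)"
      by force
    define e' where "e' d = (1 / (d - c)) *\<^sub>R e d" for d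
    define u where "u = v - (\<Sum>d\<in>set cs. e' d)"
    have "L (\<Sum>d\<in>set cs. e' d) - c *\<^sub>R (\<Sum>d\<in>set cs. e' d) = (\<Sum>d\<in>set cs. L (e' d) - c *\<^sub>R e' d)"
      by (simp add: linear_sum[OF L] sum_subtractf scaleR_sum_right)
    also have "\<dots> = (\<Sum>d\<in>set cs. e d)"
    proof (rule sum.cong[OF refl])
      fix d assume d: "d \<in> set cs"
      then have "d - c \<noteq> 0" using Cons.prems by auto
      have "L (e' d) - c *\<^sub>R e' d = (1 / (d - c)) *\<^sub>R (d *\<^sub>R e d - c *\<^sub>R e d)"
        by (simp add: e'_def linear_scale[OF L] e(1)[OF d] scaleR_diff_right)
      also have "\<dots> = ((1 / (d - c)) * (d - c)) *\<^sub>R e d"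
        by (simp only: scaleR_scaleR scaleR_diff_left[symmetric])
      finally show "L (e' d) - c *\<^sub>R e' d = e d" using \<open>d - c \<noteq> 0\<close> by simp
    qed
    finally have "L u - c *\<^sub>R u = 0"
      using e(2) by (simp add: u_def linear_diff[OF L] scaleR_diff_right algebra_simps)
    moreover have "L (e' d) = d *\<^sub>R e' d" if "d \<in> set cs" for d
      using e(1)[OF that] by (simp add: e'_def linear_scale[OF L])
    moreover have c: "c \<notin> set cs" using Cons.prems by simp
    moreover have "(\<Sum>d\<in>set cs. (e'(c := u)) d) = (\<Sum>d\<in>set cs. e' d)"
      by (rule sum.cong) (use c in auto)
    then have "(\<Sum>d\<in>set (c # cs). (e'(c := u)) d) = v"
      using c by (simp add: u_def)
    ultimately show ?case
      by (intro exI[of _ "e'(c := u)"]) auto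
  qed simp
  with that show ?thesis by blast
qed

text \<open>Symmetry of the product of \<open>J\<close> and \<open>L\<close> makes eigenvectors for
  distinct values orthogonal in the form of \<open>J\<close>. The form is then a sum of eigenvalues
  times nonnegative squares.\<close>

lemma psd_if_root_op_zero:
  fixes J L :: "'a::real_inner \<Rightarrow> 'a"
  assumes L: "linear L" and J: "linear J" and cs: "distinct cs" "\<And>c. c \<in> set cs \<Longrightarrow> c \<ge> 0"
    and zero: "root_op L cs v = 0"
    and J_sym: "\<And>x y. J x \<bullet> y = x \<bullet> J y" and J_psd: "\<And>x. 0 \<le> J x \<bullet> x"
    and JL_sym: "\<And>x y. J (L x) \<bullet> y = x \<bullet> J (L y)"
  shows "0 \<le> J (L v) \<bullet> v"
proof -
  obtain e where e: "\<And>c. c \<in> set cs \<Longrightarrow> L (e c) = c *\<^sub>R e c" "v = (\<Sum>c\<in>set cs. e c)"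
    using eigenvector_decomposition[OF L cs(1) zero] by blast
  have orth: "J (e c) \<bullet> e d = 0" if "c \<in> set cs" "d \<in> set cs" "c \<noteq> d" for c d
  proof -
    have "c * (J (e c) \<bullet> e d) = d * (J (e c) \<bullet> e d)"
      using JL_sym[of "e c" "e d"] e(1) that J_sym[of "e c" "e d"] by (simp add: linear_scale[OF J])
    then show ?thesis using that by simp
  qed
  have "J (L v) = (\<Sum>c\<in>set cs. c *\<^sub>R J (e c))"
    unfolding e(2) linear_sum[OF L] linear_sum[OF J]
    by (intro sum.cong refl) (simp add: e(1) linear_scale[OF J])
  then have "J (L v) \<bullet> v = (\<Sum>c\<in>set cs. \<Sum>d\<in>set cs. c * (J (e c) \<bullet> e d))"
    by (subst (2) e(2)) (simp add: inner_sum_left inner_sum_right sum_distrib_left, rule sum.swap)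
  also have "\<dots> \<ge> 0"
  proof (intro sum_nonneg)
    fix c d assume cd: "c \<in> set cs" "d \<in> set cs"
    show "0 \<le> c * (J (e c) \<bullet> e d)"
      using orth[OF cd] cs(2)[OF cd(1)] J_psd[of "e c"] by (cases "c = d") auto
  qed
  finally show ?thesis .
qed

section \<open>Restriction to the time interval\<close>

text \<open>The orthogonal projection onto functions supported in the interval. It carries solutions
  found on the whole line back to the original problem.\<close>

definition restr :: "real \<Rightarrow> 'a::{real_inner,second_countable_topology} L2 \<Rightarrow> 'a L2" where
  "restr T F = emb T (fn F)"

lemma fn_restr: "AE t in lebesgue. fn (restr T F) t = indicator {0<..<T} t *\<^sub>R fn F t"
  unfolding restr_def by (rule fn_emb[OF fn_L2_time])

lemma restr_emb:
  assumes "f \<in> L2_time T"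
  shows "restr T (emb T f) = emb T f"
  unfolding L2_eq_iff using fn_restr[of T "emb T f"] fn_emb[OF assms]
  by eventually_elim (simp add: indicator_def)

lemma restr_idem: "restr T (restr T F) = restr T F"
  unfolding restr_def[of T F] by (rule restr_emb[OF fn_L2_time])

lemma linear_restr: "linear (restr T)"
proof (rule linearI)
  show "restr T (F + G) = restr T F + restr T G" for F G :: "'a L2"
    unfolding L2_eq_iff using fn_restr[of T F] fn_restr[of T G] fn_restr[of T "F + G"]
      fn_add[of F G] fn_add[of "restr T F" "restr T G"]
    by eventually_elim (simp add: scaleR_add_right)
  show "restr T (c *\<^sub>R F) = c *\<^sub>R restr T F" for c and F :: "'a L2"
    unfolding L2_eq_iff using fn_restr[of T F] fn_restr[of T "c *\<^sub>R F"] fn_scaleR[of c F]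
      fn_scaleR[of c "restr T F"]
    by eventually_elim simp
qed

lemma restr_lift_L2:
  assumes "bounded_linear A"
  shows "restr T (lift_L2 A F) = lift_L2 A (restr T F)"
  unfolding L2_eq_iff using fn_restr[of T F] fn_restr[of T "lift_L2 A F"] fn_lift_L2[OF assms, of F]
    fn_lift_L2[OF assms, of "restr T F"]
proof eventually_elim
  case (elim t)
  show ?case unfolding elim by (simp add: linear_scale[OF bounded_linear.linear[OF assms]])
qed

lemma inner_restr: "restr T F \<bullet> G = F \<bullet> restr T G"
  unfolding inner_L2_eq
proof (rule integral_cong_AE)
  show "AE t in lebesgue. fn (restr T F) t \<bullet> fn G t = fn F t \<bullet> fn (restr T G) t"
    using fn_restr[of T F] fn_restr[of T G] by eventually_elim simp
qed (intro borel_measurable_inner fn_measurable)+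

lemma norm_restr_le: "norm (restr T F) \<le> norm F"
proof -
  have "AE t in lebesgue. norm (fn (restr T F) t) \<le> 1 * norm (fn F t)"
    using fn_restr[of T F] by eventually_elim (simp add: indicator_def)
  from norm_L2_le[OF this] show ?thesis by simp
qed

text \<open>Slabs lie inside the interval, so primitives only see the restricted function.\<close>

lemma restr_volt:
  fixes F :: "'a::{real_inner,complete_space,second_countable_topology} L2"
  assumes r: "time_order r"
  shows "restr T (volt r T F) = volt r T (restr T F)"
proof -
  have prim: "prim r T (restr T F) t = prim r T F t" for t
  proof (rule inner_eqI)
    fix v :: 'a
    have "AE s in lebesgue. indicator {0<..<T} s *\<^sub>R fn (ind (slab r T t) v) s = fn (ind (slab r T t) v) s"
      using fn_ind[OF slab_lmeasurable[OF r], of T t v] by eventually_elim (auto simp: slab_def indicator_def)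
    then have "restr T (ind (slab r T t) v) = ind (slab r T t) v"
      unfolding L2_eq_iff using fn_restr[of T "ind (slab r T t) v"] by eventually_elim simp
    then show "prim r T (restr T F) t \<bullet> v = prim r T F t \<bullet> v"
      by (simp add: prim_def wint(2)[OF slab_lmeasurable[OF r]] inner_restr)
  qed
  show ?thesis
    unfolding L2_eq_iff using fn_restr[of T F] fn_restr[of T "volt r T F"] fn_volt[OF r, of T F]
      fn_volt[OF r, of T "restr T F"]
    by eventually_elim (auto simp: prim indicator_def)
qed

section \<open>Bilinear forms and functionals\<close>

lemma bounded_bilinear_operator:
  fixes b :: "'u::real_normed_vector \<Rightarrow> 'y::{real_inner,complete_space} \<Rightarrow> real"
  assumes "bounded_bilinear b"
  obtains A where "bounded_linear A" "\<And>u z. b u z = A u \<bullet> z"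
proof -
  interpret b: bounded_bilinear b by (rule assms)
  have "\<exists>w. \<forall>z. b u z = w \<bullet> z" for u
    using riesz_representation[OF b.bounded_linear_right[of u]] by metis
  then obtain A where A: "\<And>u z. b u z = A u \<bullet> z" by metis
  obtain K where K: "K > 0" "\<And>u z. norm (b u z) \<le> norm u * norm z * K" using b.pos_bounded by blast
  have "bounded_linear A"
  proof (rule bounded_linear_intro[where K = K])
    show "A (x + y) = A x + A y" for x y
      by (rule inner_eqI) (simp add: inner_add_left b.add_left flip: A)
    show "A (c *\<^sub>R x) = c *\<^sub>R A x" for c x
      by (rule inner_eqI) (simp add: b.scaleR_left flip: A)
    show "norm (A x) \<le> norm x * K" for x
    proof (cases "A x = 0")
      case False
      have "(norm (A x))\<^sup>2 = b x (A x)" by (simp add: A power2_norm_eq_inner)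
      also have "\<dots> \<le> norm x * norm (A x) * K" using K(2)[of x "A x"] by simp
      finally have "norm (A x) * norm (A x) \<le> norm (A x) * (norm x * K)"
        by (simp add: power2_eq_square ac_simps)
      then show ?thesis using False by (simp add: mult_le_cancel_left)
    qed (use K in simp)
  qed
  with A that show ?thesis by blast
qed

text \<open>The datum \<open>g\<close> is known only through its integrals, so the integrated
  functional is represented, rather than each \<open>g t\<close>. It ignores values outside the
  interval, hence \<open>F\<close> is supported there.\<close>

lemma time_functional_representation:
  fixes g :: "real \<Rightarrow> 'y::{real_inner,complete_space,second_countable_topology} \<Rightarrow>\<^sub>L real"
  assumes int: "\<And>z. z \<in> L2_time T \<Longrightarrow> integrable (lebesgue_on {0<..<T}) (\<lambda>t. blinfun_apply (g t) (z t))"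
    and bound: "\<And>z. z \<in> L2_time T \<Longrightarrow>
      \<bar>LINT t|lebesgue_on {0<..<T}. blinfun_apply (g t) (z t)\<bar> \<le> K * L2_time_norm T z"
  obtains F where "restr T F = F"
    "\<And>z. z \<in> L2_time T \<Longrightarrow> (LINT t|lebesgue_on {0<..<T}. blinfun_apply (g t) (z t)) = F \<bullet> emb T z"
proof -
  let ?M = "lebesgue_on {0<..<T}"
  define \<Phi> where "\<Phi> F = (LINT t|?M. blinfun_apply (g t) (fn F t))" for F
  have cong: "(LINT t|?M. blinfun_apply (g t) (y t)) = (LINT t|?M. blinfun_apply (g t) (z t))"
    if "y \<in> L2_time T" "z \<in> L2_time T" "AE t in ?M. y t = z t" for y z
  proof (rule integral_cong_AE)
    show "AE t in ?M. blinfun_apply (g t) (y t) = blinfun_apply (g t) (z t)"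
      using that(3) by eventually_elim simp
  qed (intro borel_measurable_integrable int that)+
  have lin: "fn F \<in> L2_time T" for F :: "'y L2" by (rule fn_L2_time)
  have \<Phi>_emb: "\<Phi> (emb T z) = (LINT t|?M. blinfun_apply (g t) (z t))" if "z \<in> L2_time T" for z
    unfolding \<Phi>_def by (rule cong[OF lin that fn_emb_on[OF that]])
  have comb: "(\<lambda>t. fn F t + fn G t) \<in> L2_time T" "(\<lambda>t. c *\<^sub>R fn F t) \<in> L2_time T" for F G :: "'y L2" and c
  proof -
    have eq: "(\<lambda>t. indicator {0<..<T} t *\<^sub>R (fn F t + fn G t)) =
        (\<lambda>t. indicator {0<..<T} t *\<^sub>R fn F t + indicator {0<..<T} t *\<^sub>R fn G t)"
      by (auto simp: scaleR_add_right)
    show "(\<lambda>t. fn F t + fn G t) \<in> L2_time T"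
      unfolding L2_time_iff eq using lin[of F] lin[of G] by (intro sq_int_add) (simp_all add: L2_time_iff)
    show "(\<lambda>t. c *\<^sub>R fn F t) \<in> L2_time T"
      by (rule L2_time_bounded_linear[OF bounded_linear_scaleR_right lin])
  qed
  have AE_on: "AE t in ?M. P t" if "AE t in lebesgue. P t" for P
    by (rule AE_lebesgue_onI[OF that]) simp
  have bd: "\<bar>\<Phi> F\<bar> \<le> norm F * \<bar>K\<bar>" for F
  proof -
    have "\<bar>\<Phi> F\<bar> \<le> K * norm (restr T F)"
      using bound[OF lin[of F]] by (simp add: \<Phi>_def L2_time_norm_eq[OF lin] restr_def)
    also have "\<dots> \<le> \<bar>K\<bar> * norm F"
      by (intro mult_mono norm_restr_le) auto
    finally show ?thesis by (simp add: mult.commute)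
  qed
  have "bounded_linear \<Phi>"
  proof (rule bounded_linear_intro[where K = "\<bar>K\<bar>"])
    show "\<Phi> (F + G) = \<Phi> F + \<Phi> G" for F G
    proof -
      have "\<Phi> (F + G) = (LINT t|?M. blinfun_apply (g t) (fn F t + fn G t))"
        unfolding \<Phi>_def by (rule cong[OF lin comb(1) AE_on[OF fn_add]])
      then show ?thesis by (simp add: \<Phi>_def blinfun.add_right int lin)
    qed
    show "\<Phi> (c *\<^sub>R F) = c *\<^sub>R \<Phi> F" for c F
    proof -
      have "\<Phi> (c *\<^sub>R F) = (LINT t|?M. blinfun_apply (g t) (c *\<^sub>R fn F t))"
        unfolding \<Phi>_def by (rule cong[OF lin comb(2) AE_on[OF fn_scaleR]])
      then show ?thesis by (simp add: \<Phi>_def blinfun.scaleR_right)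
    qed
    show "norm (\<Phi> F) \<le> norm F * \<bar>K\<bar>" for F using bd[of F] by simp
  qed
  from riesz_representation[OF this] obtain F where F: "\<And>G. \<Phi> G = F \<bullet> G" by blast
  show ?thesis
  proof
    show "(LINT t|?M. blinfun_apply (g t) (z t)) = F \<bullet> emb T z" if "z \<in> L2_time T" for z
      using \<Phi>_emb[OF that] F by simp
    show "restr T F = F"
    proof (rule inner_eqI)
      fix G
      have "\<Phi> (restr T G) = \<Phi> G" unfolding restr_def by (subst \<Phi>_emb[OF lin]) (simp add: \<Phi>_def)
      then show "restr T F \<bullet> G = F \<bullet> G" by (simp add: F inner_restr)
    qed
  qed
qed

lemma lift_L2_compose:
  assumes A: "bounded_linear A" and B: "bounded_linear B"
  shows "lift_L2 (\<lambda>x. A (B x)) F = lift_L2 A (lift_L2 B F)"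
  unfolding L2_eq_iff
  using fn_lift_L2[OF bounded_linear_compose[OF A B], of F] fn_lift_L2[OF A, of "lift_L2 B F"]
    fn_lift_L2[OF B, of F]
proof eventually_elim
  case (elim t)
  show ?case by (simp only: elim)
qed

section \<open>The optimality system\<close>

context parabolic_ocp
begin

text \<open>Subdomains may overlap, so the value at a point is a sum of coefficients over the set of
  indices containing it. There are finitely many such sets, and none is empty on
  \<open>\<Omega>\<close>.\<close>

lemma multiplication_weight:
  assumes \<mu>: "\<mu> \<in> P"
  shows "finite (piecewise_weight QS cS \<Omega>S \<mu> ` \<Omega>)"
    and "x \<in> \<Omega> \<Longrightarrow> piecewise_weight QS cS \<Omega>S \<mu> x > 0"
proof -
  have "piecewise_weight QS cS \<Omega>S \<mu> x = (\<Sum>i\<in>{i. i < QS \<and> x \<in> \<Omega>S i}. cS i \<mu>)" for x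
    unfolding piecewise_weight_def
    by (rule sum.mono_neutral_cong_right) (auto simp: indicator_def)
  then have "piecewise_weight QS cS \<Omega>S \<mu> ` \<Omega> \<subseteq> (\<lambda>A. \<Sum>i\<in>A. cS i \<mu>) ` Pow {..<QS}"
    by (auto intro!: image_eqI)
  then show "finite (piecewise_weight QS cS \<Omega>S \<mu> ` \<Omega>)"
    by (rule finite_subset) simp
  assume "x \<in> \<Omega>"
  then obtain i where i: "i < QS" "x \<in> \<Omega>S i" using S_subdomains(2) by auto
  show "piecewise_weight QS cS \<Omega>S \<mu> x > 0"
    unfolding piecewise_weight_def
    by (rule sum_pos2[of _ i]) (use i S_positive[OF \<mu>] in \<open>auto simp: less_imp_le\<close>)
qed

text \<open>With \<open>cs\<close> listing all values of the weight the product is zero on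
  \<open>\<Omega>\<close>, so the polynomial annihilates \<open>S \<mu>\<close> on the image of
  \<open>pivot j\<close>.\<close>

lemma root_op_pivot:
  assumes \<mu>: "\<mu> \<in> P" and piv: "\<And>h v. blinfun_apply (pivot j h) v = h \<bullet> j v"
  shows "\<exists>h'. root_op (S \<mu>) cs (pivot j h) = pivot j h' \<and>
    (AE x in lebesgue_on \<Omega>. rH h' x = (\<Prod>c\<leftarrow>cs. piecewise_weight QS cS \<Omega>S \<mu> x - c) * rH h x)"
proof (induction cs arbitrary: h)
  case Nil
  show ?case by (intro exI[of _ h]) simp
next
  case (Cons c cs)
  let ?w = "piecewise_weight QS cS \<Omega>S \<mu>"
  obtain h1 where h1: "AE x in lebesgue_on \<Omega>. rH h1 x = ?w x * rH h x" "S \<mu> (pivot j h) = pivot j h1"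
    using S_multiplication[OF \<mu>] by blast
  define h2 where "h2 = h1 + (- c) *\<^sub>R h"
  have "root_op (S \<mu>) (c # cs) (pivot j h) = root_op (S \<mu>) cs (pivot j h2)"
  proof -
    have "S \<mu> (pivot j h) - c *\<^sub>R pivot j h = pivot j h2"
      by (rule blinfun_eqI)
        (simp add: h1(2) h2_def piv blinfun.diff_left blinfun.scaleR_left inner_add_left
          inner_diff_left)
    then show ?thesis by simp
  qed
  moreover have "AE x in lebesgue_on \<Omega>. rH h2 x = (?w x - c) * rH h x"
  proof -
    have "AE x in lebesgue_on \<Omega>. rH h2 x = rH h1 x + rH ((- c) *\<^sub>R h) x"
      "AE x in lebesgue_on \<Omega>. rH ((- c) *\<^sub>R h) x = (- c) * rH h x"
      unfolding h2_def
      by (rule H_in_L2[unfolded contained_in_L2_def, THEN conjunct2, THEN conjunct1, rule_format]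
          H_in_L2[unfolded contained_in_L2_def, THEN conjunct2, THEN conjunct2, THEN conjunct1, rule_format])+
    with h1(1) show ?thesis by eventually_elim (simp add: algebra_simps)
  qed
  moreover obtain h' where "root_op (S \<mu>) cs (pivot j h2) = pivot j h'"
    "AE x in lebesgue_on \<Omega>. rH h' x = (\<Prod>c\<leftarrow>cs. ?w x - c) * rH h2 x"
    using Cons.IH by blast
  ultimately show ?case
  proof (intro exI[of _ h'] conjI)
    assume "AE x in lebesgue_on \<Omega>. rH h' x = (\<Prod>c\<leftarrow>cs. ?w x - c) * rH h2 x"
      "AE x in lebesgue_on \<Omega>. rH h2 x = (?w x - c) * rH h x"
    then show "AE x in lebesgue_on \<Omega>. rH h' x = (\<Prod>c\<leftarrow>c # cs. ?w x - c) * rH h x"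
      by eventually_elim (simp add: ac_simps)
  qed simp
qed

text \<open>Multiplication and self-adjointness are given only on functionals coming from
  \<open>'h\<close>, not on all of the dual. The transpose \<open>L\<close> of \<open>Sg\<close>
  brings them back to \<open>'y\<close>: self-adjointness reads \<open>Sg (J x) = J (L x)\<close>,
  and since \<open>J\<close> is injective the annihilating polynomial passes to \<open>L\<close>.
  The inverse of \<open>L\<close>, transposed, is then the inverse \<open>R\<close> of
  \<open>Sg\<close>.\<close>

lemma S_operator:
  assumes \<mu>: "\<mu> \<in> P" and T: "T > 0"
  obtains Sg R J where "gelfand_triple j J T" "bounded_linear Sg"
    "\<And>f z. blinfun_apply (S \<mu> f) z = Sg (riesz f) \<bullet> z"
    "bounded_linear R" "\<And>x. Sg (R x) = x" "\<And>x. R (Sg x) = x"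
    "\<And>x y. Sg (J x) \<bullet> y = x \<bullet> Sg (J y)" "\<And>x. 0 \<le> Sg (J x) \<bullet> x"
proof -
  have j: "bounded_linear j" by (rule Y_in_H(1))
  obtain j' where j': "bounded_linear j'" "\<And>x y. j x \<bullet> y = x \<bullet> j' y"
    using bounded_linear_adjoint_exists[OF j] by blast
  define J where "J x = j' (j x)" for x
  have J: "bounded_linear J" unfolding J_def by (rule bounded_linear_compose[OF j'(1) j])
  have J_inner: "J u \<bullet> v = j u \<bullet> j v" for u v
    using j'(2)[of v "j u"] by (simp add: J_def inner_commute)
  interpret gelfand_triple j J T
    by (rule gelfand_triple.intro) (use j H_in_dual J J_inner T in auto)
  define Sg where "Sg u = riesz (S \<mu> (blinfun_inner_right u))" for u
  have Sg: "bounded_linear Sg"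
    unfolding Sg_def
    by (intro bounded_linear_compose[OF bounded_linear_riesz]
        bounded_linear_compose[OF S_continuous[OF \<mu>]] bounded_linear_blinfun_inner_right)
  have Sg_riesz: "Sg (riesz f) = riesz (S \<mu> f)" for f
    by (simp only: Sg_def inner_right_riesz)
  have J_riesz: "J x = riesz (pivot j (j x))" for x
    by (rule inner_eqI) (simp add: J_inner pivot_apply flip: riesz)
  obtain L where L: "bounded_linear L" "\<And>x y. Sg x \<bullet> y = x \<bullet> L y"
    using bounded_linear_adjoint_exists[OF Sg] by blast
  have SJ_sym: "Sg (J x) \<bullet> y = x \<bullet> Sg (J y)" for x y
  proof -
    have "Sg (J x) \<bullet> y = blinfun_apply (S \<mu> (pivot j (j x))) y"
      by (simp only: J_riesz Sg_riesz riesz)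
    also have "\<dots> = blinfun_apply (S \<mu> (pivot j (j y))) x" by (rule S_selfadjoint[OF \<mu>])
    also have "\<dots> = Sg (J y) \<bullet> x" by (simp only: J_riesz Sg_riesz riesz)
    finally show ?thesis by (simp only: inner_commute)
  qed
  have SJ: "Sg (J x) = J (L x)" for x
  proof (rule inner_eqI)
    fix y
    have "Sg (J x) \<bullet> y = Sg (J y) \<bullet> x" using SJ_sym[of x y] by (simp only: inner_commute)
    also have "\<dots> = J y \<bullet> L x" by (rule L(2))
    also have "\<dots> = J (L x) \<bullet> y" by (simp add: J_sym[of y] inner_commute)
    finally show "Sg (J x) \<bullet> y = J (L x) \<bullet> y" .
  qed
  let ?w = "piecewise_weight QS cS \<Omega>S \<mu>"
  \<comment> \<open>Each value of the weight once: completeness of the list makes the polynomial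
    vanish, and distinctness allows the eigenvector decomposition.\<close>
  obtain cs where cs: "set cs = ?w ` \<Omega>" "distinct cs"
    using finite_distinct_list[OF multiplication_weight(1)[OF \<mu>]] by blast
  have cs_pos: "c > 0" if "c \<in> set cs" for c
    using that multiplication_weight(2)[OF \<mu>] by (auto simp: cs(1))
  have zero: "root_op L cs x = 0" for x
  proof -
    obtain h' where h': "root_op (S \<mu>) cs (pivot j (j x)) = pivot j h'"
      "AE y in lebesgue_on \<Omega>. rH h' y = (\<Prod>c\<leftarrow>cs. ?w y - c) * rH (j x) y"
      using root_op_pivot[OF \<mu> pivot_apply] by blast
    have "(\<Prod>c\<leftarrow>cs. ?w y - c) = 0" if "y \<in> \<Omega>" for y
      using that by (auto simp: prod_list_zero_iff cs(1))
    moreover have "AE y in lebesgue_on \<Omega>. y \<in> \<Omega>"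
      using AE_space[of "lebesgue_on \<Omega>"] by simp
    ultimately have "AE y in lebesgue_on \<Omega>. rH h' y = 0"
      using h'(2) by (auto elim!: eventually_elim2)
    then have "h' = 0" using H_in_L2 unfolding contained_in_L2_def by blast
    then have piv0: "root_op (S \<mu>) cs (pivot j (j x)) = 0"
      by (auto simp: h'(1) pivot_apply intro: blinfun_eqI)
    have "J (root_op L cs x) = root_op Sg cs (J x)"
      by (rule root_op_intertwine[where S = Sg and E = J and L = L, OF SJ bounded_linear.linear[OF J], symmetric])
    also have "\<dots> = riesz (root_op (S \<mu>) cs (pivot j (j x)))"
      unfolding J_riesz by (rule root_op_intertwine[where S = Sg and E = riesz and L = "S \<mu>", OF Sg_riesz bounded_linear.linear[OF bounded_linear_riesz]])
    also have "\<dots> = 0" unfolding piv0 by (rule linear_0[OF bounded_linear.linear[OF bounded_linear_riesz]])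
    finally have "J (root_op L cs x) \<bullet> root_op L cs x = 0" by simp
    then have "j (root_op L cs x) = j 0"
      by (simp add: J_inner linear_0[OF bounded_linear.linear[OF j]])
    then show ?thesis using Y_in_H(2) by (simp add: inj_eq)
  qed
  have "0 \<notin> set cs" using cs_pos by force
  from root_op_inverse[OF L(1) this zero]
  obtain N where N: "bounded_linear N" "\<And>x. N (L x) = x" "\<And>x. L (N x) = x" by blast
  obtain R where R: "bounded_linear R" "\<And>x y. N x \<bullet> y = x \<bullet> R y"
    using bounded_linear_adjoint_exists[OF N(1)] by blast
  show ?thesis
  proof (rule that[of J Sg R])
    show "blinfun_apply (S \<mu> f) z = Sg (riesz f) \<bullet> z" for f z
      by (simp only: Sg_riesz riesz)
    show "Sg (R x) = x" for x
    proof (rule inner_eqI)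
      fix z
      have "Sg (R x) \<bullet> z = L z \<bullet> R x" unfolding L(2) by (rule inner_commute)
      also have "\<dots> = z \<bullet> x" by (simp add: N(2) flip: R(2))
      finally show "Sg (R x) \<bullet> z = x \<bullet> z" by (simp only: inner_commute)
    qed
    show "R (Sg x) = x" for x
    proof (rule inner_eqI)
      fix z
      have "R (Sg x) \<bullet> z = N z \<bullet> Sg x" unfolding R(2) by (rule inner_commute)
      also have "\<dots> = Sg x \<bullet> N z" by (rule inner_commute)
      also have "\<dots> = x \<bullet> z" by (simp add: L(2) N(3))
      finally show "R (Sg x) \<bullet> z = x \<bullet> z" .
    qed
    have "0 \<le> J (L x) \<bullet> x" for x
    proof (rule psd_if_root_op_zero[OF bounded_linear.linear[OF L(1)] bounded_linear.linear[OF J] cs(2) _ zero J_sym J_psd])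
      show "c \<ge> 0" if "c \<in> set cs" for c using cs_pos[OF that] by simp
      show "J (L x) \<bullet> y = x \<bullet> J (L y)" for x y using SJ_sym[of x y] by (simp add: SJ)
    qed
    then show "0 \<le> Sg (J x) \<bullet> x" for x by (simp add: SJ)
  qed (fact gelfand_triple_axioms Sg R(1) SJ_sym)+
qed

lemma c_symmetric:
  assumes "\<mu> \<in> P" shows "c \<mu> (tr u) v = c \<mu> (tr v) u"
proof (rule has_bochner_integral_eq[OF c_weighted[OF assms]])
  show "has_bochner_integral \<nu> (\<lambda>x. piecewise_weight QC cC \<Omega>C \<mu> x * rU (tr u) x * rU (tr v) x) (c \<mu> (tr v) u)"
    using c_weighted[OF assms, of "tr v" u] by (simp add: ac_simps)
qed

lemma c_semidefinite:
  assumes "\<mu> \<in> P" shows "0 \<le> c \<mu> (tr u) u"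
proof -
  have "0 \<le> piecewise_weight QC cC \<Omega>C \<mu> x" for x
    unfolding piecewise_weight_def using c_positive[OF assms] by (intro sum_nonneg) (auto simp: less_imp_le)
  then have "0 \<le> (LINT x|\<nu>. piecewise_weight QC cC \<Omega>C \<mu> x * rU (tr u) x * rU (tr u) x)"
    by (intro Bochner_Integration.integral_nonneg) (simp add: mult.assoc)
  then show ?thesis
    using has_bochner_integral_integral_eq[OF c_weighted[OF assms, of "tr u" u]] by simp
qed

lemma wellposed:
  assumes T: "T > 0" and \<alpha>: "\<alpha> > 0" and \<mu>: "\<mu> \<in> P" and yd: "yd \<in> L2_time T"
  shows "\<exists>y \<in> state_space T j. \<exists>p \<in> adjoint_space T j.
    solves_optimality T \<alpha> j tr ob (S \<mu>) (a \<mu>) (c \<mu>) (m \<mu>) (G \<mu>) yd (y, p) \<and>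
    (\<forall>y' \<in> state_space T j. \<forall>p' \<in> adjoint_space T j.
       solves_optimality T \<alpha> j tr ob (S \<mu>) (a \<mu>) (c \<mu>) (m \<mu>) (G \<mu>) yd (y', p') \<longrightarrow>
       (AE t in lebesgue_on {0<..<T}. y' t = y t \<and> p' t = p t))"
proof -
  let ?I = "lebesgue_on {0<..<T}"
  let ?V = "volt (<) T :: 'y L2 \<Rightarrow> 'y L2" and ?W = "volt (>) T :: 'y L2 \<Rightarrow> 'y L2"
  obtain Sg R J where GT: "gelfand_triple j J T" and Sg: "bounded_linear Sg"
    "\<And>f z. blinfun_apply (S \<mu> f) z = Sg (riesz f) \<bullet> z"
    and R: "bounded_linear R" "\<And>x. Sg (R x) = x" "\<And>x. R (Sg x) = x"
    and SJ: "\<And>x y. Sg (J x) \<bullet> y = x \<bullet> Sg (J y)" "\<And>x. 0 \<le> Sg (J x) \<bullet> x"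
    by (rule S_operator[OF \<mu> T]) (rule that; assumption)
  interpret gelfand_triple j J T by (rule GT)
  obtain A where A: "bounded_linear A" "\<And>u z. a \<mu> u z = A u \<bullet> z"
    using bounded_bilinear_operator[OF a_continuous[OF \<mu>]] by blast
  obtain A' where A': "bounded_linear A'" "\<And>x y. A x \<bullet> y = x \<bullet> A' y"
    using bounded_linear_adjoint_exists[OF A(1)] by blast
  obtain \<gamma> where \<gamma>: "\<gamma> > 0" "\<And>y. \<gamma> * (norm y)\<^sup>2 \<le> A y \<bullet> y"
    using a_coercive[OF \<mu>] by (auto simp: A(2))
  obtain C where C: "bounded_linear C" "\<And>u z. c \<mu> u z = C u \<bullet> z"
    using bounded_bilinear_operator[OF c_continuous[OF \<mu>]] by blast
  obtain M0 where M0: "bounded_linear M0" "\<And>u z. m \<mu> u z = M0 u \<bullet> z"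
    using bounded_bilinear_operator[OF m_continuous[OF \<mu>]] by blast
  define D where "D u = (1 / \<alpha>) *\<^sub>R C (tr u)" for u
  define M where "M u = M0 (ob u)" for u
  have D: "bounded_linear D" unfolding D_def
    by (intro bounded_linear_compose[OF bounded_linear_scaleR_right] bounded_linear_compose[OF C(1)] Y_in_U)
  have D_sym: "D x \<bullet> y = x \<bullet> D y" for x y
    using c_symmetric[OF \<mu>, of x y] by (simp add: D_def C(2) inner_commute[of x])
  have D_psd: "0 \<le> D x \<bullet> x" for x using c_semidefinite[OF \<mu>, of x] \<alpha> by (simp add: D_def C(2))
  have M: "bounded_linear M" unfolding M_def by (rule bounded_linear_compose[OF M0(1) Y_in_Yobs])
  have M_sym: "M x \<bullet> y = x \<bullet> M y" for x y
    using m_symmetric[OF \<mu>, of x y] by (simp add: M_def M0(2) inner_commute[of x])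
  have M_psd: "0 \<le> M x \<bullet> x" for x using m_semidefinite[OF \<mu>, of x] by (simp add: M_def M0(2))
  \<comment> \<open>The weight of \<open>S\<close> enters the pivot operator, which remains
    symmetric and positive semidefinite and, acting pointwise in time, commutes with
    \<open>?V\<close> and \<open>?W\<close>.\<close>
  define B where "B x = Sg (J x)" for x
  have B: "bounded_linear B" unfolding B_def by (rule bounded_linear_compose[OF Sg(1) J])
  have B_sym: "B x \<bullet> y = x \<bullet> B y" and B_psd: "0 \<le> B x \<bullet> x" for x y
    using SJ by (auto simp: B_def)
  obtain K where K: "\<forall>z \<in> L2_time T. integrable ?I (\<lambda>t. blinfun_apply (G \<mu> t) (z t)) \<and>
      \<bar>LINT t|?I. blinfun_apply (G \<mu> t) (z t)\<bar> \<le> K * L2_time_norm T z"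
    using G_continuous[OF \<mu>] by blast
  obtain f where f: "restr T f = f"
    "\<And>z. z \<in> L2_time T \<Longrightarrow> (LINT t|?I. blinfun_apply (G \<mu> t) (z t)) = f \<bullet> emb T z"
    using time_functional_representation[of T "G \<mu>" K] K by blast
  define h where "h = emb T (\<lambda>t. M0 (yd t))"
  have M0yd: "(\<lambda>t. M0 (yd t)) \<in> L2_time T" by (rule L2_time_bounded_linear[OF M0(1) yd])
  have h: "restr T h = h" unfolding h_def by (rule restr_emb[OF M0yd])

  interpret vp: volterra_pair ?V ?W by (rule volterra_pair_volt[OF T])
  interpret sys: optimality_system ?V ?W "lift_L2 B" "lift_L2 A" "lift_L2 A'" "lift_L2 D" "lift_L2 M" \<gamma>
  proof (intro optimality_system.intro optimality_system_axioms.intro vp.volterra_pair_axioms)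
    show "lift_L2 B (?V x) = ?V (lift_L2 B x)" for x by (rule volt_lift_L2[OF time_order_less B])
    show "0 \<le> lift_L2 B x \<bullet> ?V x" for x
      by (rule lift_volt_nonneg[OF time_order_less B B_sym B_psd])
    show "\<gamma> * (norm x)\<^sup>2 \<le> lift_L2 A x \<bullet> x" for x by (rule lift_L2_coercive[OF A(1) \<gamma>(2)])
    show "0 \<le> lift_L2 D x \<bullet> x" for x using lift_L2_coercive[OF D, of 0 x] D_psd by simp
    show "0 \<le> lift_L2 M x \<bullet> x" for x using lift_L2_coercive[OF M, of 0 x] M_psd by simp
    show "lift_L2 B x \<bullet> y = x \<bullet> lift_L2 B y" for x y by (rule lift_L2_adjoint[OF B B B_sym])
    show "lift_L2 A x \<bullet> y = x \<bullet> lift_L2 A' y" for x y by (rule lift_L2_adjoint[OF A(1) A'(1) A'(2)])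
    show "lift_L2 D x \<bullet> y = x \<bullet> lift_L2 D y" for x y by (rule lift_L2_adjoint[OF D D D_sym])
    show "lift_L2 M x \<bullet> y = x \<bullet> lift_L2 M y" for x y by (rule lift_L2_adjoint[OF M M M_sym])
  qed (intro bounded_linear_lift_L2 B A(1) A'(1) D M \<gamma>(1))+

  have lift_B: "lift_L2 B F = lift_L2 Sg (lift_L2 J F)" for F
    unfolding B_def by (rule lift_L2_compose[OF Sg(1) J])
  have lift_SgR: "lift_L2 Sg (lift_L2 R F) = F" and lift_RSg: "lift_L2 R (lift_L2 Sg F) = F" for F :: "'y L2"
    by (simp_all add: lift_L2_id R(2,3) flip: lift_L2_compose[OF Sg(1) R(1)] lift_L2_compose[OF R(1) Sg(1)])
  note restr_lift = restr_lift_L2[OF Sg(1)] restr_lift_L2[OF R(1)] restr_lift_L2[OF A(1)]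
    restr_lift_L2[OF A'(1)] restr_lift_L2[OF D] restr_lift_L2[OF M] restr_lift_L2[OF B]
  note restr_lin = linear_add[OF linear_restr] linear_diff[OF linear_restr]

  define dt where "dt y = emb T (\<lambda>t. riesz (time_derivative T j y t))" for y
  have W: "time_derivative T j y \<in> L2_time T" "has_time_derivative T j y (time_derivative T j y)"
    if "y \<in> W_space T j" for y
  proof -
    have "\<exists>g. g \<in> L2_time T \<and> has_time_derivative T j y g" using that by (auto simp: W_space_def)
    from someI_ex[OF this] show "time_derivative T j y \<in> L2_time T"
      "has_time_derivative T j y (time_derivative T j y)"
      by (auto simp: time_derivative_def)
  qed
  have state: "lift_L2 J (emb T y) = ?V (dt y)" if "y \<in> state_space T j" for y
  proof -
    have "y \<in> W_space T j" "vanishes_at T j 0 y" "y \<in> L2_time T"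
      using that by (auto simp: state_space_def W_space_def)
    then show ?thesis
      using volt_if_time_derivative[OF time_order_less _ W, of y] by (simp add: start_def sg_def dt_def)
  qed
  \<comment> \<open>The minus sign is \<open>sg (>) = - 1\<close>.\<close>
  have adjoint: "lift_L2 J (emb T p) = ?W (- dt p)" if "p \<in> adjoint_space T j" for p
  proof -
    have "p \<in> W_space T j" "vanishes_at T j T p" "p \<in> L2_time T"
      using that by (auto simp: adjoint_space_def W_space_def)
    then show ?thesis
      using volt_if_time_derivative[OF time_order_greater _ W, of p] by (simp add: start_def sg_def dt_def)
  qed

  \<comment> \<open>Riesz representatives of the residuals of the state equation, tested with
    \<open>z\<close>, and of the adjoint equation, tested with \<open>q\<close>.\<close>
  define e1 e2 where "e1 y p = lift_L2 Sg (dt y) + lift_L2 A (emb T y) - lift_L2 D (emb T p) - f"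
    and "e2 y p = lift_L2 M (emb T y) - lift_L2 Sg (dt p) + lift_L2 A' (emb T p) - h" for y p
  have residual: "optimality_form T \<alpha> j tr ob (S \<mu>) (a \<mu>) (c \<mu>) (m \<mu>) (y, p) (z, q)
      - optimality_rhs T (m \<mu>) (G \<mu>) yd (z, q) = e1 y p \<bullet> emb T z + e2 y p \<bullet> emb T q"
    if y: "y \<in> W_space T j" and p: "p \<in> W_space T j" and z: "z \<in> L2_time T" and q: "q \<in> L2_time T"
    for y p z q
  proof -
    have yL: "y \<in> L2_time T" and pL: "p \<in> L2_time T" using y p by (auto simp: W_space_def)
    have gy: "(\<lambda>t. riesz (time_derivative T j y t)) \<in> L2_time T"
      and gp: "(\<lambda>t. riesz (time_derivative T j p t)) \<in> L2_time T"
      using W(1)[OF y] W(1)[OF p] by (auto intro: L2_time_bounded_linear[OF bounded_linear_riesz])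
    have pairing: "integrable ?I (\<lambda>t. E (u t) \<bullet> w t)" "(LINT t|?I. E (u t) \<bullet> w t) = lift_L2 E (emb T u) \<bullet> emb T w"
      if "bounded_linear E" "u \<in> L2_time T" "w \<in> L2_time T" for E and u w :: "real \<Rightarrow> 'y"
      using LINT_inner_emb[OF L2_time_bounded_linear[OF that(1,2)] that(3)] emb_lift[OF that(1,2)] by auto
    note t1 = pairing[OF Sg(1) gy z] and t2 = pairing[OF A(1) yL z] and t3 = pairing[OF D pL z]
      and t4 = pairing[OF M yL q] and t5 = pairing[OF Sg(1) gp q] and t6 = pairing[OF A'(1) pL q]
    have "a \<mu> (q t) (p t) = A' (p t) \<bullet> q t" for t
      using A'(2)[of "q t" "p t"] by (simp add: A(2) inner_commute)
    then have "optimality_form T \<alpha> j tr ob (S \<mu>) (a \<mu>) (c \<mu>) (m \<mu>) (y, p) (z, q) =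
        (LINT t|?I. Sg (riesz (time_derivative T j y t)) \<bullet> z t + A (y t) \<bullet> z t - D (p t) \<bullet> z t
           + M (y t) \<bullet> q t - Sg (riesz (time_derivative T j p t)) \<bullet> q t + A' (p t) \<bullet> q t)"
      by (simp add: optimality_form_def Sg(2) A(2) C(2) M0(2) D_def M_def)
    also have "\<dots> = lift_L2 Sg (dt y) \<bullet> emb T z + lift_L2 A (emb T y) \<bullet> emb T z
        - lift_L2 D (emb T p) \<bullet> emb T z + lift_L2 M (emb T y) \<bullet> emb T q
        - lift_L2 Sg (dt p) \<bullet> emb T q + lift_L2 A' (emb T p) \<bullet> emb T q"
      by (simp add: t1 t2 t3 t4 t5 t6 dt_def)
    finally have form: "optimality_form T \<alpha> j tr ob (S \<mu>) (a \<mu>) (c \<mu>) (m \<mu>) (y, p) (z, q) = \<dots>" .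
    have "optimality_rhs T (m \<mu>) (G \<mu>) yd (z, q) = h \<bullet> emb T q + f \<bullet> emb T z"
      by (simp add: optimality_rhs_def M0(2) f(2)[OF z] LINT_inner_emb(2)[OF M0yd q] h_def)
    with form show ?thesis
      by (simp add: e1_def e2_def inner_add_left inner_diff_left)
  qed
  have solves_iff: "solves_optimality T \<alpha> j tr ob (S \<mu>) (a \<mu>) (c \<mu>) (m \<mu>) (G \<mu>) yd (y, p) \<longleftrightarrow>
      e1 y p = 0 \<and> e2 y p = 0"
    if y: "y \<in> W_space T j" and p: "p \<in> W_space T j" for y p
  proof
    assume "e1 y p = 0 \<and> e2 y p = 0"
    then show "solves_optimality T \<alpha> j tr ob (S \<mu>) (a \<mu>) (c \<mu>) (m \<mu>) (G \<mu>) yd (y, p)"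
      using residual[OF y p] by (simp add: solves_optimality_def)
  next
    assume "solves_optimality T \<alpha> j tr ob (S \<mu>) (a \<mu>) (c \<mu>) (m \<mu>) (G \<mu>) yd (y, p)"
    then have orth: "e1 y p \<bullet> restr T F + e2 y p \<bullet> restr T F' = 0" for F F'
      using residual[OF y p fn_L2_time[of F T] fn_L2_time[of F' T]] fn_L2_time[of F T] fn_L2_time[of F' T]
      by (simp add: solves_optimality_def restr_def)
    have yL: "y \<in> L2_time T" and pL: "p \<in> L2_time T" using y p by (auto simp: W_space_def)
    have r0: "restr T (dt v) = dt v" if "v \<in> W_space T j" for v
      unfolding dt_def by (rule restr_emb[OF L2_time_bounded_linear[OF bounded_linear_riesz W(1)[OF that]]])
    \<comment> \<open>The residuals are supported in the interval and can therefore be tested with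
      themselves.\<close>
    have r: "restr T (e1 y p) = e1 y p" "restr T (e2 y p) = e2 y p"
      by (simp_all add: e1_def e2_def restr_lin restr_lift r0[OF y] r0[OF p] restr_emb[OF yL] restr_emb[OF pL] f(1) h)
    have "restr T (0 :: 'y L2) = 0" by (rule linear_0[OF linear_restr])
    then have "e1 y p \<bullet> e1 y p = 0" "e2 y p \<bullet> e2 y p = 0"
      using orth[of "e1 y p" 0] orth[of 0 "e2 y p"] r by auto
    then show "e1 y p = 0 \<and> e2 y p = 0" by simp
  qed

  obtain Y0 P0 where YP0: "lift_L2 B Y0 = ?V (f - lift_L2 A Y0 + lift_L2 D P0)"
    "lift_L2 B P0 = ?W (h - lift_L2 A' P0 - lift_L2 M Y0)"
    using sys.solvable by blast
  \<comment> \<open>\<open>restr T\<close> commutes with every operator of the system and fixes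
    \<open>f\<close> and \<open>h\<close>, so the restricted pair solves the same equations.\<close>
  define Y Q where "Y = restr T Y0" and "Q = restr T P0"
  define g k where "g = f - lift_L2 A Y + lift_L2 D Q" and "k = h - lift_L2 A' Q - lift_L2 M Y"
  have YQ: "restr T Y = Y" "restr T Q = Q" by (simp_all add: Y_def Q_def restr_idem)
  have "restr T (lift_L2 B Y0) = ?V g" "restr T (lift_L2 B P0) = ?W k"
    unfolding YP0 restr_volt[OF time_order_less] restr_volt[OF time_order_greater]
    by (simp_all add: g_def k_def restr_lin restr_lift f(1) h Y_def Q_def)
  then have BY: "lift_L2 B Y = ?V g" "lift_L2 B Q = ?W k" by (simp_all add: restr_lift Y_def Q_def)
  \<comment> \<open>Cancelling \<open>Sg\<close> exposes \<open>lift_L2 R g\<close> as the class of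
    the time derivative.\<close>
  have JY: "lift_L2 J Y = ?V (lift_L2 R g)"
    using arg_cong[OF BY(1), of "lift_L2 R"] by (simp add: lift_B lift_RSg volt_lift_L2[OF time_order_less R(1)])
  have JQ: "lift_L2 J Q = ?W (lift_L2 R k)"
    using arg_cong[OF BY(2), of "lift_L2 R"] by (simp add: lift_B lift_RSg volt_lift_L2[OF time_order_greater R(1)])
  define y p where "y = fn Y" and "p = fn Q"
  have emb_y: "emb T y = Y" and emb_p: "emb T p = Q" using YQ by (auto simp: y_def p_def restr_def)
  have y: "y \<in> state_space T j" and p: "p \<in> adjoint_space T j"
    using W_space_if_volt[OF time_order_less JY] W_space_if_volt[OF time_order_greater JQ]
    by (auto simp: state_space_def adjoint_space_def y_def p_def start_def)
  have yW: "v \<in> W_space T j" if "v \<in> state_space T j" for v using that by (simp add: state_space_def)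
  have pW: "v \<in> W_space T j" if "v \<in> adjoint_space T j" for v using that by (simp add: adjoint_space_def)
  \<comment> \<open>\<open>time_derivative\<close> is some choice among admissible derivatives;
    injectivity of \<open>?V\<close> forces its class to be the expected one.\<close>
  have "?V (dt y - lift_L2 R g) = 0"
    using state[OF y] JY by (simp add: emb_y linear_diff[OF bounded_linear.linear[OF vp.V]])
  then have dt_y: "lift_L2 Sg (dt y) = g" using vp.V_inj[of "dt y - lift_L2 R g"] by (simp add: lift_SgR)
  have "?W (- dt p - lift_L2 R k) = 0"
    using adjoint[OF p] JQ by (simp add: emb_p linear_diff[OF bounded_linear.linear[OF vp.W]])
  then have "- dt p - lift_L2 R k = 0" by (rule vp.W_inj)
  then have "dt p = - lift_L2 R k" by (simp add: eq_neg_iff_add_eq_0 neg_eq_iff_add_eq_0 algebra_simps)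
  then have dt_p: "lift_L2 Sg (dt p) = - k"
    by (simp add: linear_neg[OF bounded_linear.linear[OF bounded_linear_lift_L2[OF Sg(1)]]] lift_SgR)
  have "e1 y p = 0" "e2 y p = 0"
    by (simp_all add: e1_def e2_def dt_y dt_p emb_y emb_p g_def k_def)
  then have sol: "solves_optimality T \<alpha> j tr ob (S \<mu>) (a \<mu>) (c \<mu>) (m \<mu>) (G \<mu>) yd (y, p)"
    using solves_iff[OF yW[OF y] pW[OF p]] by simp

  have "AE t in ?I. y' t = y t \<and> p' t = p t"
    if y': "y' \<in> state_space T j" and p': "p' \<in> adjoint_space T j"
      and sol': "solves_optimality T \<alpha> j tr ob (S \<mu>) (a \<mu>) (c \<mu>) (m \<mu>) (G \<mu>) yd (y', p')" for y' p'
  proof -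
    have e': "e1 y' p' = 0" "e2 y' p' = 0" using sol' solves_iff[OF yW[OF y'] pW[OF p']] by auto
    note lin = bounded_linear.linear[OF bounded_linear_lift_L2[OF Sg(1)]]
      bounded_linear.linear[OF bounded_linear_lift_L2[OF A(1)]]
      bounded_linear.linear[OF bounded_linear_lift_L2[OF A'(1)]]
      bounded_linear.linear[OF bounded_linear_lift_L2[OF D]]
      bounded_linear.linear[OF bounded_linear_lift_L2[OF M]]
      bounded_linear.linear[OF bounded_linear_lift_L2[OF J]]
      bounded_linear.linear[OF vp.V] bounded_linear.linear[OF vp.W]
    define dY dP where "dY = emb T y' - emb T y" and "dP = emb T p' - emb T p"
    \<comment> \<open>The reversed difference in \<open>dk\<close> matches the sign in
      \<open>adjoint\<close>; the differences solve the homogeneous system.\<close>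
    define dg dk where "dg = lift_L2 Sg (dt y' - dt y)" and "dk = lift_L2 Sg (dt p - dt p')"
    have "lift_L2 B dY = ?V dg"
      unfolding lift_B dY_def dg_def
      by (simp add: lin[THEN linear_diff] state[OF y] state[OF y'] volt_lift_L2[OF time_order_less Sg(1)])
    moreover have "lift_L2 B dP = ?W dk"
      unfolding lift_B dP_def dk_def
      by (simp add: lin[THEN linear_diff] lin[THEN linear_neg] adjoint[OF p] adjoint[OF p']
          volt_lift_L2[OF time_order_greater Sg(1)])
    moreover have "dg + lift_L2 A dY - lift_L2 D dP = e1 y' p' - e1 y p"
      by (simp add: dg_def dY_def dP_def e1_def lin[THEN linear_diff])
    moreover have "dk + lift_L2 A' dP + lift_L2 M dY = e2 y' p' - e2 y p"
      by (simp add: dk_def dY_def dP_def e2_def lin[THEN linear_diff])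
    ultimately have "dY = 0" "dP = 0"
      using sys.unique[of dY dg dP dk] e' \<open>e1 y p = 0\<close> \<open>e2 y p = 0\<close> by simp_all
    then have "emb T y' = emb T y" "emb T p' = emb T p" by (simp_all add: dY_def dP_def)
    moreover have "y \<in> L2_time T" "p \<in> L2_time T" "y' \<in> L2_time T" "p' \<in> L2_time T"
      using yW[OF y] yW[OF y'] pW[OF p] pW[OF p'] by (simp_all add: W_space_def)
    ultimately have "AE t in ?I. y' t = y t" "AE t in ?I. p' t = p t"
      by (simp_all add: emb_eq_iff)
    then show ?thesis by eventually_elim simp
  qed
  with y p sol show ?thesis by blast
qed

end

theorem theorem1:
  fixes \<Omega> \<Omega>obs \<Omega>u :: "(real^'n) set"
    and \<nu> :: "(real^'n) measure"
    and j :: "'y::{real_inner,complete_space,second_countable_topology}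
              \<Rightarrow> 'h::{real_inner,complete_space,second_countable_topology}"
    and tr :: "'y \<Rightarrow> 'u::{real_inner,complete_space}"
    and ob :: "'y \<Rightarrow> 'o::{real_inner,complete_space}"
    and P :: "(real^'d) set"
    and T \<alpha> :: real
  assumes "0 < T" and "0 < \<alpha>" and "\<alpha> \<le> 1"
    and "parabolic_ocp \<Omega> \<Omega>obs \<Omega>u \<nu> j tr ob rH rU P T a S QS cS \<Omega>S c QC cC \<Omega>C m wm G"
  shows "\<forall>\<mu> \<in> P. \<forall>yd \<in> L2_time T.
           \<exists>y \<in> state_space T j. \<exists>p \<in> adjoint_space T j.
             solves_optimality T \<alpha> j tr ob (S \<mu>) (a \<mu>) (c \<mu>) (m \<mu>) (G \<mu>) yd (y, p) \<and>
             (\<forall>y' \<in> state_space T j. \<forall>p' \<in> adjoint_space T j.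
                solves_optimality T \<alpha> j tr ob (S \<mu>) (a \<mu>) (c \<mu>) (m \<mu>) (G \<mu>) yd (y', p') \<longrightarrow>
                (AE t in lebesgue_on {0<..<T}. y' t = y t \<and> p' t = p t))"
  using parabolic_ocp.wellposed[OF assms(4) assms(1) assms(2)] by blast

end
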